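(* (A) Let $X$ be a space. Each arrow $A\to B$ below means that if $X$ is an $A$-nonmeager space then $X$ is a $B$-nonmeager space, and if $X$ is an $A$-Baire space then $X$ is a $B$-Baire space. The following arrows hold: - $\Gamma^{BM}_f\to\Gamma^{\widehat{BM}}_f\to\Delta_s$; - $\Gamma^{OD}_{p,l}\to\Gamma^{\widehat{OD}}_{p,l}\to\Delta_h$; - $\Gamma^{OD}_{o,l}\to\Gamma^{\widehat{OD}}_{o,l}\to\Delta$; - $\Gamma^{BM}_f\to\Gamma^{OD}_{p,l}\to\Gamma^{OD}_{o,l}$; - $\Gamma^{\widehat{BM}}_f\to\Gamma^{\widehat{OD}}_{p,l}\to\Gamma^{\widehat{OD}}_{o,l}$; - $\Delta_s\to\Delta_h\to\Delta$. (B) Let $\mathcal P_k$ (respectively $\mathcal P_c$) be the smallest class of spaces that contains $p$-spaces and strongly $\Sigma$-spaces, is closed under arbitrary (respectively countable) products, and is closed under taking open subspaces. Let $\widetilde\Delta\in\{\Delta_s,\Delta_h,\Delta\}$. If a regular Baire (respectively nonmeager) space $X$ belongs to the class of spaces described in $(\widetilde\Delta)$ below, then $X$ is $\widetilde\Delta$-Baire (respectively $\widetilde\Delta$-nonmeager). - $(\Delta_s)$: the class of $\sigma$-spaces. - $(\Delta_h)$: the smallest class of spaces that contains $\Sigma$-spaces and $w\Delta$-spaces, is closed under products by spaces from the class $\mathcal P_c$, and is closed under taking open subspaces. - $(\Delta)$: the smallest class of spaces that contains $\Sigma$-spaces, $w\Delta$-spaces and feebly compact spaces, is closed under products by spaces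 from the class $\mathcal P_k$, and is closed under taking open subspaces.
   Context: Spaces are nonempty topological spaces. $\mathcal T$ is the topology of $X$, $\mathcal T^*=\mathcal T\setminus\{\emptyset\}$. **Semi-neighborhoods.** For $P\subset X\times X$, $P(x)=\{y:(x,y)\in P\}$. $P$ is a semi-neighborhood of the diagonal if $x\in\operatorname{Int}P(x)$ for all $x\in X$. For $\widetilde\Delta\in\{\Delta,\Delta_h,\Delta_s\}$, $X$ is $\widetilde\Delta$-nonmeager (respectively $\widetilde\Delta$-Baire) if for every semi-neighborhood of the diagonal $P$ (and every nonempty open $O\subset X$) there is a nonempty open $W\subset X$ (respectively $W\subset O$) such that - for $\Delta$: $P\cap(W\times W)$ is dense in $W\times W$; - for $\Delta_h$: for every $y\in W$ the set $\{x\in W:(x,y)\in P\}$ is dense in $W$; - for $\Delta_s$: there is a dense subset $M$ of $W$ with $M\times W\subset P$. **Games.** Two players $\alpha,\beta$ move alternately. Games $BM_f(X)$ and $MB_f(X)$: on move $0$, $\alpha$ chooses $U_0=X$ in $BM_f(X)$, and an arbitrary $U_0\in\mathcal T^*$ in $MB_f(X)$; $\beta$ chooses $V_0\in\mathcal T^*$, $V_0\subset U_0$. On move $n\ge1$, $\alpha$ chooses $U_n\in\mathcal T^*$, $U_n\subset V_{n-1}$, and $\beta$ chooses $V_n\in\mathcal T^*$, $V_n\subset U_n$. Player $\alpha$ wins if there is $x\in\bigcap_nV_n$ such that $(V_n)_{n\in\omega}$ is a base at $x$; otherwise $\beta$ wins. Let $\mathcal N$ be a $\pi$-net of $X$ (a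 family of nonempty subsets such that each nonempty open set contains a member of $\mathcal N$). Games $OD_l(X,\mathcal N)$ and $DO_l(X,\mathcal N)$: the first move of $\alpha$ is $U_0=X$ in $OD_l$ and an arbitrary $U_0\in\mathcal T^*$ in $DO_l$; $\beta$ chooses $V_0\in\mathcal T^*$, $V_0\subset U_0$, and $M_0\in\mathcal N$, $M_0\subset U_0$. On move $n\ge1$, $\alpha$ chooses $U_n\in\mathcal T^*$, $U_n\subset V_{n-1}$, and $\beta$ chooses $V_n\in\mathcal T^*$, $V_n\subset U_n$, and $M_n\in\mathcal N$, $M_n\subset U_n$. Player $\alpha$ wins if $\operatorname{Ls}_{n}M_n\cap\bigcap_nV_n\ne\emptyset$, where $\operatorname{Ls}_nM_n$ is the set of $x\in X$ such that every neighborhood of $x$ meets $M_n$ for infinitely many $n$; otherwise $\beta$ wins. $OD_{o,l}(X)$, $DO_{o,l}(X)$ are these games with $\mathcal N=\mathcal T^*$, and $OD_{p,l}(X)$, $DO_{p,l}(X)$ those with $\mathcal N=\{\{x\}:x\in X\}$. A game is $\beta$-unfavorable if $\beta$ has no winning strategy (strategies may depend on all previous moves). $X$ is $\Gamma^{BM}_f$-Baire (respectively $\Gamma^{BM}_f$-nonmeager) if $BM_f(X)$ (respectively $MB_f(X)$) is $\beta$-unfavorable. For $k\in\{o,p\}$, $X$ is $\Gamma^{OD}_{k,l}$-Baire (respectively -nonmeager) if $OD_{k,l}(X)$ (respectively $DO_{k,l}(X)$) is $\beta$-unfavorable. A tactic of $\beta$ is a strategy in which each move of $\beta$ depends only on the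 last move $U_n$ of $\alpha$ (so $V_n=\varphi(U_n)$, and, where applicable, $M_n=\psi(U_n)$, for fixed functions $\varphi,\psi$ on $\mathcal T^*$). The classes with a hat, $\Gamma^{\widehat{BM}}_f$, $\Gamma^{\widehat{OD}}_{p,l}$, $\Gamma^{\widehat{OD}}_{o,l}$ (-Baire and -nonmeager), are defined in the same way, with "$\beta$ has no winning strategy" replaced by "$\beta$ has no winning tactic". **Classes of spaces.** A space is nonmeager if it is not a countable union of nowhere dense subsets of itself; it is Baire if every intersection of countably many dense open sets is dense. A space is feebly compact if every locally finite family of nonempty open sets is finite. The remaining notions are the standard ones of the theory of generalized metric spaces: - $\sigma$-space: a space with a $\sigma$-discrete network. - $\Sigma$-space (respectively strongly $\Sigma$-space): there exist a $\sigma$-locally finite family $\mathcal F$ of closed sets and a cover $\mathcal C$ of the space by closed countably compact (respectively compact) sets such that whenever $C\in\mathcal C$, $C\subset U$, $U$ open, there is $F\in\mathcal F$ with $C\subset F\subset U$. - $w\Delta$-space: there is a sequence $(\mathcal G_n)_{n\in\omega}$ of open covers such that whenever $x\in X$ and $x_n\in\operatorname{st}(x,\mathcal G_n)=\bigcup\{G\in\mathcal G_n:x\in G\}$ for all $n$, the sequence $(x_n)$ has a cluster point. - $p$-space: a completely regular (Tychonoff) space $X$ for which there is a sequence $(\mathcal U_n)_{n\in\omega}$ of families of open subsets of $\beta X$, each covering $X$, with $\bigcap_n\operatorname{st}(x,\mathcal U_n)\subset X$ for every $x\in X$. A class $\mathcal K$ is closed under products by spaces from a class $\mathcal P$ if $X\times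 Y\in\mathcal K$ whenever $X\in\mathcal K$ and $Y\in\mathcal P$.
   Formalization: In (B) the generating Σ-spaces, strongly Σ-spaces, wΔ-spaces and feebly compact spaces are taken to be regular; otherwise every space U is open in a compact space (add a point whose only neighborhood is the whole space), and the Sorgenfrey line refutes the claims for Δ_h and Δ. *)

theory Defs
  imports "HOL-Analysis.Analysis"
begin

section \<open>Semi-neighborhoods of the diagonal\<close>

definition nonempty_open :: "'a topology \<Rightarrow> 'a set set" where
  "nonempty_open X = {U. openin X U \<and> U \<noteq> {}}"

definition dense_subset :: "'a topology \<Rightarrow> 'a set \<Rightarrow> 'a set \<Rightarrow> bool" where
  "dense_subset X W D \<longleftrightarrow> D \<subseteq> W \<and> W \<subseteq> X closure_of D"

definition semi_neighborhood :: "'a topology \<Rightarrow> ('a \<times> 'a) set \<Rightarrow> bool" where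
  "semi_neighborhood X P \<longleftrightarrow>
     P \<subseteq> topspace X \<times> topspace X \<and> (\<forall>x\<in>topspace X. x \<in> X interior_of (P `` {x}))"

definition good_Delta :: "'a topology \<Rightarrow> ('a \<times> 'a) set \<Rightarrow> 'a set \<Rightarrow> bool" where
  "good_Delta X P W \<longleftrightarrow> dense_subset (prod_topology X X) (W \<times> W) (P \<inter> (W \<times> W))"

definition good_Delta_h :: "'a topology \<Rightarrow> ('a \<times> 'a) set \<Rightarrow> 'a set \<Rightarrow> bool" where
  "good_Delta_h X P W \<longleftrightarrow> (\<forall>y\<in>W. dense_subset X W {x \<in> W. (x, y) \<in> P})"

definition good_Delta_s :: "'a topology \<Rightarrow> ('a \<times> 'a) set \<Rightarrow> 'a set \<Rightarrow> bool" where
  "good_Delta_s X P W \<longleftrightarrow> (\<exists>M. dense_subset X W M \<and> M \<times> W \<subseteq> P)"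

definition Delta_nonmeager :: "'a topology \<Rightarrow> bool" where
  "Delta_nonmeager X \<longleftrightarrow>
     (\<forall>P. semi_neighborhood X P \<longrightarrow> (\<exists>W\<in>nonempty_open X. good_Delta X P W))"

definition Delta_Baire :: "'a topology \<Rightarrow> bool" where
  "Delta_Baire X \<longleftrightarrow>
     (\<forall>P. semi_neighborhood X P \<longrightarrow>
       (\<forall>Q\<in>nonempty_open X. \<exists>W\<in>nonempty_open X. W \<subseteq> Q \<and> good_Delta X P W))"

definition Delta_h_nonmeager :: "'a topology \<Rightarrow> bool" where
  "Delta_h_nonmeager X \<longleftrightarrow>
     (\<forall>P. semi_neighborhood X P \<longrightarrow> (\<exists>W\<in>nonempty_open X. good_Delta_h X P W))"

definition Delta_h_Baire :: "'a topology \<Rightarrow> bool" where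
  "Delta_h_Baire X \<longleftrightarrow>
     (\<forall>P. semi_neighborhood X P \<longrightarrow>
       (\<forall>Q\<in>nonempty_open X. \<exists>W\<in>nonempty_open X. W \<subseteq> Q \<and> good_Delta_h X P W))"

definition Delta_s_nonmeager :: "'a topology \<Rightarrow> bool" where
  "Delta_s_nonmeager X \<longleftrightarrow>
     (\<forall>P. semi_neighborhood X P \<longrightarrow> (\<exists>W\<in>nonempty_open X. good_Delta_s X P W))"

definition Delta_s_Baire :: "'a topology \<Rightarrow> bool" where
  "Delta_s_Baire X \<longleftrightarrow>
     (\<forall>P. semi_neighborhood X P \<longrightarrow>
       (\<forall>Q\<in>nonempty_open X. \<exists>W\<in>nonempty_open X. W \<subseteq> Q \<and> good_Delta_s X P W))"

section \<open>Topological games\<close>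

text \<open>A move of the first player is a set \<open>U\<^sub>n\<close>; a move of the second player has a type \<open>'m\<close>,
  and its open part \<open>V\<^sub>n\<close> restricts the next move of the first player.\<close>

record ('a, 'm) game =
  first_moves :: "'a set set"
  later_moves :: "'a set set"
  open_part :: "'m \<Rightarrow> 'a set"
  replies :: "'a set \<Rightarrow> 'm set"
  alpha_wins :: "(nat \<Rightarrow> 'm) \<Rightarrow> bool"

type_synonym ('a, 'm) strategy = "('a set \<times> 'm) list \<Rightarrow> 'a set \<Rightarrow> 'm"

definition alpha_legal :: "('a, 'm) game \<Rightarrow> (nat \<Rightarrow> 'a set) \<Rightarrow> (nat \<Rightarrow> 'm) \<Rightarrow> nat \<Rightarrow> bool" where
  "alpha_legal G U m n \<longleftrightarrow>
     (if n = 0 then U 0 \<in> first_moves G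
      else U n \<in> later_moves G \<and> U n \<subseteq> open_part G (m (n - 1)))"

text \<open>The first argument of a strategy is the list of all earlier rounds. Legality of the replies
  has to be demanded after every finite legal beginning of a play and not only along infinite
  legal plays: otherwise a strategy could win by making an illegal move that leaves the opponent
  without a continuation.\<close>

definition beta_winning :: "('a, 'm) game \<Rightarrow> ('a, 'm) strategy \<Rightarrow> bool" where
  "beta_winning G s \<longleftrightarrow>
     (\<forall>U m. (\<forall>n. m n = s (map (\<lambda>i. (U i, m i)) [0..<n]) (U n)) \<longrightarrow>
        (\<forall>n. (\<forall>i\<le>n. alpha_legal G U m i) \<longrightarrow> m n \<in> replies G (U n)) \<and>
        ((\<forall>n. alpha_legal G U m n) \<longrightarrow> \<not> alpha_wins G m))"

definition beta_unfavorable :: "('a, 'm) game \<Rightarrow> bool" where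
  "beta_unfavorable G \<longleftrightarrow> (\<nexists>s. beta_winning G s)"

definition beta_unfavorable_hat :: "('a, 'm) game \<Rightarrow> bool" where
  "beta_unfavorable_hat G \<longleftrightarrow> (\<nexists>t :: 'a set \<Rightarrow> 'm. beta_winning G (\<lambda>_. t))"

definition base_at :: "'a topology \<Rightarrow> 'a \<Rightarrow> (nat \<Rightarrow> 'a set) \<Rightarrow> bool" where
  "base_at X x V \<longleftrightarrow>
     (\<forall>n. openin X (V n) \<and> x \<in> V n) \<and> (\<forall>G. openin X G \<and> x \<in> G \<longrightarrow> (\<exists>n. V n \<subseteq> G))"

definition BM_f :: "'a topology \<Rightarrow> ('a, 'a set) game" where
  "BM_f X =
     \<lparr>first_moves = {topspace X},
      later_moves = nonempty_open X,
      open_part = id,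
      replies = (\<lambda>U. {V \<in> nonempty_open X. V \<subseteq> U}),
      alpha_wins = (\<lambda>V. \<exists>x\<in>(\<Inter>n. V n). base_at X x V)\<rparr>"

definition MB_f :: "'a topology \<Rightarrow> ('a, 'a set) game" where
  "MB_f X = (BM_f X)\<lparr>first_moves := nonempty_open X\<rparr>"

definition Ls :: "'a topology \<Rightarrow> (nat \<Rightarrow> 'a set) \<Rightarrow> 'a set" where
  "Ls X M = {x \<in> topspace X. \<forall>G. openin X G \<and> x \<in> G \<longrightarrow> infinite {n. M n \<inter> G \<noteq> {}}}"

definition OD_l :: "'a topology \<Rightarrow> 'a set set \<Rightarrow> ('a, 'a set \<times> 'a set) game" where
  "OD_l X N =
     \<lparr>first_moves = {topspace X},
      later_moves = nonempty_open X,
      open_part = fst,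
      replies = (\<lambda>U. {(V, M). V \<in> nonempty_open X \<and> V \<subseteq> U \<and> M \<in> N \<and> M \<subseteq> U}),
      alpha_wins = (\<lambda>m. Ls X (\<lambda>n. snd (m n)) \<inter> (\<Inter>n. fst (m n)) \<noteq> {})\<rparr>"

definition DO_l :: "'a topology \<Rightarrow> 'a set set \<Rightarrow> ('a, 'a set \<times> 'a set) game" where
  "DO_l X N = (OD_l X N)\<lparr>first_moves := nonempty_open X\<rparr>"

definition singletons :: "'a topology \<Rightarrow> 'a set set" where
  "singletons X = {{x} | x. x \<in> topspace X}"

definition Gamma_BM_f_Baire :: "'a topology \<Rightarrow> bool" where
  "Gamma_BM_f_Baire X \<longleftrightarrow> beta_unfavorable (BM_f X)"

definition Gamma_BM_f_nonmeager :: "'a topology \<Rightarrow> bool" where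
  "Gamma_BM_f_nonmeager X \<longleftrightarrow> beta_unfavorable (MB_f X)"

definition Gamma_OD_pl_Baire :: "'a topology \<Rightarrow> bool" where
  "Gamma_OD_pl_Baire X \<longleftrightarrow> beta_unfavorable (OD_l X (singletons X))"

definition Gamma_OD_pl_nonmeager :: "'a topology \<Rightarrow> bool" where
  "Gamma_OD_pl_nonmeager X \<longleftrightarrow> beta_unfavorable (DO_l X (singletons X))"

definition Gamma_OD_ol_Baire :: "'a topology \<Rightarrow> bool" where
  "Gamma_OD_ol_Baire X \<longleftrightarrow> beta_unfavorable (OD_l X (nonempty_open X))"

definition Gamma_OD_ol_nonmeager :: "'a topology \<Rightarrow> bool" where
  "Gamma_OD_ol_nonmeager X \<longleftrightarrow> beta_unfavorable (DO_l X (nonempty_open X))"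

definition Gamma_hat_BM_f_Baire :: "'a topology \<Rightarrow> bool" where
  "Gamma_hat_BM_f_Baire X \<longleftrightarrow> beta_unfavorable_hat (BM_f X)"

definition Gamma_hat_BM_f_nonmeager :: "'a topology \<Rightarrow> bool" where
  "Gamma_hat_BM_f_nonmeager X \<longleftrightarrow> beta_unfavorable_hat (MB_f X)"

definition Gamma_hat_OD_pl_Baire :: "'a topology \<Rightarrow> bool" where
  "Gamma_hat_OD_pl_Baire X \<longleftrightarrow> beta_unfavorable_hat (OD_l X (singletons X))"

definition Gamma_hat_OD_pl_nonmeager :: "'a topology \<Rightarrow> bool" where
  "Gamma_hat_OD_pl_nonmeager X \<longleftrightarrow> beta_unfavorable_hat (DO_l X (singletons X))"

definition Gamma_hat_OD_ol_Baire :: "'a topology \<Rightarrow> bool" where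
  "Gamma_hat_OD_ol_Baire X \<longleftrightarrow> beta_unfavorable_hat (OD_l X (nonempty_open X))"

definition Gamma_hat_OD_ol_nonmeager :: "'a topology \<Rightarrow> bool" where
  "Gamma_hat_OD_ol_nonmeager X \<longleftrightarrow> beta_unfavorable_hat (DO_l X (nonempty_open X))"

section \<open>Classes of spaces\<close>

definition nowhere_dense_in :: "'a topology \<Rightarrow> 'a set \<Rightarrow> bool" where
  "nowhere_dense_in X A \<longleftrightarrow> A \<subseteq> topspace X \<and> X interior_of (X closure_of A) = {}"

definition nonmeager_space :: "'a topology \<Rightarrow> bool" where
  "nonmeager_space X \<longleftrightarrow>
     \<not> (\<exists>A :: nat \<Rightarrow> 'a set. (\<forall>n. nowhere_dense_in X (A n)) \<and> topspace X = (\<Union>n. A n))"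

definition Baire_space :: "'a topology \<Rightarrow> bool" where
  "Baire_space X \<longleftrightarrow>
     (\<forall>G :: nat \<Rightarrow> 'a set. (\<forall>n. openin X (G n) \<and> dense_subset X (topspace X) (G n)) \<longrightarrow>
        dense_subset X (topspace X) (\<Inter>n. G n))"

definition feebly_compact_space :: "'a topology \<Rightarrow> bool" where
  "feebly_compact_space X \<longleftrightarrow>
     (\<forall>\<U>. \<U> \<subseteq> nonempty_open X \<and> locally_finite_in X \<U> \<longrightarrow> finite \<U>)"

definition discrete_family_in :: "'a topology \<Rightarrow> 'a set set \<Rightarrow> bool" where
  "discrete_family_in X \<D> \<longleftrightarrow>
     \<Union>\<D> \<subseteq> topspace X \<and>
     (\<forall>x\<in>topspace X. \<exists>V. openin X V \<and> x \<in> V \<and>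
        (\<forall>D\<in>\<D>. \<forall>E\<in>\<D>. D \<inter> V \<noteq> {} \<and> E \<inter> V \<noteq> {} \<longrightarrow> D = E))"

definition network_of :: "'a topology \<Rightarrow> 'a set set \<Rightarrow> bool" where
  "network_of X \<N> \<longleftrightarrow>
     \<Union>\<N> \<subseteq> topspace X \<and> (\<forall>U x. openin X U \<and> x \<in> U \<longrightarrow> (\<exists>F\<in>\<N>. x \<in> F \<and> F \<subseteq> U))"

definition sigma_space :: "'a topology \<Rightarrow> bool" where
  "sigma_space X \<longleftrightarrow>
     (\<exists>\<N> :: nat \<Rightarrow> 'a set set.
        (\<forall>n. discrete_family_in X (\<N> n)) \<and> network_of X (\<Union>n. \<N> n))"

definition countably_compactin :: "'a topology \<Rightarrow> 'a set \<Rightarrow> bool" where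
  "countably_compactin X S \<longleftrightarrow>
     S \<subseteq> topspace X \<and>
     (\<forall>\<U>. countable \<U> \<and> (\<forall>U\<in>\<U>. openin X U) \<and> S \<subseteq> \<Union>\<U> \<longrightarrow>
        (\<exists>\<F>. finite \<F> \<and> \<F> \<subseteq> \<U> \<and> S \<subseteq> \<Union>\<F>))"

definition Sigma_network :: "'a topology \<Rightarrow> 'a set set \<Rightarrow> (nat \<Rightarrow> 'a set set) \<Rightarrow> bool" where
  "Sigma_network X \<C> \<F> \<longleftrightarrow>
     (\<forall>C\<in>\<C>. closedin X C) \<and> \<Union>\<C> = topspace X \<and>
     (\<forall>n. locally_finite_in X (\<F> n) \<and> (\<forall>F\<in>\<F> n. closedin X F)) \<and>
     (\<forall>C U. C \<in> \<C> \<and> openin X U \<and> C \<subseteq> U \<longrightarrow> (\<exists>F\<in>(\<Union>n. \<F> n). C \<subseteq> F \<and> F \<subseteq> U))"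

definition Sigma_space :: "'a topology \<Rightarrow> bool" where
  "Sigma_space X \<longleftrightarrow>
     (\<exists>\<C> \<F>. Sigma_network X \<C> \<F> \<and> (\<forall>C\<in>\<C>. countably_compactin X C))"

definition strongly_Sigma_space :: "'a topology \<Rightarrow> bool" where
  "strongly_Sigma_space X \<longleftrightarrow>
     (\<exists>\<C> \<F>. Sigma_network X \<C> \<F> \<and> (\<forall>C\<in>\<C>. compactin X C))"

definition star :: "'a \<Rightarrow> 'a set set \<Rightarrow> 'a set" where
  "star x \<G> = \<Union>{G \<in> \<G>. x \<in> G}"

definition cluster_point_of :: "'a topology \<Rightarrow> (nat \<Rightarrow> 'a) \<Rightarrow> 'a \<Rightarrow> bool" where
  "cluster_point_of X s z \<longleftrightarrow>
     z \<in> topspace X \<and> (\<forall>G. openin X G \<and> z \<in> G \<longrightarrow> infinite {n. s n \<in> G})"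

definition wDelta_space :: "'a topology \<Rightarrow> bool" where
  "wDelta_space X \<longleftrightarrow>
     (\<exists>\<G> :: nat \<Rightarrow> 'a set set.
        (\<forall>n. (\<forall>G\<in>\<G> n. openin X G) \<and> \<Union>(\<G> n) = topspace X) \<and>
        (\<forall>x\<in>topspace X. \<forall>s. (\<forall>n. s n \<in> star x (\<G> n)) \<longrightarrow> (\<exists>z. cluster_point_of X s z)))"

text \<open>The Stone--Cech compactification of a Tychonoff space, as the closure of its image
  in the cube whose coordinates are the continuous functions into the unit interval.
  The index functions are taken extensional, so that a function on the space occurs
  only once.\<close>

definition unit_maps :: "'a topology \<Rightarrow> ('a \<Rightarrow> real) set" where
  "unit_maps X = {f \<in> extensional (topspace X). continuous_map X (top_of_set {0..1}) f}"

definition SC_embed :: "'a topology \<Rightarrow> 'a \<Rightarrow> (('a \<Rightarrow> real) \<Rightarrow> real)" where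
  "SC_embed X x = (\<lambda>f\<in>unit_maps X. f x)"

definition unit_cube :: "'a topology \<Rightarrow> (('a \<Rightarrow> real) \<Rightarrow> real) topology" where
  "unit_cube X = product_topology (\<lambda>_. top_of_set {0..1}) (unit_maps X)"

definition Stone_Cech :: "'a topology \<Rightarrow> (('a \<Rightarrow> real) \<Rightarrow> real) topology" where
  "Stone_Cech X = subtopology (unit_cube X) (unit_cube X closure_of (SC_embed X ` topspace X))"

definition p_space :: "'a topology \<Rightarrow> bool" where
  "p_space X \<longleftrightarrow>
     completely_regular_space X \<and> Hausdorff_space X \<and>
     (\<exists>\<U> :: nat \<Rightarrow> (('a \<Rightarrow> real) \<Rightarrow> real) set set.
        (\<forall>n. (\<forall>G\<in>\<U> n. openin (Stone_Cech X) G) \<and> SC_embed X ` topspace X \<subseteq> \<Union>(\<U> n)) \<and>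
        (\<forall>x\<in>topspace X. (\<Inter>n. star (SC_embed X x) (\<U> n)) \<subseteq> SC_embed X ` topspace X))"

section \<open>Generated classes\<close>

text \<open>A class of spaces cannot range over all types. The classes below are generated inside an
  arbitrary type \<open>'u\<close> serving as a universe: it carries the spaces, and it indexes arbitrary
  products. Products are taken up to homeomorphism, to remain in the universe. A member of one
  of the classes is obtained by a well-founded derivation that involves a set of spaces and index
  sets, all of which embed into some sufficiently large universe; membership of a space on any
  type \<open>'a\<close> is then expressed by a homeomorphism with a member of the class generated in \<open>'u\<close>.

  As is customary for generalized metric spaces, the generating spaces are regular (for \<open>p\<close>-spaces
  this is part of the definition). Without this requirement the classes would contain every space:
  adding to a space \<open>U\<close> a point whose only neighborhood is the whole space gives a compact space,
  hence a strongly \<open>\<Sigma>\<close>-space, in which \<open>U\<close> is open.\<close>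

inductive class_Pk :: "'u topology \<Rightarrow> bool" where
  Pk_p: "topspace Y \<noteq> {} \<Longrightarrow> p_space Y \<Longrightarrow> class_Pk Y"
| Pk_Sigma: "topspace Y \<noteq> {} \<Longrightarrow> regular_space Y \<Longrightarrow> strongly_Sigma_space Y \<Longrightarrow> class_Pk Y"
| Pk_product: "(\<And>i. i \<in> I \<Longrightarrow> class_Pk (F i)) \<Longrightarrow>
     Z homeomorphic_space product_topology F (I :: 'u set) \<Longrightarrow> class_Pk Z"
| Pk_open: "class_Pk Y \<Longrightarrow> openin Y U \<Longrightarrow> U \<noteq> {} \<Longrightarrow> class_Pk (subtopology Y U)"

inductive class_Pc :: "'u topology \<Rightarrow> bool" where
  Pc_p: "topspace Y \<noteq> {} \<Longrightarrow> p_space Y \<Longrightarrow> class_Pc Y"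
| Pc_Sigma: "topspace Y \<noteq> {} \<Longrightarrow> regular_space Y \<Longrightarrow> strongly_Sigma_space Y \<Longrightarrow> class_Pc Y"
| Pc_product: "(\<And>i. i \<in> I \<Longrightarrow> class_Pc (F i)) \<Longrightarrow>
     Z homeomorphic_space product_topology F (I :: nat set) \<Longrightarrow> class_Pc Z"
| Pc_open: "class_Pc Y \<Longrightarrow> openin Y U \<Longrightarrow> U \<noteq> {} \<Longrightarrow> class_Pc (subtopology Y U)"

inductive class_Kh :: "'u topology \<Rightarrow> bool" where
  Kh_Sigma: "topspace Y \<noteq> {} \<Longrightarrow> regular_space Y \<Longrightarrow> Sigma_space Y \<Longrightarrow> class_Kh Y"
| Kh_wDelta: "topspace Y \<noteq> {} \<Longrightarrow> regular_space Y \<Longrightarrow> wDelta_space Y \<Longrightarrow> class_Kh Y"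
| Kh_product: "class_Kh Y \<Longrightarrow> class_Pc (T :: 'u topology) \<Longrightarrow>
     Z homeomorphic_space prod_topology Y T \<Longrightarrow> class_Kh Z"
| Kh_open: "class_Kh Y \<Longrightarrow> openin Y U \<Longrightarrow> U \<noteq> {} \<Longrightarrow> class_Kh (subtopology Y U)"

inductive class_K :: "'u topology \<Rightarrow> bool" where
  K_Sigma: "topspace Y \<noteq> {} \<Longrightarrow> regular_space Y \<Longrightarrow> Sigma_space Y \<Longrightarrow> class_K Y"
| K_wDelta: "topspace Y \<noteq> {} \<Longrightarrow> regular_space Y \<Longrightarrow> wDelta_space Y \<Longrightarrow> class_K Y"
| K_feebly: "topspace Y \<noteq> {} \<Longrightarrow> regular_space Y \<Longrightarrow> feebly_compact_space Y \<Longrightarrow> class_K Y"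
| K_product: "class_K Y \<Longrightarrow> class_Pk (T :: 'u topology) \<Longrightarrow>
     Z homeomorphic_space prod_topology Y T \<Longrightarrow> class_K Z"
| K_open: "class_K Y \<Longrightarrow> openin Y U \<Longrightarrow> U \<noteq> {} \<Longrightarrow> class_K (subtopology Y U)"

definition in_class_Delta_h :: "'u itself \<Rightarrow> 'a topology \<Rightarrow> bool" where
  "in_class_Delta_h _ X \<longleftrightarrow> (\<exists>Z :: 'u topology. class_Kh Z \<and> X homeomorphic_space Z)"

definition in_class_Delta :: "'u itself \<Rightarrow> 'a topology \<Rightarrow> bool" where
  "in_class_Delta _ X \<longleftrightarrow> (\<exists>Z :: 'u topology. class_K Z \<and> X homeomorphic_space Z)"

end

theory Submission
  imports Defs
begin

text \<open>The implications between games come from translating replies: the second player wins \<open>BM\<close>-type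
games with the open parts of replies that win an \<open>OD\<close>-type game, and wins with points chosen in
open sets whenever the open sets win. Translating a whole strategy requires the new strategy to
reconstruct the play of the old game from the moves of the opponent.

For the passage from stationary strategies to the \<open>\<Delta>\<close>-properties, suppose that no nonempty open
\<open>W \<subseteq> Q\<close> is good for \<open>P\<close>. Every such \<open>W\<close> then contains a nonempty open \<open>\<phi> W\<close> consisting of points
\<open>x\<close> with \<open>W \<not>\<subseteq> P(x)\<close> (for \<open>\<Delta>\<^sub>s\<close>), or a \<open>\<phi> W\<close> together with a point or an open set \<open>\<psi> W\<close> such that
\<open>\<phi> W \<times> \<psi> W\<close> misses \<open>P\<close> (for \<open>\<Delta>\<^sub>h\<close> and \<open>\<Delta>\<close>). Replying with \<open>\<phi>\<close> and \<open>\<psi>\<close> is not winning, so in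
some play a point \<open>x\<close> lies in all the sets \<open>\<phi> W\<close>, and these form a base at \<open>x\<close> or the sets \<open>\<psi> W\<close>
accumulate at \<open>x\<close>. As
\<open>P(x)\<close> is a neighborhood of \<open>x\<close>, it contains some \<open>W\<close> of the play, or meets some \<open>\<psi> W\<close>: a
contradiction.

A regular \<open>\<sigma>\<close>-space is a countable union of the sets \<open>A\<^sub>n\<close> of points \<open>x\<close> such that the closure of
some member \<open>F \<ni> x\<close> of the \<open>n\<close>-th discrete family lies in \<open>P(x)\<close>. Some \<open>A\<^sub>n\<close> is dense in an open set
\<open>W\<close>, which can be taken to meet a single \<open>F\<close>; then \<open>W\<close> lies in the closure of \<open>F\<close>, hence in \<open>P(x)\<close>
for every \<open>x \<in> A\<^sub>n \<inter> W\<close>.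

For the classes of \<open>\<Delta>\<^sub>h\<close> and \<open>\<Delta>\<close>, a play that defeats \<open>\<phi>\<close> and \<open>\<psi>\<close> has to be constructed
(\<open>controlled_imp_no_bad_moves\<close>). Nonmeagerness supplies plays with nonempty
intersection even when the sets \<open>W\<^sub>n\<close> are confined to prescribed \<open>\<pi>\<close>-bases of open sets
(\<open>nonmeager_branch\<close>), and regularity allows the closure of \<open>W\<^sub>n\<^sub>+\<^sub>1\<close> to lie in \<open>\<phi> W\<^sub>n\<close>, so that
every accumulation point of the sets \<open>M\<^sub>n = \<psi> W\<^sub>n\<close> lies in all \<open>\<phi> W\<^sub>n\<close>. What remains is a property of
the space: a rule that prescribes the \<open>\<pi>\<close>-bases and forces \<open>(M\<^sub>n)\<close> to accumulate. Spaces with such a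
rule are called \<open>controlled\<close> here.

Control comes in two strengths. In \<open>\<Sigma>\<close>-spaces and \<open>w\<Delta>\<close>-spaces, and in feebly compact spaces for open
sets \<open>M\<^sub>n\<close>, the sequence converges along some free ultrafilter on the natural numbers. In \<open>p\<close>-spaces
and strongly \<open>\<Sigma>\<close>-spaces compactness makes it converge along every free ultrafilter. The stronger form
passes to products coordinate by coordinate, and the product of a factor of the weaker form with one of
the stronger form has the weaker form. A rule restricts only finitely many coordinates at a time, thus
countably many in a play. This suffices for countable products. For open sets \<open>M\<^sub>n\<close> it suffices for
arbitrary products: each \<open>M\<^sub>n\<close> can be shrunk to a box, only the countably many coordinates in
the supports of these boxes have to be restricted, and in the other coordinates every point is a limit.
The supports become known during the play; this is why a rule depends on the sets played before.\<close>

section \<open>Translating strategies between games\<close>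

lemma nonempty_openD:
  "U \<in> nonempty_open X \<Longrightarrow> openin X U" "U \<in> nonempty_open X \<Longrightarrow> U \<noteq> {}"
  "U \<in> nonempty_open X \<Longrightarrow> U \<subseteq> topspace X"
  by (auto simp: nonempty_open_def dest: openin_subset)

lemma nonempty_openI: "openin X U \<Longrightarrow> x \<in> U \<Longrightarrow> U \<in> nonempty_open X"
  by (auto simp: nonempty_open_def)

lemma beta_unfavorable_imp_hat: "beta_unfavorable G \<Longrightarrow> beta_unfavorable_hat G"
  by (auto simp: beta_unfavorable_def beta_unfavorable_hat_def)

text \<open>The two games share the moves of the first player; the replies that \<open>s\<close> would have given to them
are recomputed round by round.\<close>

definition translated_history ::
    "('a, 'm) strategy \<Rightarrow> ('a set \<times> 'n) list \<Rightarrow> ('a set \<times> 'm) list" where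
  "translated_history s h = foldl (\<lambda>h' r. h' @ [(fst r, s h' (fst r))]) [] h"

lemma translated_history_play:
  assumes "\<And>n. m n = s (translated_history s (map (\<lambda>i. (U i, m' i)) [0..<n])) (U n)"
  shows "translated_history s (map (\<lambda>i. (U i, m' i)) [0..<n]) = map (\<lambda>i. (U i, m i)) [0..<n]"
proof (induction n)
  case 0
  show ?case by (simp add: translated_history_def)
next
  case (Suc n)
  have "translated_history s (map (\<lambda>i. (U i, m' i)) [0..<Suc n])
      = translated_history s (map (\<lambda>i. (U i, m' i)) [0..<n]) @ [(U n, m n)]"
    unfolding assms by (simp add: translated_history_def)
  then show ?case using Suc by simp
qed

text \<open>The translation \<open>f\<close> of replies makes life harder for the first player: a win of the first player
in \<open>G'\<close> against translated replies is a win in \<open>G\<close> against the original ones. Hence winning strategies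
of the second player pass from \<open>G\<close> to \<open>G'\<close>, and being unfavorable passes from \<open>G'\<close> to \<open>G\<close>.\<close>

locale game_translation =
  fixes G :: "('a, 'm) game" and G' :: "('a, 'n) game" and f :: "'m \<Rightarrow> 'n"
  assumes first: "first_moves G' = first_moves G"
    and later: "later_moves G' = later_moves G"
    and open_part: "\<And>m. open_part G' (f m) = open_part G m"
    and replies: "\<And>U m. m \<in> replies G U \<Longrightarrow> f m \<in> replies G' U"
    and wins: "\<And>U m. (\<And>n. alpha_legal G U m n) \<Longrightarrow> (\<And>n. m n \<in> replies G (U n)) \<Longrightarrow>
                 alpha_wins G' (\<lambda>n. f (m n)) \<Longrightarrow> alpha_wins G m"
begin

lemma legal: "alpha_legal G' U (\<lambda>n. f (m n)) n \<longleftrightarrow> alpha_legal G U m n"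
  by (simp add: alpha_legal_def first later open_part)

lemma outcome:
  assumes "beta_winning G s" and "\<And>n. m n = s (map (\<lambda>i. (U i, m i)) [0..<n]) (U n)"
  shows "(\<forall>n. (\<forall>i\<le>n. alpha_legal G' U (\<lambda>n. f (m n)) i) \<longrightarrow> f (m n) \<in> replies G' (U n)) \<and>
         ((\<forall>n. alpha_legal G' U (\<lambda>n. f (m n)) n) \<longrightarrow> \<not> alpha_wins G' (\<lambda>n. f (m n)))"
proof -
  note win = assms(1)[unfolded beta_winning_def, THEN spec[of _ U], THEN spec[of _ m],
      THEN mp, OF allI, OF assms(2)]
  have reply: "m n \<in> replies G (U n)" if "\<forall>i\<le>n. alpha_legal G U m i" for n
    using conjunct1[OF win] that by simp
  have "\<not> alpha_wins G m" if "\<forall>n. alpha_legal G U m n"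
    using conjunct2[OF win] that by simp
  moreover have "alpha_wins G m"
    if "\<forall>n. alpha_legal G U m n" "alpha_wins G' (\<lambda>n. f (m n))"
  proof (rule wins[of U m])
    show "m n \<in> replies G (U n)" for n
      using that(1) by (intro reply) simp
  qed (use that in simp_all)
  ultimately have loses: "\<not> alpha_wins G' (\<lambda>n. f (m n))" if "\<forall>n. alpha_legal G U m n"
    using that by (metis (no_types))
  show ?thesis
    unfolding legal
  proof (intro conjI allI impI)
    show "f (m n) \<in> replies G' (U n)" if "\<forall>i\<le>n. alpha_legal G U m i" for n
      by (rule replies[OF reply[OF that]])
    show "\<not> alpha_wins G' (\<lambda>n. f (m n))" if "\<forall>n. alpha_legal G U m n"
      by (rule loses[OF that])
  qed
qed

lemma beta_winning:
  assumes "beta_winning G s"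
  shows "beta_winning G' (\<lambda>h U. f (s (translated_history s h) U))"
  unfolding beta_winning_def
proof (intro allI impI)
  fix U :: "nat \<Rightarrow> 'a set" and m' assume m': "\<forall>n. m' n = f (s (translated_history s (map (\<lambda>i. (U i, m' i)) [0..<n])) (U n))"
  define m where "m n = s (translated_history s (map (\<lambda>i. (U i, m' i)) [0..<n])) (U n)" for n
  have m'_eq: "m' = (\<lambda>n. f (m n))"
    unfolding m_def by (rule ext, rule spec[OF m'])
  have "m n = s (map (\<lambda>i. (U i, m i)) [0..<n]) (U n)" for n
    unfolding translated_history_play[of m s U m', OF m_def, symmetric] by (rule m_def)
  from outcome[OF assms, of m U, OF this] show "(\<forall>n. (\<forall>i\<le>n. alpha_legal G' U m' i) \<longrightarrow> m' n \<in> replies G' (U n)) \<and>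
         ((\<forall>n. alpha_legal G' U m' n) \<longrightarrow> \<not> alpha_wins G' m')"
    unfolding m'_eq .
qed

lemma beta_winning_hat:
  assumes "beta_winning G (\<lambda>_. t)"
  shows "beta_winning G' (\<lambda>_ U. f (t U))"
  unfolding beta_winning_def
proof (intro allI impI)
  fix U :: "nat \<Rightarrow> 'a set" and m' assume "\<forall>n. m' n = f (t (U n))"
  then have "m' = (\<lambda>n. f (t (U n)))" by auto
  then show "(\<forall>n. (\<forall>i\<le>n. alpha_legal G' U m' i) \<longrightarrow> m' n \<in> replies G' (U n)) \<and>
         ((\<forall>n. alpha_legal G' U m' n) \<longrightarrow> \<not> alpha_wins G' m')"
    using outcome[OF assms, of "\<lambda>n. t (U n)" U] by simp
qed

lemma unfavorable:
  "beta_unfavorable G' \<Longrightarrow> beta_unfavorable G"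
  "beta_unfavorable_hat G' \<Longrightarrow> beta_unfavorable_hat G"
  unfolding beta_unfavorable_def beta_unfavorable_hat_def
  using beta_winning beta_winning_hat by blast+

end

lemma game_simps:
  "later_moves (OD_l X N) = nonempty_open X" "later_moves (DO_l X N) = nonempty_open X"
  "later_moves (BM_f X) = nonempty_open X" "later_moves (MB_f X) = nonempty_open X"
  "first_moves (OD_l X N) = {topspace X}" "first_moves (DO_l X N) = nonempty_open X"
  "first_moves (BM_f X) = {topspace X}" "first_moves (MB_f X) = nonempty_open X"
  "open_part (OD_l X N) = fst" "open_part (DO_l X N) = fst"
  "open_part (BM_f X) = id" "open_part (MB_f X) = id"
  "replies (OD_l X N) U = {(V, M). V \<in> nonempty_open X \<and> V \<subseteq> U \<and> M \<in> N \<and> M \<subseteq> U}"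
  "replies (DO_l X N) U = {(V, M). V \<in> nonempty_open X \<and> V \<subseteq> U \<and> M \<in> N \<and> M \<subseteq> U}"
  "replies (BM_f X) U = {V \<in> nonempty_open X. V \<subseteq> U}"
  "replies (MB_f X) U = {V \<in> nonempty_open X. V \<subseteq> U}"
  "alpha_wins (OD_l X N) m \<longleftrightarrow> Ls X (\<lambda>n. snd (m n)) \<inter> (\<Inter>n. fst (m n)) \<noteq> {}"
  "alpha_wins (DO_l X N) m \<longleftrightarrow> Ls X (\<lambda>n. snd (m n)) \<inter> (\<Inter>n. fst (m n)) \<noteq> {}"
  "alpha_wins (BM_f X) V \<longleftrightarrow> (\<exists>x\<in>(\<Inter>n. V n). base_at X x V)"
  "alpha_wins (MB_f X) V \<longleftrightarrow> (\<exists>x\<in>(\<Inter>n. V n). base_at X x V)"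
  by (auto simp: OD_l_def DO_l_def BM_f_def MB_f_def)

text \<open>The sets \<open>M\<^sub>n\<^sub>+\<^sub>1\<close> lie in \<open>V\<^sub>n\<close>, so a base formed by the \<open>V\<^sub>n\<close> forces them to converge to the point.\<close>

lemma base_at_imp_Ls:
  assumes "base_at X x V" and "\<And>n. M (Suc n) \<subseteq> V n" and "\<And>n. M n \<noteq> {}"
    and "\<And>n. V (Suc n) \<subseteq> V n"
  shows "x \<in> Ls X M"
  unfolding Ls_def
proof (clarify, intro conjI allI impI)
  show "x \<in> topspace X"
    using assms(1) openin_subset by (fastforce simp: base_at_def)
  fix G assume "openin X G \<and> x \<in> G"
  then obtain k where k: "V k \<subseteq> G"
    using assms(1) by (auto simp: base_at_def)
  have "V n \<subseteq> V k" if "n \<ge> k" for n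
    using that assms(4) by (rule lift_Suc_antimono_le[rotated])
  then have "M (Suc n) \<inter> G \<noteq> {}" if "n \<ge> k" for n
    using that assms(2,3)[of "Suc n"] assms(2)[of n] k by blast
  then have "Suc ` {k..} \<subseteq> {n. M n \<inter> G \<noteq> {}}"
    by auto
  then show "infinite {n. M n \<inter> G \<noteq> {}}"
    using infinite_Ici[of k] by (meson finite_imageD finite_subset inj_Suc inj_on_subset subset_UNIV)
qed

lemma fst_translation:
  assumes "\<And>M. M \<in> N \<Longrightarrow> M \<noteq> {}"
  shows "game_translation (OD_l X N) (BM_f X) fst" "game_translation (DO_l X N) (MB_f X) fst"
proof -
  have win: "Ls X (\<lambda>n. snd (m n)) \<inter> (\<Inter>n. fst (m n)) \<noteq> {}"
    if rep: "\<And>n. m n \<in> {(V, M). V \<in> nonempty_open X \<and> V \<subseteq> U n \<and> M \<in> N \<and> M \<subseteq> U n}"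
      and U: "\<And>n. U (Suc n) \<subseteq> fst (m n)"
      and b: "\<exists>x\<in>(\<Inter>n. fst (m n)). base_at X x (\<lambda>n. fst (m n))"
    for m :: "nat \<Rightarrow> 'a set \<times> 'a set" and U
  proof -
    obtain x where x: "x \<in> (\<Inter>n. fst (m n))" "base_at X x (\<lambda>n. fst (m n))"
      using b by blast
    have r: "fst (m n) \<subseteq> U n" "snd (m n) \<subseteq> U n" "snd (m n) \<in> N" for n
      using rep[of n] by (auto simp: case_prod_beta)
    have "x \<in> Ls X (\<lambda>n. snd (m n))"
      by (rule base_at_imp_Ls[OF x(2)]) (use r U assms in blast)+
    then show ?thesis using x by blast
  qed
  have legal: "U (Suc n) \<subseteq> fst (m n)"
    if "\<And>n. alpha_legal (OD_l X N) U m n \<or> alpha_legal (DO_l X N) U m n" for U m n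
    using that[of "Suc n"] by (auto simp: alpha_legal_def game_simps)
  have OD: "alpha_wins (OD_l X N) m"
    if "\<And>n. alpha_legal (OD_l X N) U m n" "\<And>n. m n \<in> replies (OD_l X N) (U n)"
      "alpha_wins (BM_f X) (\<lambda>n. fst (m n))" for U m
    using win[of m U] legal[of U m] that by (simp add: game_simps)
  have DO: "alpha_wins (DO_l X N) m"
    if "\<And>n. alpha_legal (DO_l X N) U m n" "\<And>n. m n \<in> replies (DO_l X N) (U n)"
      "alpha_wins (MB_f X) (\<lambda>n. fst (m n))" for U m
    using win[of m U] legal[of U m] that by (simp add: game_simps)
  show "game_translation (OD_l X N) (BM_f X) fst"
    using OD by unfold_locales (auto simp: game_simps(1-16))
  show "game_translation (DO_l X N) (MB_f X) fst"
    using DO by unfold_locales (auto simp: game_simps(1-16))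
qed

lemma Ls_mono: "(\<And>n. M n \<subseteq> M' n) \<Longrightarrow> Ls X M \<subseteq> Ls X M'"
proof
  fix x assume M: "\<And>n. M n \<subseteq> M' n" and x: "x \<in> Ls X M"
  have "{n. M n \<inter> G \<noteq> {}} \<subseteq> {n. M' n \<inter> G \<noteq> {}}" for G
    using M by blast
  from infinite_super[OF this] show "x \<in> Ls X M'"
    using x by (simp add: Ls_def)
qed

lemma point_translation:
  defines "f \<equiv> \<lambda>m :: 'a set \<times> 'a set. (fst m, {SOME x. x \<in> snd m})"
  shows "game_translation (OD_l X (nonempty_open X)) (OD_l X (singletons X)) f"
    and "game_translation (DO_l X (nonempty_open X)) (DO_l X (singletons X)) f"
proof -
  have some: "(SOME x. x \<in> M) \<in> M" if "M \<in> nonempty_open X" for M :: "'a set"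
    using that by (simp add: nonempty_open_def some_in_eq)
  have rep: "f m \<in> {(V, M). V \<in> nonempty_open X \<and> V \<subseteq> U \<and> M \<in> singletons X \<and> M \<subseteq> U}"
    if "m \<in> {(V, M). V \<in> nonempty_open X \<and> V \<subseteq> U \<and> M \<in> nonempty_open X \<and> M \<subseteq> U}" for m U
    using that some[of "snd m"] nonempty_openD(3)[of "snd m" X]
    by (auto simp: f_def singletons_def)
  have win: "Ls X (\<lambda>n. snd (m n)) \<inter> (\<Inter>n. fst (m n)) \<noteq> {}"
    if "\<And>n. m n \<in> {(V, M). V \<in> nonempty_open X \<and> V \<subseteq> U n \<and> M \<in> nonempty_open X \<and> M \<subseteq> U n}"
      and w: "Ls X (\<lambda>n. snd (f (m n))) \<inter> (\<Inter>n. fst (f (m n))) \<noteq> {}"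
    for m :: "nat \<Rightarrow> 'a set \<times> 'a set" and U
  proof -
    have "snd (m n) \<in> nonempty_open X" for n
      using that(1)[of n] by auto
    then have "Ls X (\<lambda>n. snd (f (m n))) \<subseteq> Ls X (\<lambda>n. snd (m n))"
      by (intro Ls_mono) (auto simp: f_def some)
    then show ?thesis using w by (auto simp: f_def)
  qed
  have OD: "alpha_wins (OD_l X (nonempty_open X)) m"
    if "\<And>n. m n \<in> replies (OD_l X (nonempty_open X)) (U n)"
      "alpha_wins (OD_l X (singletons X)) (\<lambda>n. f (m n))" for U m
    using win[of m U] that by (simp add: game_simps)
  have DO: "alpha_wins (DO_l X (nonempty_open X)) m"
    if "\<And>n. m n \<in> replies (DO_l X (nonempty_open X)) (U n)"
      "alpha_wins (DO_l X (singletons X)) (\<lambda>n. f (m n))" for U m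
    using win[of m U] that by (simp add: game_simps)
  have part: "fst (f m) = fst m" for m
    by (simp add: f_def)
  show "game_translation (OD_l X (nonempty_open X)) (OD_l X (singletons X)) f"
    using rep part by unfold_locales (simp_all only: game_simps(1-16), rule OD, simp_all only: game_simps(1-16))
  show "game_translation (DO_l X (nonempty_open X)) (DO_l X (singletons X)) f"
    using rep part by unfold_locales (simp_all only: game_simps(1-16), rule DO, simp_all only: game_simps(1-16))
qed

section \<open>Stationary strategies against the diagonal\<close>

text \<open>Both versions of each game yield a play that stays in \<open>Q\<close>: if the first move is free, \<open>Q\<close> is the
whole space; if the first move has to be the whole space, the stationary strategy treats the whole
space as if it were \<open>Q\<close>.\<close>

lemma hat_unfavorable_play:
  fixes t :: "'a set \<Rightarrow> 'm"
  assumes unf: "beta_unfavorable_hat G"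
    and later: "later_moves G = nonempty_open X"
    and first: "first_moves G = nonempty_open X \<and> Q = topspace X \<or> first_moves G = {topspace X}"
    and Q: "Q \<in> nonempty_open X"
    and t: "\<And>U. U \<in> nonempty_open X \<Longrightarrow> U \<subseteq> Q \<Longrightarrow> t U \<in> replies G U"
    and replies_mono: "\<And>U V. U \<subseteq> V \<Longrightarrow> replies G U \<subseteq> replies G V"
    and open_part: "\<And>U m. m \<in> replies G U \<Longrightarrow> open_part G m \<subseteq> U"
  obtains U where "\<And>n. U n \<in> nonempty_open X" "\<And>n. U n \<subseteq> Q"
    "\<And>n. U (Suc n) \<subseteq> open_part G (t (U n))" "alpha_wins G (\<lambda>n. t (U n))"
proof -
  \<comment> \<open>if the whole space occurs after the opening move, it equals \<open>Q\<close>, so the replacement is harmless there\<close>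
  define c where "c U = (if U = topspace X then Q else U)" for U
  have "\<not> beta_winning G (\<lambda>_ U. t (c U))"
    using unf by (auto simp: beta_unfavorable_hat_def)
  then obtain U m where m: "\<And>n. m n = t (c (U n))"
    and no: "\<not> ((\<forall>n. (\<forall>i\<le>n. alpha_legal G U m i) \<longrightarrow> m n \<in> replies G (U n)) \<and>
        ((\<forall>n. alpha_legal G U m n) \<longrightarrow> \<not> alpha_wins G m))"
    unfolding beta_winning_def by blast
  have c_sub: "c W \<subseteq> W" if "W \<in> nonempty_open X" for W
    using that nonempty_openD(3)[OF Q] by (auto simp: c_def)
  have c: "c (U n) \<in> nonempty_open X \<and> c (U n) \<subseteq> Q \<and> U n \<in> nonempty_open X"
    if "\<forall>i\<le>n. alpha_legal G U m i" for n
    using that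
  proof (induction n)
    case 0
    have "topspace X \<in> nonempty_open X"
      using Q by (auto simp: nonempty_open_def dest: openin_subset)
    then show ?case
      using 0 Q first by (auto simp: alpha_legal_def c_def dest: nonempty_openD)
  next
    case (Suc n)
    then have n: "c (U n) \<in> nonempty_open X" "c (U n) \<subseteq> Q" by auto
    have "alpha_legal G U m (Suc n)" using Suc.prems by blast
    then have U: "U (Suc n) \<in> nonempty_open X" "U (Suc n) \<subseteq> open_part G (m n)"
      by (auto simp: alpha_legal_def later)
    then have "U (Suc n) \<subseteq> Q"
      using open_part[OF t[OF n]] n m by auto
    then show ?case using U Q by (auto simp: c_def)
  qed
  have "m n \<in> replies G (U n)" if "\<forall>i\<le>n. alpha_legal G U m i" for n
    using c[OF that] t[of "c (U n)"] replies_mono[OF c_sub[of "U n"]] m by auto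
  then have legal: "\<And>n. alpha_legal G U m n" and win: "alpha_wins G m"
    using no by blast+
  show ?thesis
  proof (rule that[of "\<lambda>n. c (U n)"])
    show "c (U (Suc n)) \<subseteq> open_part G (t (c (U n)))" for n
      using legal[of "Suc n"] c_sub[of "U (Suc n)"] m by (auto simp: alpha_legal_def later)
    show "alpha_wins G (\<lambda>n. t (c (U n)))"
      using win m by (metis ext)
  qed (use c legal in auto)
qed

lemma semi_neighborhoodD:
  assumes "semi_neighborhood X P" "x \<in> topspace X"
  obtains G where "openin X G" "x \<in> G" "G \<subseteq> P `` {x}"
proof (rule that)
  show "openin X (X interior_of (P `` {x}))" "X interior_of (P `` {x}) \<subseteq> P `` {x}"
    by (simp_all add: interior_of_subset)
  show "x \<in> X interior_of (P `` {x})"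
    using assms by (simp add: semi_neighborhood_def)
qed

text \<open>The witness of non-density, an open set missing \<open>D\<close>, is the reply of the second player below.\<close>

lemma not_dense_gap:
  assumes "openin X W" "D \<subseteq> W" "\<not> dense_subset X W D"
  obtains V where "V \<in> nonempty_open X" "V \<subseteq> W" "V \<inter> D = {}"
proof -
  obtain x where x: "x \<in> W" "x \<notin> X closure_of D"
    using assms by (auto simp: dense_subset_def)
  then obtain V where "openin X V" "x \<in> V" "V \<inter> D = {}"
    using assms(1) openin_subset by (fastforce simp: in_closure_of)
  then show ?thesis
    using that[of "V \<inter> W"] assms(1) x by (auto simp: nonempty_open_def openin_Int)
qed

lemma not_good_Delta_s:
  assumes "openin X W" "\<not> good_Delta_s X P W"
  obtains V where "V \<in> nonempty_open X" "V \<subseteq> W" "\<And>x. x \<in> V \<Longrightarrow> \<not> W \<subseteq> P `` {x}"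
proof -
  have "{x \<in> W. W \<subseteq> P `` {x}} \<times> W \<subseteq> P"
    by auto
  then have "\<not> dense_subset X W {x \<in> W. W \<subseteq> P `` {x}}"
    using assms(2) unfolding good_Delta_s_def by metis
  then obtain V where "V \<in> nonempty_open X" "V \<subseteq> W" "V \<inter> {x \<in> W. W \<subseteq> P `` {x}} = {}"
    by (rule not_dense_gap[OF assms(1), rotated]) auto
  then show ?thesis using that by blast
qed

lemma not_good_Delta_h:
  assumes "openin X W" "\<not> good_Delta_h X P W"
  obtains V M where "V \<in> nonempty_open X" "V \<subseteq> W" "M \<in> singletons X" "M \<subseteq> W" "V \<times> M \<inter> P = {}"
proof -
  obtain y where y: "y \<in> W" "\<not> dense_subset X W {x \<in> W. (x, y) \<in> P}"
    using assms(2) unfolding good_Delta_h_def by blast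
  then obtain V where "V \<in> nonempty_open X" "V \<subseteq> W" "V \<inter> {x \<in> W. (x, y) \<in> P} = {}"
    by (rule_tac not_dense_gap[OF assms(1) _ y(2)]) auto
  then show ?thesis
    using that[of V "{y}"] y(1) openin_subset[OF assms(1)] by (auto simp: singletons_def)
qed

lemma not_good_Delta:
  assumes "openin X W" "\<not> good_Delta X P W"
  obtains V M where "V \<in> nonempty_open X" "V \<subseteq> W" "M \<in> nonempty_open X" "M \<subseteq> W" "V \<times> M \<inter> P = {}"
proof -
  have W: "openin (prod_topology X X) (W \<times> W)"
    using assms(1) by (simp add: openin_prod_Times_iff)
  obtain V where V: "V \<in> nonempty_open (prod_topology X X)" "V \<subseteq> W \<times> W" "V \<inter> (P \<inter> W \<times> W) = {}"
    using not_dense_gap[OF W Int_lower2] assms(2) unfolding good_Delta_def by blast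
  then obtain x y where xy: "(x, y) \<in> V" by (auto simp: nonempty_open_def)
  obtain A B where "openin X A" "openin X B" "x \<in> A" "y \<in> B" "A \<times> B \<subseteq> V"
    using V(1) xy unfolding nonempty_open_def openin_prod_topology_alt by blast
  then show ?thesis
    using that[of A B] V(2,3) by (auto simp: nonempty_open_def)
qed

lemma replies_mono_BM:
  assumes "G \<in> {BM_f X, MB_f X}" "U \<subseteq> V"
  shows "replies G U \<subseteq> replies G V"
  using assms order_trans[OF _ assms(2)] by (auto simp: game_simps)

lemma replies_mono_OD:
  assumes "G \<in> {OD_l X N, DO_l X N}" "U \<subseteq> V"
  shows "replies G U \<subseteq> replies G V"
  using assms order_trans[OF _ assms(2)] by (auto simp: game_simps)

lemma hat_BM_imp_good_Delta_s:
  assumes G: "G = MB_f X \<and> Q = topspace X \<or> G = BM_f X"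
    and unf: "beta_unfavorable_hat G" and P: "semi_neighborhood X P" and Q: "Q \<in> nonempty_open X"
  shows "\<exists>W\<in>nonempty_open X. W \<subseteq> Q \<and> good_Delta_s X P W"
proof (rule ccontr)
  assume no: "\<not> ?thesis"
  have "\<exists>V. V \<in> nonempty_open X \<and> V \<subseteq> W \<and> (\<forall>x\<in>V. \<not> W \<subseteq> P `` {x})"
    if "W \<in> nonempty_open X" "W \<subseteq> Q" for W
    using not_good_Delta_s[of X W P] no that nonempty_openD(1) by metis
  then obtain t where t: "\<And>W. W \<in> nonempty_open X \<Longrightarrow> W \<subseteq> Q \<Longrightarrow>
      t W \<in> nonempty_open X \<and> t W \<subseteq> W \<and> (\<forall>x\<in>t W. \<not> W \<subseteq> P `` {x})"
    by metis
  obtain U where U: "\<And>n. U n \<in> nonempty_open X" "\<And>n. U n \<subseteq> Q"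
    "\<And>n. U (Suc n) \<subseteq> open_part G (t (U n))" "alpha_wins G (\<lambda>n. t (U n))"
  proof (rule hat_unfavorable_play[of G X Q t])
    show "replies G U \<subseteq> replies G V" if "U \<subseteq> V" for U V
      using replies_mono_BM[OF _ that] G by blast
  qed (use G unf Q t in \<open>auto simp: game_simps\<close>)
  have "\<exists>x. (\<forall>n. x \<in> t (U n)) \<and> base_at X x (\<lambda>n. t (U n))"
    using U(4) G by (elim disjE conjE; simp add: game_simps; blast)
  then obtain x where x: "\<And>n. x \<in> t (U n)" "base_at X x (\<lambda>n. t (U n))"
    by blast
  have "x \<in> topspace X"
    using x(1)[of 0] t[of "U 0"] U(1,2) nonempty_openD(3)[of "t (U 0)" X] by auto
  then obtain g where g: "openin X g" "x \<in> g" "g \<subseteq> P `` {x}"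
    using semi_neighborhoodD[OF P] by blast
  then obtain n where "t (U n) \<subseteq> g"
    using x(2) unfolding base_at_def by blast
  moreover have "U (Suc n) \<subseteq> t (U n)"
    using U(3)[of n] G by (auto simp: game_simps)
  ultimately have "U (Suc n) \<subseteq> P `` {x}"
    using g(3) by (meson subset_trans)
  moreover have "\<forall>y\<in>t (U (Suc n)). \<not> U (Suc n) \<subseteq> P `` {y}"
    using t[of "U (Suc n)"] U(1,2) by simp
  ultimately show False
    using x(1)[of "Suc n"] by auto
qed

lemma hat_OD_play:
  assumes G: "G = DO_l X N \<and> Q = topspace X \<or> G = OD_l X N"
    and unf: "beta_unfavorable_hat G" and P: "semi_neighborhood X P" and Q: "Q \<in> nonempty_open X"
    and bad: "\<And>W. W \<in> nonempty_open X \<Longrightarrow> W \<subseteq> Q \<Longrightarrow>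
      \<exists>V M. V \<in> nonempty_open X \<and> V \<subseteq> W \<and> M \<in> N \<and> M \<subseteq> W \<and> V \<times> M \<inter> P = {}"
  shows False
proof -
  have "\<exists>m. fst m \<in> nonempty_open X \<and> fst m \<subseteq> W \<and> snd m \<in> N \<and> snd m \<subseteq> W \<and> fst m \<times> snd m \<inter> P = {}"
    if "W \<in> nonempty_open X" "W \<subseteq> Q" for W
    using bad[OF that] by force
  then obtain t where t: "\<And>W. W \<in> nonempty_open X \<Longrightarrow> W \<subseteq> Q \<Longrightarrow>
      fst (t W) \<in> nonempty_open X \<and> fst (t W) \<subseteq> W \<and> snd (t W) \<in> N \<and> snd (t W) \<subseteq> W \<and>
      fst (t W) \<times> snd (t W) \<inter> P = {}"
    by metis
  obtain U where U: "\<And>n. U n \<in> nonempty_open X" "\<And>n. U n \<subseteq> Q"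
    "\<And>n. U (Suc n) \<subseteq> open_part G (t (U n))" "alpha_wins G (\<lambda>n. t (U n))"
  proof (rule hat_unfavorable_play[of G X Q t])
    show "replies G U \<subseteq> replies G V" if "U \<subseteq> V" for U V
      using replies_mono_OD[OF _ that] G by blast
  qed (use G unf Q t in \<open>auto simp: game_simps case_prod_beta\<close>)
  have "\<exists>x. (\<forall>n. x \<in> fst (t (U n))) \<and> x \<in> Ls X (\<lambda>n. snd (t (U n)))"
    using U(4) G by (elim disjE conjE; simp add: game_simps; blast)
  then obtain x where x: "\<And>n. x \<in> fst (t (U n))" "x \<in> Ls X (\<lambda>n. snd (t (U n)))"
    by blast
  have "x \<in> topspace X"
    using x(2) by (simp add: Ls_def)
  then obtain g where g: "openin X g" "x \<in> g" "g \<subseteq> P `` {x}"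
    using semi_neighborhoodD[OF P] by blast
  then have "infinite {n. snd (t (U n)) \<inter> g \<noteq> {}}"
    using x(2) by (simp add: Ls_def)
  then obtain n where "snd (t (U n)) \<inter> g \<noteq> {}"
    using not_finite_existsD by blast
  then obtain y where "y \<in> snd (t (U n))" "(x, y) \<in> P"
    using g(3) by blast
  then have "(x, y) \<in> fst (t (U n)) \<times> snd (t (U n)) \<inter> P"
    using x(1) by blast
  then show False
    using t[of "U n"] U(1,2) by simp
qed

lemma hat_OD_imp_good_Delta_h:
  assumes "G = DO_l X (singletons X) \<and> Q = topspace X \<or> G = OD_l X (singletons X)"
    and "beta_unfavorable_hat G" and "semi_neighborhood X P" and "Q \<in> nonempty_open X"
  shows "\<exists>W\<in>nonempty_open X. W \<subseteq> Q \<and> good_Delta_h X P W"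
  using hat_OD_play[OF assms] not_good_Delta_h[of X _ P] nonempty_openD(1) by metis

lemma hat_OD_imp_good_Delta:
  assumes "G = DO_l X (nonempty_open X) \<and> Q = topspace X \<or> G = OD_l X (nonempty_open X)"
    and "beta_unfavorable_hat G" and "semi_neighborhood X P" and "Q \<in> nonempty_open X"
  shows "\<exists>W\<in>nonempty_open X. W \<subseteq> Q \<and> good_Delta X P W"
  using hat_OD_play[OF assms] not_good_Delta[of X _ P] nonempty_openD(1) by metis

lemma dense_subset_mono: "dense_subset X W D \<Longrightarrow> D \<subseteq> E \<Longrightarrow> E \<subseteq> W \<Longrightarrow> dense_subset X W E"
  unfolding dense_subset_def by (meson closure_of_mono subset_trans)

lemma good_Delta_s_imp_h: "good_Delta_s X P W \<Longrightarrow> good_Delta_h X P W"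
  unfolding good_Delta_s_def good_Delta_h_def
proof (clarify)
  fix M y assume M: "dense_subset X W M" "M \<times> W \<subseteq> P" "y \<in> W"
  then have "M \<subseteq> W" by (simp add: dense_subset_def)
  then show "dense_subset X W {x \<in> W. (x, y) \<in> P}"
    using M by (intro dense_subset_mono[OF M(1)]) auto
qed

text \<open>Density of all sections \<open>{x. (x, y) \<in> P}\<close> gives density in the plane: move the first coordinate only.\<close>

lemma good_Delta_h_imp_Delta:
  assumes "good_Delta_h X P W"
  shows "good_Delta X P W"
  unfolding good_Delta_def dense_subset_def
proof (intro conjI subsetI)
  fix z assume z: "z \<in> W \<times> W"
  obtain x y where xy: "z = (x, y)" "x \<in> W" "y \<in> W"
    using z by blast
  have dense: "w \<in> X closure_of {x \<in> W. (x, v) \<in> P}" if "w \<in> W" "v \<in> W" for w v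
    using assms that by (auto simp: good_Delta_h_def dense_subset_def)
  have top: "x \<in> topspace X" "y \<in> topspace X"
    using dense xy(2,3) by (auto simp: in_closure_of)
  have "\<exists>p. p \<in> P \<inter> W \<times> W \<and> p \<in> T" if T: "openin (prod_topology X X) T" "(x, y) \<in> T" for T
  proof -
    obtain U V where UV: "openin X U" "openin X V" "x \<in> U" "y \<in> V" "U \<times> V \<subseteq> T"
      using T unfolding openin_prod_topology_alt by meson
    obtain x' where "x' \<in> W" "(x', y) \<in> P" "x' \<in> U"
      using dense[OF xy(2,3)] UV(1,3) by (auto simp: in_closure_of)
    then have "(x', y) \<in> P \<inter> W \<times> W" "(x', y) \<in> T"
      using UV(4,5) xy(3) by auto
    then show ?thesis by blast
  qed
  moreover have "(x, y) \<in> topspace (prod_topology X X)"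
    using top by simp
  ultimately show "z \<in> prod_topology X X closure_of (P \<inter> W \<times> W)"
    unfolding xy(1) in_closure_of by blast
qed auto

lemma singletons_nonempty: "M \<in> singletons X \<Longrightarrow> M \<noteq> {}"
  by (auto simp: singletons_def)

lemma game_implications:
  assumes "topspace X \<noteq> {}"
  shows "((Gamma_BM_f_nonmeager X \<longrightarrow> Gamma_hat_BM_f_nonmeager X) \<and>
      (Gamma_BM_f_Baire X \<longrightarrow> Gamma_hat_BM_f_Baire X) \<and>
      (Gamma_hat_BM_f_nonmeager X \<longrightarrow> Delta_s_nonmeager X) \<and>
      (Gamma_hat_BM_f_Baire X \<longrightarrow> Delta_s_Baire X) \<and>

      (Gamma_OD_pl_nonmeager X \<longrightarrow> Gamma_hat_OD_pl_nonmeager X) \<and>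
      (Gamma_OD_pl_Baire X \<longrightarrow> Gamma_hat_OD_pl_Baire X) \<and>
      (Gamma_hat_OD_pl_nonmeager X \<longrightarrow> Delta_h_nonmeager X) \<and>
      (Gamma_hat_OD_pl_Baire X \<longrightarrow> Delta_h_Baire X) \<and>

      (Gamma_OD_ol_nonmeager X \<longrightarrow> Gamma_hat_OD_ol_nonmeager X) \<and>
      (Gamma_OD_ol_Baire X \<longrightarrow> Gamma_hat_OD_ol_Baire X) \<and>
      (Gamma_hat_OD_ol_nonmeager X \<longrightarrow> Delta_nonmeager X) \<and>
      (Gamma_hat_OD_ol_Baire X \<longrightarrow> Delta_Baire X) \<and>

      (Gamma_BM_f_nonmeager X \<longrightarrow> Gamma_OD_pl_nonmeager X) \<and>
      (Gamma_BM_f_Baire X \<longrightarrow> Gamma_OD_pl_Baire X) \<and>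
      (Gamma_OD_pl_nonmeager X \<longrightarrow> Gamma_OD_ol_nonmeager X) \<and>
      (Gamma_OD_pl_Baire X \<longrightarrow> Gamma_OD_ol_Baire X) \<and>

      (Gamma_hat_BM_f_nonmeager X \<longrightarrow> Gamma_hat_OD_pl_nonmeager X) \<and>
      (Gamma_hat_BM_f_Baire X \<longrightarrow> Gamma_hat_OD_pl_Baire X) \<and>
      (Gamma_hat_OD_pl_nonmeager X \<longrightarrow> Gamma_hat_OD_ol_nonmeager X) \<and>
      (Gamma_hat_OD_pl_Baire X \<longrightarrow> Gamma_hat_OD_ol_Baire X) \<and>

      (Delta_s_nonmeager X \<longrightarrow> Delta_h_nonmeager X) \<and>
      (Delta_s_Baire X \<longrightarrow> Delta_h_Baire X) \<and>
      (Delta_h_nonmeager X \<longrightarrow> Delta_nonmeager X) \<and>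
      (Delta_h_Baire X \<longrightarrow> Delta_Baire X))"
proof -
  have top: "topspace X \<in> nonempty_open X"
    using assms by (simp add: nonempty_open_def)
  note fst_tr = fst_translation[of "singletons X" X, OF singletons_nonempty]
  note unfold_G = Gamma_BM_f_nonmeager_def Gamma_hat_BM_f_nonmeager_def
    Gamma_BM_f_Baire_def Gamma_hat_BM_f_Baire_def
    Gamma_OD_pl_nonmeager_def Gamma_hat_OD_pl_nonmeager_def
    Gamma_OD_pl_Baire_def Gamma_hat_OD_pl_Baire_def
    Gamma_OD_ol_nonmeager_def Gamma_hat_OD_ol_nonmeager_def
    Gamma_OD_ol_Baire_def Gamma_hat_OD_ol_Baire_def
  note unfold_D = Delta_s_nonmeager_def Delta_s_Baire_def Delta_h_nonmeager_def Delta_h_Baire_def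
    Delta_nonmeager_def Delta_Baire_def
  note transfer = fst_tr[THEN game_translation.unfavorable(1)]
    fst_tr[THEN game_translation.unfavorable(2)]
    point_translation[THEN game_translation.unfavorable(1), of X]
    point_translation[THEN game_translation.unfavorable(2), of X]
  note BM_f = hat_BM_imp_good_Delta_s[OF disjI1[OF conjI[OF refl refl]] _ _ top]
    hat_BM_imp_good_Delta_s[OF disjI2[OF refl]]
  have hat_BM_f: "Gamma_hat_BM_f_nonmeager X \<longrightarrow> Delta_s_nonmeager X"
    "Gamma_hat_BM_f_Baire X \<longrightarrow> Delta_s_Baire X"
    unfolding unfold_G unfold_D using BM_f by metis+
  note OD_pl = hat_OD_imp_good_Delta_h[OF disjI1[OF conjI[OF refl refl]] _ _ top]
    hat_OD_imp_good_Delta_h[OF disjI2[OF refl]]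
  have hat_OD_pl: "Gamma_hat_OD_pl_nonmeager X \<longrightarrow> Delta_h_nonmeager X"
    "Gamma_hat_OD_pl_Baire X \<longrightarrow> Delta_h_Baire X"
    unfolding unfold_G unfold_D using OD_pl by metis+
  note OD_ol = hat_OD_imp_good_Delta[OF disjI1[OF conjI[OF refl refl]] _ _ top]
    hat_OD_imp_good_Delta[OF disjI2[OF refl]]
  have hat_OD_ol: "Gamma_hat_OD_ol_nonmeager X \<longrightarrow> Delta_nonmeager X"
    "Gamma_hat_OD_ol_Baire X \<longrightarrow> Delta_Baire X"
    unfolding unfold_G unfold_D using OD_ol by metis+
  have Deltas: "Delta_s_nonmeager X \<longrightarrow> Delta_h_nonmeager X" "Delta_s_Baire X \<longrightarrow> Delta_h_Baire X"
    "Delta_h_nonmeager X \<longrightarrow> Delta_nonmeager X" "Delta_h_Baire X \<longrightarrow> Delta_Baire X"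
    unfolding unfold_D using good_Delta_s_imp_h good_Delta_h_imp_Delta by meson+
  show ?thesis
    using hat_BM_f hat_OD_pl hat_OD_ol Deltas
    by (simp add: unfold_G beta_unfavorable_imp_hat transfer)
qed

section \<open>Category and disjoint refinements\<close>

text \<open>For the whole space this is nonmeagerness, and a space is Baire if and only if all its nonempty open
sets are nonmeager; the two parts of each result on Baire and on nonmeager spaces thus become one
statement about \<open>Q\<close>.\<close>

definition nonmeager_open :: "'a topology \<Rightarrow> 'a set \<Rightarrow> bool" where
  "nonmeager_open X Q \<longleftrightarrow> Q \<in> nonempty_open X \<and>
     (\<forall>G :: nat \<Rightarrow> 'a set. (\<forall>n. openin X (G n) \<and> G n \<subseteq> Q \<and> Q \<subseteq> X closure_of G n) \<longrightarrow>
        (\<Inter>n. G n) \<noteq> {})"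

lemma nonmeager_open_Inter:
  fixes G :: "nat \<Rightarrow> 'a set"
  assumes "nonmeager_open X Q" "\<And>n. openin X (G n)" "\<And>n. G n \<subseteq> Q" "\<And>n. Q \<subseteq> X closure_of G n"
  shows "(\<Inter>n. G n) \<noteq> {}"
  using assms(1)[unfolded nonmeager_open_def, THEN conjunct2, THEN spec[of _ G]] assms(2-4) by simp

lemma Baire_space_imp_nonmeager_open:
  assumes "Baire_space X" "Q \<in> nonempty_open X"
  shows "nonmeager_open X Q"
  unfolding nonmeager_open_def
proof (intro conjI allI impI assms(2))
  fix G :: "nat \<Rightarrow> 'a set"
  assume G: "\<forall>n. openin X (G n) \<and> G n \<subseteq> Q \<and> Q \<subseteq> X closure_of G n"
  \<comment> \<open>adding the exterior of \<open>Q\<close> makes a dense subset of \<open>Q\<close> dense in the whole space\<close>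
  define H where "H n = G n \<union> (topspace X - X closure_of Q)" for n
  have openH: "openin X (H n)" for n
    using G unfolding H_def by (intro openin_Un openin_diff) auto
  have "topspace X \<subseteq> X closure_of H n" for n
  proof
    fix x assume x: "x \<in> topspace X"
    have "X closure_of Q \<subseteq> X closure_of G n"
      by (rule closure_of_minimal) (use G in auto)
    also have "\<dots> \<subseteq> X closure_of H n"
      by (rule closure_of_mono) (simp add: H_def)
    finally have "X closure_of Q \<subseteq> X closure_of H n" .
    moreover have "H n \<subseteq> X closure_of H n"
      by (rule closure_of_subset[OF openin_subset[OF openH]])
    ultimately show "x \<in> X closure_of H n"
      using x by (auto simp: H_def)
  qed
  then have "dense_subset X (topspace X) (H n)" for n
    using openin_subset[OF openH] by (simp add: dense_subset_def)
  then have "dense_subset X (topspace X) (\<Inter>n. H n)"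
    using assms(1)[unfolded Baire_space_def, THEN spec[of _ H]] openH by simp
  moreover obtain q where q: "q \<in> Q" "q \<in> topspace X"
    using nonempty_openD(2,3)[OF assms(2)] by blast
  ultimately have "q \<in> X closure_of (\<Inter>n. H n)"
    by (auto simp: dense_subset_def)
  then obtain y where y: "y \<in> (\<Inter>n. H n)" "y \<in> Q"
    using q nonempty_openD(1)[OF assms(2)] unfolding in_closure_of by meson
  then have "y \<in> X closure_of Q"
    using closure_of_subset[OF nonempty_openD(3)[OF assms(2)]] by blast
  then have "y \<in> (\<Inter>n. G n)"
    using y by (auto simp: H_def)
  then show "(\<Inter>n. G n) \<noteq> {}" by blast
qed

lemma nonmeager_space_imp_nonmeager_open:
  assumes "nonmeager_space X" "topspace X \<noteq> {}"
  shows "nonmeager_open X (topspace X)"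
  unfolding nonmeager_open_def
proof (intro conjI allI impI)
  show "topspace X \<in> nonempty_open X"
    using assms(2) by (simp add: nonempty_open_def)
  fix G :: "nat \<Rightarrow> 'a set"
  assume G: "\<forall>n. openin X (G n) \<and> G n \<subseteq> topspace X \<and> topspace X \<subseteq> X closure_of G n"
  have "nowhere_dense_in X (topspace X - G n)" for n
  proof -
    have "closedin X (topspace X - G n)"
      using G by blast
    moreover have "X interior_of (topspace X - G n) = topspace X - X closure_of G n"
      by (simp add: interior_of_complement)
    ultimately show ?thesis
      using G unfolding nowhere_dense_in_def by (simp add: closure_of_closedin)
  qed
  then have "topspace X \<noteq> (\<Union>n. topspace X - G n)"
    using assms(1)[unfolded nonmeager_space_def not_ex, THEN spec[of _ "\<lambda>n. topspace X - G n"]] by simp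
  then show "(\<Inter>n. G n) \<noteq> {}"
    by auto
qed

lemma nonmeager_open_somewhere_dense:
  assumes Q: "nonmeager_open X Q" and A: "topspace X = (\<Union>n. A n)"
  obtains n :: nat and V where "V \<in> nonempty_open X" "V \<subseteq> Q" "V \<subseteq> X closure_of A n"
proof (rule ccontr)
  assume no: "\<not> thesis"
  define G where "G n = Q - X closure_of A n" for n
  have oQ: "openin X Q"
    using Q by (auto simp: nonmeager_open_def nonempty_open_def)
  then have oG: "openin X (G n)" for n
    unfolding G_def by (intro openin_diff) auto
  have "Q \<subseteq> X closure_of G n" for n
  proof (rule ccontr)
    assume "\<not> Q \<subseteq> X closure_of G n"
    then have "\<not> dense_subset X Q (G n)"
      by (simp add: dense_subset_def)
    then obtain V where "V \<in> nonempty_open X" "V \<subseteq> Q" "V \<inter> G n = {}"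
      by (rule_tac not_dense_gap[OF oQ, of "G n"]) (auto simp: G_def)
    then show False
      using no that[of V n] by (auto simp: G_def)
  qed
  then have "(\<Inter>n. G n) \<noteq> {}"
    by (intro nonmeager_open_Inter[OF Q] oG) (auto simp: G_def)
  then obtain x where x: "x \<in> Q" "\<And>n. x \<notin> X closure_of A n"
    by (auto simp: G_def)
  then have "x \<in> topspace X"
    using oQ openin_subset by blast
  then obtain n where "x \<in> A n"
    using A by blast
  moreover have "A n \<subseteq> topspace X"
    using A by blast
  ultimately show False
    using x(2)[of n] closure_of_subset[of "A n" X] by blast
qed

text \<open>States \<open>s\<close> carry regions \<open>reg s\<close>. Zorn's lemma gives a maximal family of states with disjoint
regions; by maximality, the union of the regions leaves no open gap.\<close>

lemma maximal_disjoint_refinement: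
  assumes refine: "\<And>V. V \<in> nonempty_open X \<Longrightarrow> V \<subseteq> R \<Longrightarrow>
      \<exists>s. s \<in> S \<and> reg s \<in> nonempty_open X \<and> reg s \<subseteq> V"
    and R: "openin X R"
  shows "\<exists>D\<subseteq>S. (\<forall>s\<in>D. reg s \<subseteq> R) \<and> pairwise (\<lambda>s t. disjnt (reg s) (reg t)) D \<and>
    R \<subseteq> X closure_of (\<Union>s\<in>D. reg s)"
proof -
  define C where "C = {s \<in> S. reg s \<in> nonempty_open X \<and> reg s \<subseteq> R}"
  define \<A> where "\<A> = {D. D \<subseteq> C \<and> pairwise (\<lambda>s t. disjnt (reg s) (reg t)) D}"
  have "\<exists>D\<in>\<A>. \<forall>E\<in>\<A>. D \<subseteq> E \<longrightarrow> E = D"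
  proof (rule subset_Zorn_nonempty)
    have "{} \<in> \<A>" by (simp add: \<A>_def)
    then show "\<A> \<noteq> {}" by blast
    fix \<C> assume \<C>: "\<C> \<noteq> {}" "subset.chain \<A> \<C>"
    have "disjnt (reg s) (reg t)" if st: "s \<in> \<Union>\<C>" "t \<in> \<Union>\<C>" "s \<noteq> t" for s t
    proof -
      obtain D where "D \<in> \<C>" "s \<in> D" "t \<in> D"
        using \<C>(2) st unfolding subset_chain_def by (metis UnionE subsetD)
      then show ?thesis
        using \<C>(2) st(3) unfolding subset_chain_def \<A>_def by (auto dest: pairwiseD)
    qed
    then show "\<Union>\<C> \<in> \<A>"
      using \<C>(2) unfolding subset_chain_def \<A>_def by (auto simp: pairwise_def)
  qed
  then obtain D where D: "D \<in> \<A>" and max: "\<And>E. E \<in> \<A> \<Longrightarrow> D \<subseteq> E \<Longrightarrow> E = D"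
    by blast
  have DC: "D \<subseteq> C" "pairwise (\<lambda>s t. disjnt (reg s) (reg t)) D"
    using D by (auto simp: \<A>_def)
  have "R \<subseteq> X closure_of (\<Union>s\<in>D. reg s)"
  proof (rule ccontr)
    assume "\<not> ?thesis"
    then have "\<not> dense_subset X R (\<Union>s\<in>D. reg s)"
      by (simp add: dense_subset_def)
    then obtain V where V: "V \<in> nonempty_open X" "V \<subseteq> R" "V \<inter> (\<Union>s\<in>D. reg s) = {}"
      using DC(1) by (rule_tac not_dense_gap[OF R, of "\<Union>s\<in>D. reg s"]) (auto simp: C_def)
    then obtain s where s: "s \<in> S" "reg s \<in> nonempty_open X" "reg s \<subseteq> V"
      using refine by blast
    have "insert s D \<in> \<A>"
      using s V DC by (auto simp: \<A>_def C_def pairwise_insert disjnt_def)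
    then have "s \<in> D"
      using max[of "insert s D"] by blast
    then show False
      using V(3) s nonempty_openD(2)[OF s(2)] by blast
  qed
  then show ?thesis
    using DC by (intro exI[of _ D]) (auto simp: C_def)
qed

text \<open>The half of Oxtoby's theorem on the Banach--Mazur game that is needed here, in a form that allows
arbitrary states of the play. Below each state, choose successors with disjoint regions whose union is
dense. The regions of level \<open>n\<close> then have dense union in \<open>Q\<close>, so some point lies in a region of every
level; by disjointness these regions belong to a single branch.\<close>

lemma nonmeager_branch:
  assumes Q: "nonmeager_open X Q" and I0: "I s0" and reg0: "reg s0 = Q"
    and I_reg: "\<And>s. I s \<Longrightarrow> reg s \<in> nonempty_open X"
    and refine: "\<And>s V. I s \<Longrightarrow> V \<in> nonempty_open X \<Longrightarrow> V \<subseteq> reg s \<Longrightarrow>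
      \<exists>s'. I s' \<and> step s s' \<and> reg s' \<subseteq> V"
  obtains \<sigma> :: "nat \<Rightarrow> 's" where "\<sigma> 0 = s0" "\<And>n. step (\<sigma> n) (\<sigma> (Suc n))" "(\<Inter>n. reg (\<sigma> n)) \<noteq> {}"
proof -
  define \<Phi> where "\<Phi> s D \<longleftrightarrow> D \<subseteq> {s'. I s' \<and> step s s'} \<and> (\<forall>s'\<in>D. reg s' \<subseteq> reg s) \<and>
      pairwise (\<lambda>s t. disjnt (reg s) (reg t)) D \<and> reg s \<subseteq> X closure_of (\<Union>s\<in>D. reg s)" for s D
  have ex: "\<exists>D. \<Phi> s D"
    if s: "I s" for s
  proof -
    have "\<exists>s'. s' \<in> {s'. I s' \<and> step s s'} \<and> reg s' \<in> nonempty_open X \<and> reg s' \<subseteq> V"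
      if V: "V \<in> nonempty_open X" "V \<subseteq> reg s" for V
    proof -
      obtain s' where "I s'" "step s s'" "reg s' \<subseteq> V"
        using refine[OF s V] by (elim exE conjE)
      then show ?thesis using I_reg[of s'] by auto
    qed
    then show ?thesis
      unfolding \<Phi>_def by (rule maximal_disjoint_refinement[OF _ nonempty_openD(1)[OF I_reg[OF s]]])
  qed
  define D where "D s = (SOME D. \<Phi> s D)" for s
  have D: "\<Phi> s (D s)" if "I s" for s
    unfolding D_def by (rule someI_ex[OF ex[OF that]])
  note D = this[unfolded \<Phi>_def]
  define S where "S n = rec_nat {s0} (\<lambda>_ T. \<Union>s\<in>T. D s) n" for n
  have S: "S 0 = {s0}" "\<And>n. S (Suc n) = (\<Union>s\<in>S n. D s)"
    by (simp_all add: S_def)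
  have IS: "I s" if "s \<in> S n" for s n
    using that
  proof (induction n arbitrary: s)
    case 0 then show ?case using I0 S by simp
  next
    case (Suc n)
    then obtain t where "t \<in> S n" "s \<in> D t" using S by auto
    then show ?case using D[of t] Suc.IH by auto
  qed
  define G where "G n = (\<Union>s\<in>S n. reg s)" for n
  have oG: "openin X (G n)" for n
    using nonempty_openD(1)[OF I_reg[OF IS]] by (auto simp: G_def)
  have GQ: "G n \<subseteq> Q \<and> Q \<subseteq> X closure_of G n" for n
  proof (induction n)
    case 0
    have "Q \<subseteq> topspace X"
      using Q nonempty_openD(3)[of Q X] by (simp add: nonmeager_open_def)
    then show ?case
      using closure_of_subset[of Q X] by (simp add: G_def S reg0)
  next
    case (Suc n)
    have "reg s \<subseteq> X closure_of G (Suc n)" if "s \<in> S n" for s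
    proof -
      have "reg s \<subseteq> X closure_of (\<Union>t\<in>D s. reg t)"
        using D[OF IS[OF that]] by simp
      also have "\<dots> \<subseteq> X closure_of G (Suc n)"
        by (rule closure_of_mono) (use that in \<open>auto simp: G_def S\<close>)
      finally show ?thesis .
    qed
    then have "G n \<subseteq> X closure_of G (Suc n)"
      by (auto simp: G_def)
    then have "X closure_of G n \<subseteq> X closure_of G (Suc n)"
      by (simp add: closure_of_minimal)
    moreover have "reg t \<subseteq> G n" if "s \<in> S n" "t \<in> D s" for s t
      using D[OF IS[OF that(1)]] that by (auto simp: G_def)
    then have "G (Suc n) \<subseteq> G n"
      by (auto simp: G_def S)
    ultimately show ?case using Suc by blast
  qed
  have "(\<Inter>n. G n) \<noteq> {}"
    by (intro nonmeager_open_Inter[OF Q] oG) (use GQ in blast)+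
  then obtain x where x: "\<And>n. x \<in> G n"
    by blast
  have unique: "s = t" if "s \<in> S n" "t \<in> S n" "x \<in> reg s" "x \<in> reg t" for s t n
    using that
  proof (induction n arbitrary: s t)
    case 0 then show ?case using S by simp
  next
    case (Suc n)
    then obtain s1 t1 where st: "s1 \<in> S n" "s \<in> D s1" "t1 \<in> S n" "t \<in> D t1" using S by auto
    then have "x \<in> reg s1" "x \<in> reg t1"
      using D[OF IS[OF st(1)]] D[OF IS[OF st(3)]] Suc.prems by auto
    then have "s1 = t1"
      using Suc.IH st by blast
    then have "\<not> s \<noteq> t"
      using D[OF IS[OF st(1)]] st Suc.prems(3,4) unfolding pairwise_def disjnt_def by blast
    then show ?case by blast
  qed
  have "\<exists>s. s \<in> S n \<and> x \<in> reg s" for n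
    using x[of n] by (auto simp: G_def)
  then obtain \<sigma> where \<sigma>: "\<And>n. \<sigma> n \<in> S n" "\<And>n. x \<in> reg (\<sigma> n)"
    by metis
  have "step (\<sigma> n) (\<sigma> (Suc n))" for n
  proof -
    obtain t where t: "t \<in> S n" "\<sigma> (Suc n) \<in> D t"
      using \<sigma>(1)[of "Suc n"] S by auto
    then have "x \<in> reg t"
      using D[OF IS[OF t(1)]] \<sigma>(2)[of "Suc n"] by auto
    then have "t = \<sigma> n"
      using unique t(1) \<sigma> by blast
    then show ?thesis
      using D[OF IS[OF t(1)]] t(2) by auto
  qed
  moreover have "\<sigma> 0 = s0"
    using \<sigma>(1)[of 0] S by simp
  ultimately show thesis
    using that[of \<sigma>] \<sigma>(2) by blast
qed

lemma regular_space_shrink: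
  assumes "regular_space X" "V \<in> nonempty_open X"
  obtains W where "W \<in> nonempty_open X" "W \<subseteq> V" "X closure_of W \<subseteq> V"
proof -
  obtain x where x: "x \<in> V"
    using assms(2) nonempty_openD(2) by blast
  obtain U C where U: "openin X U" "closedin X C" "x \<in> U" "U \<subseteq> C" "C \<subseteq> V"
    using assms x nonempty_openD(1) unfolding neighbourhood_base_of_closedin[symmetric] neighbourhood_base_of
    by meson
  then have "X closure_of U \<subseteq> V"
    using closure_of_minimal by (metis subset_trans)
  then show thesis
    using that[of U] U by (auto simp: nonempty_open_def)
qed

section \<open>\<open>\<sigma>\<close>-spaces\<close>

text \<open>The set \<open>A\<^sub>n\<close> consists of the points witnessed by the \<open>n\<close>-th discrete family. Where \<open>A\<^sub>n\<close> is dense,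
discreteness isolates one member \<open>F\<close>, and all points of \<open>A\<^sub>n\<close> there are witnessed by this \<open>F\<close>.\<close>

lemma sigma_space_imp_good_Delta_s:
  assumes reg: "regular_space X" and sig: "sigma_space X" and Q: "nonmeager_open X Q"
    and P: "semi_neighborhood X P"
  shows "\<exists>W\<in>nonempty_open X. W \<subseteq> Q \<and> good_Delta_s X P W"
proof -
  obtain \<N> :: "nat \<Rightarrow> 'a set set" where disc: "\<And>n. discrete_family_in X (\<N> n)"
    and net: "network_of X (\<Union>n. \<N> n)"
    using sig unfolding sigma_space_def by blast
  define A where "A n = {x \<in> topspace X. \<exists>F\<in>\<N> n. x \<in> F \<and> X closure_of F \<subseteq> P `` {x}}" for n
  have "topspace X \<subseteq> (\<Union>n. A n)"
  proof
    fix x assume x: "x \<in> topspace X"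
    obtain g where g: "openin X g" "x \<in> g" "g \<subseteq> P `` {x}"
      using semi_neighborhoodD[OF P x] by blast
    obtain U C where U: "openin X U" "closedin X C" "x \<in> U" "U \<subseteq> C" "C \<subseteq> g"
      using reg g unfolding neighbourhood_base_of_closedin[symmetric] neighbourhood_base_of
      by meson
    obtain F where F: "F \<in> (\<Union>n. \<N> n)" "x \<in> F" "F \<subseteq> U"
      using net U unfolding network_of_def by meson
    have "X closure_of F \<subseteq> C"
      by (rule closure_of_minimal) (use F U in auto)
    then have "X closure_of F \<subseteq> P `` {x}"
      using U(5) g(3) by (meson subset_trans)
    then show "x \<in> (\<Union>n. A n)"
      using F(1,2) x by (auto simp: A_def)
  qed
  moreover have "A n \<subseteq> topspace X" for n
    by (auto simp: A_def)
  ultimately have "topspace X = (\<Union>n. A n)"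
    by blast
  then obtain n V where V: "V \<in> nonempty_open X" "V \<subseteq> Q" "V \<subseteq> X closure_of A n"
    by (rule nonmeager_open_somewhere_dense[OF Q])
  obtain v where v: "v \<in> V" "v \<in> topspace X"
    using nonempty_openD(2,3)[OF V(1)] by blast
  obtain H where H: "openin X H" "v \<in> H"
    "\<And>D E. D \<in> \<N> n \<Longrightarrow> E \<in> \<N> n \<Longrightarrow> D \<inter> H \<noteq> {} \<Longrightarrow> E \<inter> H \<noteq> {} \<Longrightarrow> D = E"
    using disc[of n] v(2) unfolding discrete_family_in_def by meson
  define W where "W = V \<inter> H"
  have W: "W \<in> nonempty_open X" "W \<subseteq> Q" "W \<subseteq> X closure_of A n"
    using V H(1,2) v by (auto simp: W_def nonempty_open_def openin_Int)
  have dense: "\<exists>y. y \<in> A n \<inter> W \<and> y \<in> T" if "openin X T" "w \<in> T" "w \<in> W" for w T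
  proof -
    have "w \<in> X closure_of A n" "openin X (T \<inter> W)" "w \<in> T \<inter> W"
      using that W by (auto simp: nonempty_open_def openin_Int)
    then show ?thesis
      unfolding in_closure_of by blast
  qed
  have "v \<in> W"
    using v H by (simp add: W_def)
  then obtain a where a: "a \<in> A n" "a \<in> W"
    using dense[OF nonempty_openD(1)[OF W(1)]] by blast
  then obtain F where F: "F \<in> \<N> n" "a \<in> F"
    by (auto simp: A_def)
  have F_unique: "E = F" if "E \<in> \<N> n" "y \<in> E" "y \<in> W" for E y
    using H(3)[OF that(1) F(1)] that F a by (auto simp: W_def)
  have "A n \<inter> W \<subseteq> F"
    using F_unique by (auto simp: A_def)
  then have "W \<subseteq> X closure_of F"
    using dense nonempty_openD(3)[OF W(1)] unfolding in_closure_of subset_iff by (metis IntD1 IntD2 Int_iff)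
  moreover have "X closure_of F \<subseteq> P `` {y}" if "y \<in> A n \<inter> W" for y
    using that F_unique by (auto simp: A_def)
  ultimately have "W \<subseteq> P `` {y}" if "y \<in> A n \<inter> W" for y
    using that by (meson subset_trans)
  then have "(A n \<inter> W) \<times> W \<subseteq> P"
    by auto
  moreover have "dense_subset X W (A n \<inter> W)"
    using dense nonempty_openD(3)[OF W(1)] unfolding dense_subset_def in_closure_of subset_iff
    by (metis Int_iff)
  ultimately show ?thesis
    using W(1,2) unfolding good_Delta_s_def by (metis (no_types))
qed

section \<open>Free ultrafilters on the natural numbers\<close>

definition free_ultrafilter :: "nat filter \<Rightarrow> bool" where
  "free_ultrafilter U \<longleftrightarrow> U \<noteq> bot \<and> U \<le> sequentially \<and>
     (\<forall>P. eventually P U \<or> eventually (\<lambda>n. \<not> P n) U)"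

lemma free_ultrafilter_sequentially:
  "free_ultrafilter U \<Longrightarrow> eventually P sequentially \<Longrightarrow> eventually P U"
  by (simp add: free_ultrafilter_def le_filter_def)

lemma free_ultrafilter_ex: "free_ultrafilter U \<Longrightarrow> eventually P U \<Longrightarrow> \<exists>n. P n"
  using eventually_happens'[of U P] by (simp add: free_ultrafilter_def)

lemma free_ultrafilter_cases:
  assumes "free_ultrafilter U"
  obtains "eventually P U" | "eventually (\<lambda>n. \<not> P n) U"
  using assms by (auto simp: free_ultrafilter_def)

text \<open>Ultrafilters are the minimal proper filters in the order of refinement; the infimum of a chain of
proper filters is proper, so Zorn's lemma applies.\<close>

lemma free_ultrafilter_extends:
  assumes F: "F \<noteq> bot" "F \<le> sequentially"
  obtains U where "free_ultrafilter U" "U \<le> F"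
proof -
  define A where "A = {G. G \<noteq> bot \<and> G \<le> F}"
  define r :: "nat filter \<Rightarrow> nat filter \<Rightarrow> bool" where "r = (\<lambda>a b. b \<le> a)"
  have "\<exists>U\<in>A. \<forall>G\<in>A. r U G \<longrightarrow> G = U"
  proof (rule predicate_Zorn)
    show "partial_order_on A (relation_of r A)"
      by (rule partial_order_on_relation_ofI) (auto simp: r_def)
    fix C assume C: "C \<in> Chains (relation_of r A)"
    have CA: "C \<subseteq> A" and chain: "\<And>a b. a \<in> C \<Longrightarrow> b \<in> C \<Longrightarrow> a \<le> b \<or> b \<le> a"
      using C by (auto simp: Chains_def relation_of_def r_def)
    have fin: "Y \<noteq> {} \<longrightarrow> Inf Y \<in> Y" if "finite Y" "Y \<subseteq> C" for Y
      using that
    proof (induction Y rule: finite_induct)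
      case (insert a Y)
      show ?case
      proof (cases "Y = {}")
        case False
        then have "a \<le> Inf Y \<or> Inf Y \<le> a"
          using insert chain[of a "Inf Y"] by auto
        then show ?thesis
          using insert False by (auto simp: inf_absorb1 inf_absorb2)
      qed simp
    qed simp
    have notbot: "Inf C \<noteq> bot"
    proof (rule Inf_filter_not_bot)
      fix Y assume Y: "Y \<subseteq> C" "finite Y"
      show "Inf Y \<noteq> bot"
      proof (cases "Y = {}")
        case False
        then show ?thesis using fin Y CA by (auto simp: A_def)
      next
        case True
        have "top \<noteq> (bot :: nat filter)"
          using F(1) bot.extremum_uniqueI[of F] top_greatest[of F] by metis
        then show ?thesis using True by simp
      qed
    qed
    show "\<exists>U\<in>A. \<forall>a\<in>C. r a U"
    proof (cases "C = {}")
      case True then show ?thesis using F by (auto simp: A_def)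
    next
      case False
      then obtain c where "c \<in> C" by blast
      then have "Inf C \<le> F"
        using Inf_lower[of c C] CA by (auto simp: A_def)
      then have "Inf C \<in> A"
        using notbot by (simp add: A_def)
      moreover have "\<forall>a\<in>C. r a (Inf C)"
        by (simp add: r_def Inf_lower)
      ultimately show ?thesis by blast
    qed
  qed
  then obtain U where U: "U \<noteq> bot" "U \<le> F" and min: "\<And>G. G \<noteq> bot \<Longrightarrow> G \<le> U \<Longrightarrow> G = U"
    by (auto simp: A_def r_def intro: order_trans)
  have "eventually P U \<or> eventually (\<lambda>n. \<not> P n) U" for P
  proof (cases "eventually (\<lambda>n. \<not> P n) U")
    case False
    have "inf U (principal {n. P n}) \<noteq> bot"
      using False by (simp add: trivial_limit_def eventually_inf_principal)
    then have "inf U (principal {n. P n}) = U"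
      by (rule min) simp
    moreover have "eventually P (inf U (principal {n. P n}))"
      by (simp add: eventually_inf_principal)
    ultimately show ?thesis by simp
  qed simp
  then show thesis
    using that[of U] U F(2) by (simp add: free_ultrafilter_def)
qed

text \<open>A singleton-valued \<open>M\<close> converges in this sense exactly as the sequence of its points; for sets in
general, each neighborhood of \<open>b\<close> has to be met along \<open>U\<close>. Treating both at once lets one proof serve
\<open>\<Delta>\<^sub>h\<close> and \<open>\<Delta>\<close>.\<close>

definition set_limit :: "'a topology \<Rightarrow> (nat \<Rightarrow> 'a set) \<Rightarrow> 'a \<Rightarrow> nat filter \<Rightarrow> bool" where
  "set_limit X M b U \<longleftrightarrow>
     b \<in> topspace X \<and> (\<forall>G. openin X G \<and> b \<in> G \<longrightarrow> eventually (\<lambda>n. M n \<inter> G \<noteq> {}) U)"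

definition limit_ultrafilters :: "'a topology \<Rightarrow> (nat \<Rightarrow> 'a set) \<Rightarrow> nat filter set" where
  "limit_ultrafilters X M = {U. free_ultrafilter U \<and> (\<exists>b. set_limit X M b U)}"

lemma limitin_imp_set_limit:
  assumes "limitin X y b U" "eventually (\<lambda>n. y n \<in> M n) U"
  shows "set_limit X M b U"
  unfolding set_limit_def
proof (intro conjI allI impI)
  show "b \<in> topspace X"
    using assms(1) by (simp add: limitin_def)
  fix G assume "openin X G \<and> b \<in> G"
  then have "eventually (\<lambda>n. y n \<in> G) U"
    using assms(1) by (simp add: limitin_def)
  then show "eventually (\<lambda>n. M n \<inter> G \<noteq> {}) U"
    using assms(2) by eventually_elim blast
qed

lemma set_limit_in_closure:
  assumes U: "free_ultrafilter U" and lim: "set_limit X M b U"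
    and sub: "\<And>n. n \<ge> N \<Longrightarrow> M n \<subseteq> W"
  shows "b \<in> X closure_of W"
  unfolding in_closure_of
proof (intro conjI allI impI)
  show "b \<in> topspace X" using lim by (simp add: set_limit_def)
  fix G assume G: "b \<in> G \<and> openin X G"
  then have "eventually (\<lambda>n. M n \<inter> G \<noteq> {}) U"
    using lim by (simp add: set_limit_def)
  moreover have "eventually (\<lambda>n. n \<ge> N) U"
    by (rule free_ultrafilter_sequentially[OF U eventually_ge_at_top])
  ultimately have "eventually (\<lambda>n. M n \<inter> G \<noteq> {} \<and> n \<ge> N) U"
    by eventually_elim simp
  from free_ultrafilter_ex[OF U this] obtain n where "M n \<inter> G \<noteq> {}" "n \<ge> N" by blast
  then show "\<exists>y. y \<in> W \<and> y \<in> G"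
    using sub[of n] by blast
qed

text \<open>The sets of indices \<open>n \<ge> k\<close> with \<open>M n\<close> meeting a neighborhood of \<open>b\<close> form a filter base.\<close>

lemma Ls_imp_limit_ultrafilter:
  assumes b: "b \<in> Ls X M"
  shows "limit_ultrafilters X M \<noteq> {}"
proof -
  define I where "I = {G. openin X G \<and> b \<in> G} \<times> (UNIV :: nat set)"
  define f where "f i = principal {n. n \<ge> snd i \<and> M n \<inter> fst i \<noteq> {}}" for i :: "'a set \<times> nat"
  have top: "b \<in> topspace X" and inf: "\<And>G. openin X G \<Longrightarrow> b \<in> G \<Longrightarrow> infinite {n. M n \<inter> G \<noteq> {}}"
    using b by (auto simp: Ls_def)
  have "(INF i\<in>I. f i) = bot \<longleftrightarrow> (\<exists>i\<in>I. f i = bot)"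
  proof (rule INF_filter_bot_base)
    fix i j assume ij: "i \<in> I" "j \<in> I"
    then have "(fst i \<inter> fst j, max (snd i) (snd j)) \<in> I"
      by (auto simp: I_def)
    moreover have "f (fst i \<inter> fst j, max (snd i) (snd j)) \<le> inf (f i) (f j)"
      by (auto simp: f_def)
    ultimately show "\<exists>k\<in>I. f k \<le> inf (f i) (f j)" by blast
  qed
  moreover have "f i \<noteq> bot" if i: "i \<in> I" for i
  proof -
    have "infinite {n. M n \<inter> fst i \<noteq> {}}"
      using i inf by (auto simp: I_def)
    then obtain n where "n \<ge> snd i" "M n \<inter> fst i \<noteq> {}"
      unfolding infinite_nat_iff_unbounded_le by blast
    then show ?thesis by (auto simp: f_def principal_eq_bot_iff)
  qed
  ultimately have "(INF i\<in>I. f i) \<noteq> bot" by blast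
  moreover have "(INF i\<in>I. f i) \<le> sequentially"
  proof (rule filter_leI)
    fix P :: "nat \<Rightarrow> bool" assume "eventually P sequentially"
    then obtain k where k: "\<And>n. n \<ge> k \<Longrightarrow> P n"
      by (auto simp: eventually_sequentially)
    have "(topspace X, k) \<in> I"
      using top by (simp add: I_def)
    then have "(INF i\<in>I. f i) \<le> f (topspace X, k)"
      by (rule INF_lower)
    moreover have "eventually P (f (topspace X, k))"
      using k by (simp add: f_def eventually_principal)
    ultimately show "eventually P (INF i\<in>I. f i)"
      by (simp add: le_filter_def)
  qed
  ultimately obtain U where U: "free_ultrafilter U" "U \<le> (INF i\<in>I. f i)"
    by (rule free_ultrafilter_extends)
  have "set_limit X M b U"
    unfolding set_limit_def
  proof (intro conjI allI impI top)
    fix G assume "openin X G \<and> b \<in> G"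
    then have "(G, 0) \<in> I" by (simp add: I_def)
    then have "U \<le> f (G, 0)"
      using U(2) INF_lower order_trans by meson
    moreover have "eventually (\<lambda>n. M n \<inter> G \<noteq> {}) (f (G, 0))"
      by (simp add: f_def eventually_principal)
    ultimately show "eventually (\<lambda>n. M n \<inter> G \<noteq> {}) U"
      by (simp add: le_filter_def)
  qed
  then show ?thesis
    using U(1) by (auto simp: limit_ultrafilters_def)
qed

section \<open>Controlled spaces\<close>

datatype move_kind = Points | Opens

fun moves :: "move_kind \<Rightarrow> 'a topology \<Rightarrow> 'a set set" where
  "moves Points X = singletons X"
| "moves Opens X = nonempty_open X"

lemma moves_nonempty: "M \<in> moves k X \<Longrightarrow> M \<noteq> {}"
  by (cases k) (auto simp: singletons_def nonempty_open_def)

lemma moves_subset: "M \<in> moves k X \<Longrightarrow> M \<subseteq> topspace X"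
  by (cases k) (auto simp: singletons_def dest: nonempty_openD(3))

text \<open>The list contains the earlier moves \<open>M\<^sub>0, \<dots>, M\<^sub>n\<^sub>-\<^sub>1\<close>. Closure under smaller open sets allows
finitely many such requirements to be met one after another.\<close>

definition pi_rule :: "'a topology \<Rightarrow> ('a set list \<Rightarrow> 'a set set) \<Rightarrow> bool" where
  "pi_rule X \<G> \<longleftrightarrow> (\<forall>l. \<G> l \<subseteq> nonempty_open X \<and>
     (\<forall>W\<in>\<G> l. \<forall>V\<in>nonempty_open X. V \<subseteq> W \<longrightarrow> V \<in> \<G> l) \<and>
     (\<forall>V\<in>nonempty_open X. \<exists>W\<in>\<G> l. W \<subseteq> V))"

text \<open>The rule has to be obeyed only from some move on: a coordinate of a product is subject to its own
rule only once it has become visible in the play.\<close>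

definition controlled_play ::
    "move_kind \<Rightarrow> 'a topology \<Rightarrow> ('a set list \<Rightarrow> 'a set set) \<Rightarrow> (nat \<Rightarrow> 'a set) \<Rightarrow> (nat \<Rightarrow> 'a set) \<Rightarrow> bool"
  where "controlled_play k X \<G> W M \<longleftrightarrow>
     decseq W \<and> (\<Inter>n. W n) \<noteq> {} \<and> (\<forall>n. M n \<in> moves k X \<and> M n \<subseteq> W n) \<and>
     (\<exists>N. \<forall>n\<ge>N. W n \<in> \<G> (map M [0..<n]))"

lemma controlled_playE:
  assumes "controlled_play k X \<G> W M"
  obtains x N where "decseq W" "\<And>n. x \<in> W n" "\<And>n. M n \<in> moves k X" "\<And>n. M n \<subseteq> W n"
    "\<And>n. n \<ge> N \<Longrightarrow> W n \<in> \<G> (map M [0..<n])"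
proof -
  obtain x where x: "x \<in> (\<Inter>n. W n)"
    using assms unfolding controlled_play_def by blast
  obtain N where N: "\<forall>n\<ge>N. W n \<in> \<G> (map M [0..<n])"
    using assms unfolding controlled_play_def by (elim conjE exE)
  show thesis
    by (rule that[of x N]) (use assms x N in \<open>auto simp: controlled_play_def\<close>)
qed

text \<open>The parameter \<open>\<Q>\<close> says along how many free ultrafilters the moves \<open>M\<close> have to converge; the two
values of interest are \<open>some_ultrafilter\<close> and \<open>every_ultrafilter\<close>.\<close>

definition controlled :: "(nat filter set \<Rightarrow> bool) \<Rightarrow> move_kind \<Rightarrow> 'a topology \<Rightarrow> bool" where
  "controlled \<Q> k X \<longleftrightarrow>
     (\<exists>\<G>. pi_rule X \<G> \<and> (\<forall>W M. controlled_play k X \<G> W M \<longrightarrow> \<Q> (limit_ultrafilters X M)))"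

definition some_ultrafilter :: "nat filter set \<Rightarrow> bool" where
  "some_ultrafilter A \<longleftrightarrow> A \<noteq> {}"

definition every_ultrafilter :: "nat filter set \<Rightarrow> bool" where
  "every_ultrafilter A \<longleftrightarrow> {U. free_ultrafilter U} \<subseteq> A"

lemma Ls_nonempty_imp_some_ultrafilter:
  assumes "Ls X M \<noteq> {}"
  shows "some_ultrafilter (limit_ultrafilters X M)"
proof -
  obtain b where "b \<in> Ls X M" using assms by blast
  then show ?thesis
    unfolding some_ultrafilter_def by (rule Ls_imp_limit_ultrafilter)
qed

lemma mono_some_ultrafilter: "mono some_ultrafilter"
  by (auto simp: mono_def some_ultrafilter_def)

lemma mono_every_ultrafilter: "mono every_ultrafilter"
  by (auto simp: mono_def every_ultrafilter_def)

lemma controlledI: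
  assumes "pi_rule X \<G>" "\<And>W M. controlled_play k X \<G> W M \<Longrightarrow> \<Q> (limit_ultrafilters X M)"
  shows "controlled \<Q> k X"
  unfolding controlled_def using assms by (intro exI[of _ \<G>]) simp

lemma controlledE:
  assumes "controlled \<Q> k X"
  obtains \<G> where "pi_rule X \<G>" "\<And>W M. controlled_play k X \<G> W M \<Longrightarrow> \<Q> (limit_ultrafilters X M)"
  using assms unfolding controlled_def by (elim exE conjE) simp

lemma pi_ruleD:
  assumes "pi_rule X \<G>"
  shows "W \<in> \<G> l \<Longrightarrow> W \<in> nonempty_open X"
    and "W \<in> \<G> l \<Longrightarrow> V \<in> nonempty_open X \<Longrightarrow> V \<subseteq> W \<Longrightarrow> V \<in> \<G> l"
    and "V \<in> nonempty_open X \<Longrightarrow> \<exists>W\<in>\<G> l. W \<subseteq> V"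
  using assms unfolding pi_rule_def by auto

text \<open>The states of the play are the lists of the sets \<open>W\<close> chosen so far, and the region of a state is
\<open>\<phi>\<close> of its last set. A branch with nonempty intersection obeys the rule, so the moves \<open>\<psi> W\<close> converge to
some \<open>b\<close>. Nested closures put \<open>b\<close> into every \<open>\<phi> W\<close>, and the neighborhood \<open>P(b)\<close> meets some \<open>\<psi> W\<close>.\<close>

lemma controlled_imp_no_bad_moves:
  assumes reg: "regular_space X" and Q: "nonmeager_open X Q" and ctrl: "controlled some_ultrafilter k X"
    and P: "semi_neighborhood X P"
    and bad: "\<And>W. W \<in> nonempty_open X \<Longrightarrow> W \<subseteq> Q \<Longrightarrow>
      \<exists>V M. V \<in> nonempty_open X \<and> V \<subseteq> W \<and> M \<in> moves k X \<and> M \<subseteq> W \<and> V \<times> M \<inter> P = {}"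
  shows False
proof -
  obtain \<G> where \<G>: "pi_rule X \<G>"
    and play: "\<And>W M. controlled_play k X \<G> W M \<Longrightarrow> some_ultrafilter (limit_ultrafilters X M)"
    using ctrl by (rule controlledE) blast
  define \<Phi> where "\<Phi> W m \<longleftrightarrow> fst m \<in> nonempty_open X \<and> fst m \<subseteq> W \<and> snd m \<in> moves k X \<and> snd m \<subseteq> W \<and>
      fst m \<times> snd m \<inter> P = {}" for W and m :: "'a set \<times> 'a set"
  define \<phi> where "\<phi> W = fst (SOME m. \<Phi> W m)" for W
  define \<psi> where "\<psi> W = snd (SOME m. \<Phi> W m)" for W
  have sel: "\<phi> W \<in> nonempty_open X \<and> \<phi> W \<subseteq> W \<and> \<psi> W \<in> moves k X \<and> \<psi> W \<subseteq> W \<and> \<phi> W \<times> \<psi> W \<inter> P = {}"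
    if W: "W \<in> nonempty_open X" "W \<subseteq> Q" for W
  proof -
    obtain V M where "V \<in> nonempty_open X \<and> V \<subseteq> W \<and> M \<in> moves k X \<and> M \<subseteq> W \<and> V \<times> M \<inter> P = {}"
      using bad[OF W] by (elim exE)
    then have "\<Phi> W (V, M)" by (simp add: \<Phi>_def)
    then have "\<Phi> W (SOME m. \<Phi> W m)" by (rule someI)
    then show ?thesis by (simp add: \<Phi>_def \<phi>_def \<psi>_def)
  qed
  define reg where "reg h = (if h = [] then Q else \<phi> (last h))" for h
  define I where "I h \<longleftrightarrow> h = [] \<or> last h \<in> nonempty_open X \<and> last h \<subseteq> Q" for h
  define step where "step h h' \<longleftrightarrow>
    (\<exists>W. h' = h @ [W] \<and> W \<in> \<G> (map \<psi> h) \<and> X closure_of W \<subseteq> reg h \<and> W \<subseteq> reg h)" for h h'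
  have QO: "Q \<in> nonempty_open X"
    using Q by (simp add: nonmeager_open_def)
  have regQ: "reg h \<subseteq> Q" if "I h" for h
    using that sel[of "last h"] by (auto simp: reg_def I_def)
  obtain \<sigma> where \<sigma>: "\<sigma> 0 = []" "\<And>n. step (\<sigma> n) (\<sigma> (Suc n))" "(\<Inter>n. reg (\<sigma> n)) \<noteq> {}"
  proof (rule nonmeager_branch[OF Q, of I "[]" reg step])
    show "I []" "reg [] = Q" by (simp_all add: I_def reg_def)
    show "reg h \<in> nonempty_open X" if "I h" for h
      using that sel[of "last h"] QO by (auto simp: reg_def I_def)
    show "\<exists>h'. I h' \<and> step h h' \<and> reg h' \<subseteq> V"
      if h: "I h" and V: "V \<in> nonempty_open X" "V \<subseteq> reg h" for h V
    proof -
      obtain W' where W': "W' \<in> nonempty_open X" "W' \<subseteq> V" "X closure_of W' \<subseteq> V"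
        by (rule regular_space_shrink[OF \<open>regular_space X\<close> V(1)])
      obtain W where W: "W \<in> \<G> (map \<psi> h)" "W \<subseteq> W'"
        using pi_ruleD(3)[OF \<G> W'(1)] by blast
      have WO: "W \<in> nonempty_open X" "W \<subseteq> V" "W \<subseteq> Q"
        using pi_ruleD(1)[OF \<G> W(1)] W W' V(2) regQ[OF h] by auto
      have "X closure_of W \<subseteq> V"
        using closure_of_mono[OF W(2)] W'(3) by (rule subset_trans)
      then have "step h (h @ [W])"
        using W(1) V(2) WO(2) by (auto simp: step_def)
      moreover have "I (h @ [W])" "reg (h @ [W]) \<subseteq> V"
        using WO sel[of W] by (auto simp: I_def reg_def)
      ultimately show ?thesis by blast
    qed
  qed (rule that; assumption)
  define W where "W n = last (\<sigma> (Suc n))" for n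
  define M where "M n = \<psi> (W n)" for n
  have succ: "\<sigma> (Suc n) = \<sigma> n @ [W n]" "W n \<in> \<G> (map \<psi> (\<sigma> n))"
    "X closure_of W n \<subseteq> reg (\<sigma> n)" "W n \<subseteq> reg (\<sigma> n)" for n
    using \<sigma>(2)[of n] by (auto simp: step_def W_def)
  have \<sigma>_eq: "\<sigma> n = map W [0..<n]" for n
    by (induction n) (simp_all add: \<sigma>(1) succ(1))
  have reg_Suc: "reg (\<sigma> (Suc n)) = \<phi> (W n)" for n
    by (simp add: succ(1) reg_def)
  have WO: "W n \<in> nonempty_open X" for n
    by (rule pi_ruleD(1)[OF \<G> succ(2)])
  have WQ: "W n \<subseteq> Q" for n
  proof (induction n)
    case 0 show ?case using succ(4)[of 0] by (simp add: \<sigma>(1) reg_def)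
  next
    case (Suc n) then show ?case
      using succ(4)[of "Suc n"] sel[OF WO Suc] by (auto simp: reg_Suc)
  qed
  note selW = sel[OF WO WQ]
  have W_Suc: "W (Suc n) \<subseteq> \<phi> (W n)" "X closure_of W (Suc n) \<subseteq> \<phi> (W n)" for n
    using succ(3,4)[of "Suc n"] by (simp_all add: reg_Suc)
  have dec: "decseq W"
    by (rule decseq_SucI) (use W_Suc(1) selW in blast)
  have "(\<Inter>n. reg (\<sigma> n)) \<subseteq> (\<Inter>n. W n)"
  proof (rule INT_greatest)
    fix n
    have "(\<Inter>n. reg (\<sigma> n)) \<subseteq> reg (\<sigma> (Suc n))" by blast
    then show "(\<Inter>n. reg (\<sigma> n)) \<subseteq> W n"
      using selW[of n] by (auto simp: reg_Suc)
  qed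
  then have "(\<Inter>n. W n) \<noteq> {}"
    using \<sigma>(3) by blast
  moreover have "W n \<in> \<G> (map M [0..<n])" for n
  proof -
    have "map \<psi> (\<sigma> n) = map M [0..<n]"
      by (simp add: \<sigma>_eq) (simp add: M_def)
    then show ?thesis using succ(2)[of n] by simp
  qed
  ultimately have "controlled_play k X \<G> W M"
    using dec selW by (simp add: controlled_play_def M_def)
  from play[OF this] obtain U b where U: "free_ultrafilter U" and b: "set_limit X M b U"
    by (auto simp: some_ultrafilter_def limit_ultrafilters_def)
  have b_in: "b \<in> \<phi> (W m)" for m
  proof -
    have "b \<in> X closure_of W (Suc m)"
    proof (rule set_limit_in_closure[OF U b])
      show "M n \<subseteq> W (Suc m)" if "n \<ge> Suc m" for n
        using selW[of n] decseqD[OF dec that] by (auto simp: M_def)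
    qed
    then show ?thesis using W_Suc(2) by blast
  qed
  have "b \<in> topspace X" using b by (simp add: set_limit_def)
  then obtain g where g: "openin X g" "b \<in> g" "g \<subseteq> P `` {b}"
    using semi_neighborhoodD[OF P] by blast
  then have "eventually (\<lambda>n. M n \<inter> g \<noteq> {}) U"
    using b by (simp add: set_limit_def)
  from free_ultrafilter_ex[OF U this] obtain n where "M n \<inter> g \<noteq> {}" by blast
  then obtain y where "y \<in> M n" "(b, y) \<in> P"
    using g(3) by blast
  then have "(b, y) \<in> \<phi> (W n) \<times> \<psi> (W n) \<inter> P"
    using b_in by (simp add: M_def)
  then show False
    using selW[of n] by simp
qed

lemma controlled_imp_good_Delta_h:
  assumes "regular_space X" "nonmeager_open X Q" "controlled some_ultrafilter Points X"
    "semi_neighborhood X P"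
  shows "\<exists>W\<in>nonempty_open X. W \<subseteq> Q \<and> good_Delta_h X P W"
proof (rule ccontr)
  assume no: "\<not> ?thesis"
  show False
  proof (rule controlled_imp_no_bad_moves[OF assms])
    fix W assume W: "W \<in> nonempty_open X" "W \<subseteq> Q"
    then have "\<not> good_Delta_h X P W" using no by blast
    then obtain V M where "V \<in> nonempty_open X" "V \<subseteq> W" "M \<in> singletons X" "M \<subseteq> W" "V \<times> M \<inter> P = {}"
      by (rule not_good_Delta_h[OF nonempty_openD(1)[OF W(1)]])
    then show "\<exists>V M. V \<in> nonempty_open X \<and> V \<subseteq> W \<and> M \<in> moves Points X \<and> M \<subseteq> W \<and> V \<times> M \<inter> P = {}"
      by (intro exI[of _ V] exI[of _ M]) simp
  qed
qed

lemma controlled_imp_good_Delta: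
  assumes "regular_space X" "nonmeager_open X Q" "controlled some_ultrafilter Opens X"
    "semi_neighborhood X P"
  shows "\<exists>W\<in>nonempty_open X. W \<subseteq> Q \<and> good_Delta X P W"
proof (rule ccontr)
  assume no: "\<not> ?thesis"
  show False
  proof (rule controlled_imp_no_bad_moves[OF assms])
    fix W assume W: "W \<in> nonempty_open X" "W \<subseteq> Q"
    then have "\<not> good_Delta X P W" using no by blast
    then obtain V M where "V \<in> nonempty_open X" "V \<subseteq> W" "M \<in> nonempty_open X" "M \<subseteq> W" "V \<times> M \<inter> P = {}"
      by (rule not_good_Delta[OF nonempty_openD(1)[OF W(1)]])
    then show "\<exists>V M. V \<in> nonempty_open X \<and> V \<subseteq> W \<and> M \<in> moves Opens X \<and> M \<subseteq> W \<and> V \<times> M \<inter> P = {}"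
      by (intro exI[of _ V] exI[of _ M]) simp
  qed
qed

section \<open>Spaces controlled by a sequence of \<open>\<pi>\<close>-bases\<close>

lemma limit_ultrafilters_eventually_eq:
  assumes "\<And>n. n \<ge> N \<Longrightarrow> M n = M' n"
  shows "limit_ultrafilters X M \<subseteq> limit_ultrafilters X M'"
proof
  fix U assume "U \<in> limit_ultrafilters X M"
  then obtain b where U: "free_ultrafilter U" and b: "set_limit X M b U"
    by (auto simp: limit_ultrafilters_def)
  have N: "eventually (\<lambda>n. n \<ge> N) U"
    by (rule free_ultrafilter_sequentially[OF U eventually_ge_at_top])
  have "set_limit X M' b U"
    unfolding set_limit_def
  proof (intro conjI allI impI)
    show "b \<in> topspace X" using b by (simp add: set_limit_def)
    fix G assume "openin X G \<and> b \<in> G"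
    then have "eventually (\<lambda>n. M n \<inter> G \<noteq> {}) U"
      using b by (simp add: set_limit_def)
    then show "eventually (\<lambda>n. M' n \<inter> G \<noteq> {}) U"
      using N by eventually_elim (simp add: assms)
  qed
  then show "U \<in> limit_ultrafilters X M'"
    using U by (auto simp: limit_ultrafilters_def)
qed

text \<open>The usual source of control: a sequence of \<open>\<pi>\<close>-bases, imposed cumulatively. Since the rule holds
only from move \<open>N\<close> on, the initial part of the play is replaced by its \<open>N\<close>-th move, which satisfies the
earlier requirements as well.\<close>

lemma controlled_by_sequence:
  fixes H :: "nat \<Rightarrow> 'a set set"
  assumes Q: "mono \<Q>"
    and HO: "\<And>n. H n \<subseteq> nonempty_open X"
    and down: "\<And>n W V. W \<in> H n \<Longrightarrow> V \<in> nonempty_open X \<Longrightarrow> V \<subseteq> W \<Longrightarrow> V \<in> H n"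
    and dense: "\<And>n V. V \<in> nonempty_open X \<Longrightarrow> \<exists>W\<in>H n. W \<subseteq> V"
    and lim: "\<And>W M x. decseq W \<Longrightarrow> (\<And>n. x \<in> W n) \<Longrightarrow> (\<And>n. W n \<in> H n) \<Longrightarrow>
      (\<And>n. M n \<in> moves k X) \<Longrightarrow> (\<And>n. M n \<subseteq> W n) \<Longrightarrow> \<Q> (limit_ultrafilters X M)"
  shows "controlled \<Q> k X"
proof (rule controlledI)
  define \<G> where "\<G> l = {W \<in> nonempty_open X. \<forall>j\<le>length l. W \<in> H j}" for l :: "'a set list"
  have refine: "\<exists>W\<in>nonempty_open X. W \<subseteq> V \<and> (\<forall>j\<le>n. W \<in> H j)" if "V \<in> nonempty_open X" for V n
  proof (induction n)
    case 0
    obtain W where "W \<in> H 0" "W \<subseteq> V" using dense[OF \<open>V \<in> nonempty_open X\<close>] by blast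
    then show ?case using HO[of 0] by auto
  next
    case (Suc n)
    then obtain W where W: "W \<in> nonempty_open X" "W \<subseteq> V" "\<forall>j\<le>n. W \<in> H j" by blast
    obtain W' where W': "W' \<in> H (Suc n)" "W' \<subseteq> W" using dense[OF W(1)] by blast
    have "W' \<in> nonempty_open X" using W' HO by blast
    moreover from this have "\<forall>j\<le>Suc n. W' \<in> H j"
      using W' W(3) down by (auto simp: le_Suc_eq)
    ultimately show ?case using W' W(2) by blast
  qed
  show "pi_rule X \<G>"
    unfolding pi_rule_def
  proof (intro allI conjI ballI impI)
    show "\<G> l \<subseteq> nonempty_open X" for l by (auto simp: \<G>_def)
    show "V \<in> \<G> l" if "W \<in> \<G> l" "V \<in> nonempty_open X" "V \<subseteq> W" for l W V
      using that down by (auto simp: \<G>_def)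
    show "\<exists>W\<in>\<G> l. W \<subseteq> V" if "V \<in> nonempty_open X" for l V
      using refine[OF that, of "length l"] by (auto simp: \<G>_def)
  qed
  fix W M assume play: "controlled_play k X \<G> W M"
  obtain x N where dec: "decseq W" and x: "\<And>n. x \<in> W n"
    and M: "\<And>n. M n \<in> moves k X" "\<And>n. M n \<subseteq> W n"
    and N: "\<And>n. n \<ge> N \<Longrightarrow> W n \<in> \<G> (map M [0..<n])"
    by (rule controlled_playE[OF play]) (rule that; assumption)
  have "\<Q> (limit_ultrafilters X (\<lambda>n. M (max n N)))"
  proof (rule lim[of "\<lambda>n. W (max n N)" x])
    show "decseq (\<lambda>n. W (max n N))"
      using dec by (auto simp: decseq_def)
    show "W (max n N) \<in> H n" for n
      using N[of "max n N"] by (auto simp: \<G>_def)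
  qed (use x M in auto)
  moreover have "limit_ultrafilters X (\<lambda>n. M (max n N)) \<subseteq> limit_ultrafilters X M"
    by (rule limit_ultrafilters_eventually_eq[of N]) (simp add: max_absorb1)
  ultimately show "\<Q> (limit_ultrafilters X M)"
    using Q by (auto simp: mono_def le_bool_def)
qed

lemma finite_closed_decided:
  assumes "finite \<A>" "\<And>F. F \<in> \<A> \<Longrightarrow> closedin X F" "V \<in> nonempty_open X"
  shows "\<exists>W\<in>nonempty_open X. W \<subseteq> V \<and> (\<forall>F\<in>\<A>. W \<subseteq> F \<or> W \<inter> F = {})"
  using assms(1,2)
proof (induction \<A> rule: finite_induct)
  case empty
  then show ?case using assms(3) by blast
next
  case (insert F \<A>)
  then obtain W where W: "W \<in> nonempty_open X" "W \<subseteq> V" "\<forall>F\<in>\<A>. W \<subseteq> F \<or> W \<inter> F = {}"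
    by auto
  show ?case
  proof (cases "W \<subseteq> F")
    case True then show ?thesis using W by auto
  next
    case False
    have "openin X (W - F)"
      using W(1) insert.prems[of F] by (auto simp: nonempty_open_def intro!: openin_diff)
    then have "W - F \<in> nonempty_open X"
      using False by (auto simp: nonempty_open_def)
    moreover have "W - F \<subseteq> V" "\<forall>E\<in>insert F \<A>. W - F \<subseteq> E \<or> (W - F) \<inter> E = {}"
      using W(2,3) by auto
    ultimately show ?thesis by blast
  qed
qed

text \<open>Inside such a \<open>W\<close>, a point lies in a member of \<open>\<F>\<close> only if all of \<open>W\<close> does. These sets form a
\<open>\<pi>\<close>-base when \<open>\<F>\<close> is a locally finite family of closed sets: locally there are only finitely many
members, and each of them either contains the open set at hand or can be subtracted from it.\<close>

definition decided :: "'a topology \<Rightarrow> 'a set set \<Rightarrow> 'a set set" where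
  "decided X \<F> = {W \<in> nonempty_open X. \<forall>F\<in>\<F>. W \<subseteq> F \<or> W \<inter> F = {}}"

lemma locally_finite_decided:
  assumes lf: "locally_finite_in X \<F>" and cl: "\<And>F. F \<in> \<F> \<Longrightarrow> closedin X F"
    and V: "V \<in> nonempty_open X"
  shows "\<exists>W\<in>decided X \<F>. W \<subseteq> V"
proof -
  obtain x where x: "x \<in> V" "x \<in> topspace X"
    using nonempty_openD(2,3)[OF V] by blast
  obtain H where H: "openin X H" "x \<in> H" "finite {F \<in> \<F>. F \<inter> H \<noteq> {}}"
    using lf x(2) unfolding locally_finite_in_def by meson
  have "V \<inter> H \<in> nonempty_open X"
    using V H x by (auto simp: nonempty_open_def openin_Int)
  from finite_closed_decided[OF H(3) _ this] cl
  obtain W where W: "W \<in> nonempty_open X" "W \<subseteq> V \<inter> H" "\<forall>F\<in>{F \<in> \<F>. F \<inter> H \<noteq> {}}. W \<subseteq> F \<or> W \<inter> F = {}"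
    by auto
  then have "W \<in> decided X \<F>"
    by (auto simp: decided_def)
  then show ?thesis using W(2) by blast
qed

lemma decided_down:
  "W \<in> decided X \<F> \<Longrightarrow> V \<in> nonempty_open X \<Longrightarrow> V \<subseteq> W \<Longrightarrow> V \<in> decided X \<F>"
  unfolding decided_def by blast

text \<open>For \<open>x \<in> C \<subseteq> F \<subseteq> G\<close> with \<open>F\<close> in the \<open>m\<close>-th family, the set \<open>W\<^sub>m \<ni> x\<close> is decided by \<open>F\<close>,
so it lies in \<open>F\<close>.\<close>

lemma Sigma_network_play:
  assumes net: "Sigma_network X \<C> \<F>" and dec: "decseq W" and W: "\<And>n. W n \<in> decided X (\<F> n)"
    and x: "\<And>n. x \<in> W n"
  obtains C where "C \<in> \<C>" "\<And>G. openin X G \<Longrightarrow> C \<subseteq> G \<Longrightarrow> \<exists>N. \<forall>n\<ge>N. W n \<subseteq> G"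
proof -
  have "x \<in> topspace X"
    using W[of 0] x[of 0] nonempty_openD(3)[of "W 0" X] by (auto simp: decided_def)
  then obtain C where C: "C \<in> \<C>" "x \<in> C"
    using net unfolding Sigma_network_def by blast
  have "\<exists>N. \<forall>n\<ge>N. W n \<subseteq> G" if G: "openin X G" "C \<subseteq> G" for G
  proof -
    have "\<exists>F\<in>(\<Union>n. \<F> n). C \<subseteq> F \<and> F \<subseteq> G"
      using net[unfolded Sigma_network_def] C(1) G by simp
    then obtain F m where F: "F \<in> \<F> m" "C \<subseteq> F" "F \<subseteq> G"
      by blast
    then have "W m \<subseteq> F"
      using W[of m] x[of m] C(2) by (auto simp: decided_def)
    then have "W n \<subseteq> G" if "n \<ge> m" for n
      using F(3) decseqD[OF dec that] by simp
    then show ?thesis by (intro exI[of _ m]) simp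
  qed
  then show thesis by (rule that[OF C(1)])
qed

text \<open>If no point of \<open>C\<close> is a limit, each has an open neighborhood that the sequence avoids along the
ultrafilter, and finitely many of these cover \<open>C\<close>.\<close>

lemma ultrafilter_limit_or_avoids:
  assumes C: "compactin X C" and U: "free_ultrafilter U"
  shows "(\<exists>G. openin X G \<and> C \<subseteq> G \<and> eventually (\<lambda>n. y n \<notin> G) U) \<or> (\<exists>b\<in>C. limitin X y b U)"
proof (rule disjCI)
  assume no: "\<not> (\<exists>b\<in>C. limitin X y b U)"
  define \<U> where "\<U> = {G. openin X G \<and> eventually (\<lambda>n. y n \<notin> G) U}"
  have CX: "C \<subseteq> topspace X" by (rule compactin_subset_topspace[OF C])
  have "C \<subseteq> \<Union>\<U>"
  proof
    fix c assume c: "c \<in> C"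
    then have "\<not> limitin X y c U" using no by blast
    then obtain G where "openin X G" "c \<in> G" "\<not> eventually (\<lambda>n. y n \<in> G) U"
      using c CX unfolding limitin_def by blast
    moreover from this have "eventually (\<lambda>n. y n \<notin> G) U"
      using free_ultrafilter_cases[OF U, of "\<lambda>n. y n \<in> G"] by blast
    ultimately show "c \<in> \<Union>\<U>" by (auto simp: \<U>_def)
  qed
  then obtain \<V> where \<V>: "finite \<V>" "\<V> \<subseteq> \<U>" "C \<subseteq> \<Union>\<V>"
    using compactinD[OF C, of \<U>] by (auto simp: \<U>_def)
  have "eventually (\<lambda>n. \<forall>G\<in>\<V>. y n \<notin> G) U"
    using \<V> by (intro eventually_ball_finite) (auto simp: \<U>_def)
  then have "eventually (\<lambda>n. y n \<notin> \<Union>\<V>) U"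
    by eventually_elim blast
  moreover have "openin X (\<Union>\<V>)"
    using \<V>(2) by (auto simp: \<U>_def)
  ultimately show "\<exists>G. openin X G \<and> C \<subseteq> G \<and> eventually (\<lambda>n. y n \<notin> G) U"
    using \<V>(3) by blast
qed

text \<open>The sets \<open>W\<^sub>n\<close> shrink into every neighborhood of a compact set \<open>C\<close>, so the moves cannot avoid a
neighborhood of \<open>C\<close>, and they converge to a point of \<open>C\<close> along any free ultrafilter.\<close>

lemma strongly_Sigma_space_controlled:
  assumes "strongly_Sigma_space X"
  shows "controlled every_ultrafilter k X"
proof -
  obtain \<C> \<F> where net: "Sigma_network X \<C> \<F>" and comp: "\<And>C. C \<in> \<C> \<Longrightarrow> compactin X C"
    using assms unfolding strongly_Sigma_space_def by blast
  have \<F>: "locally_finite_in X (\<F> n)" "\<And>F. F \<in> \<F> n \<Longrightarrow> closedin X F" for n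
    using net by (auto simp: Sigma_network_def)
  show ?thesis
  proof (rule controlled_by_sequence[where H = "\<lambda>n. decided X (\<F> n)"])
    show "mono every_ultrafilter" by (rule mono_every_ultrafilter)
    show "decided X (\<F> n) \<subseteq> nonempty_open X" for n by (auto simp: decided_def)
    show "\<exists>W\<in>decided X (\<F> n). W \<subseteq> V" if "V \<in> nonempty_open X" for n V
      by (rule locally_finite_decided[OF \<F> that])
    fix W M x
    assume dec: "decseq W" and x: "\<And>n. x \<in> W n" and W: "\<And>n. W n \<in> decided X (\<F> n)"
      and M: "\<And>n. M n \<in> moves k X" "\<And>n. M n \<subseteq> W n"
    obtain C where C: "C \<in> \<C>" "\<And>G. openin X G \<Longrightarrow> C \<subseteq> G \<Longrightarrow> \<exists>N. \<forall>n\<ge>N. W n \<subseteq> G"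
      by (rule Sigma_network_play[OF net dec W x]) blast
    define y where "y n = (SOME y. y \<in> M n)" for n
    have y: "y n \<in> M n" for n
      using moves_nonempty[OF M(1)[of n]] unfolding y_def by (simp add: some_in_eq)
    show "every_ultrafilter (limit_ultrafilters X M)"
      unfolding every_ultrafilter_def
    proof
      fix U assume "U \<in> {U. free_ultrafilter U}"
      then have U: "free_ultrafilter U" by simp
      have "\<not> (\<exists>G. openin X G \<and> C \<subseteq> G \<and> eventually (\<lambda>n. y n \<notin> G) U)"
      proof
        assume "\<exists>G. openin X G \<and> C \<subseteq> G \<and> eventually (\<lambda>n. y n \<notin> G) U"
        then obtain G where G: "openin X G" "C \<subseteq> G" "eventually (\<lambda>n. y n \<notin> G) U" by blast
        obtain N where N: "\<forall>n\<ge>N. W n \<subseteq> G" using C(2)[OF G(1,2)] by blast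
        have "eventually (\<lambda>n. n \<ge> N) U"
          by (rule free_ultrafilter_sequentially[OF U eventually_ge_at_top])
        with G(3) have "eventually (\<lambda>n. False) U"
          by eventually_elim (use N y M(2) in blast)
        then show False using free_ultrafilter_ex[OF U] by blast
      qed
      then obtain b where "limitin X y b U"
        using ultrafilter_limit_or_avoids[OF comp[OF C(1)] U, of y] by blast
      then have "set_limit X M b U"
        by (rule limitin_imp_set_limit) (simp add: y)
      then show "U \<in> limit_ultrafilters X M"
        using U by (auto simp: limit_ultrafilters_def)
    qed
  qed (rule decided_down)
qed

text \<open>As for strongly \<open>\<Sigma>\<close>-spaces, but \<open>C\<close> is only countably compact. If the moves do not accumulate, the
increasing open sets of points having a neighborhood missed by all \<open>M\<^sub>n\<close> with \<open>n \<ge> j\<close> cover \<open>C\<close>, so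
one of them contains \<open>C\<close> and then almost all \<open>W\<^sub>n\<close>.\<close>

lemma Sigma_space_controlled:
  assumes "Sigma_space X"
  shows "controlled some_ultrafilter k X"
proof -
  obtain \<C> \<F> where net: "Sigma_network X \<C> \<F>" and comp: "\<And>C. C \<in> \<C> \<Longrightarrow> countably_compactin X C"
    using assms unfolding Sigma_space_def by blast
  have \<F>: "locally_finite_in X (\<F> n)" "\<And>F. F \<in> \<F> n \<Longrightarrow> closedin X F" for n
    using net by (auto simp: Sigma_network_def)
  show ?thesis
  proof (rule controlled_by_sequence[where H = "\<lambda>n. decided X (\<F> n)"])
    show "mono some_ultrafilter" by (rule mono_some_ultrafilter)
    show "decided X (\<F> n) \<subseteq> nonempty_open X" for n by (auto simp: decided_def)
    show "\<exists>W\<in>decided X (\<F> n). W \<subseteq> V" if "V \<in> nonempty_open X" for n V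
      by (rule locally_finite_decided[OF \<F> that])
    fix W M x
    assume dec: "decseq W" and x: "\<And>n. x \<in> W n" and W: "\<And>n. W n \<in> decided X (\<F> n)"
      and M: "\<And>n. M n \<in> moves k X" "\<And>n. M n \<subseteq> W n"
    obtain C where C: "C \<in> \<C>" "\<And>G. openin X G \<Longrightarrow> C \<subseteq> G \<Longrightarrow> \<exists>N. \<forall>n\<ge>N. W n \<subseteq> G"
      by (rule Sigma_network_play[OF net dec W x]) blast
    have CX: "C \<subseteq> topspace X"
      using comp[OF C(1)] by (simp add: countably_compactin_def)
    have "Ls X M \<noteq> {}"
    proof
      assume no: "Ls X M = {}"
      define H where "H j = \<Union>{G. openin X G \<and> (\<forall>n\<ge>j. M n \<inter> G = {})}" for j :: nat
      have H_mono: "H i \<subseteq> H j" if "i \<le> j" for i j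
        unfolding H_def by (intro Union_mono Collect_mono) (use that in \<open>meson order_trans\<close>)
      have "C \<subseteq> \<Union>(range H)"
      proof
        fix c assume c: "c \<in> C"
        then obtain G where G: "openin X G" "c \<in> G" "finite {n. M n \<inter> G \<noteq> {}}"
          using no CX unfolding Ls_def by blast
        then obtain j where j: "\<And>n. n \<in> {n. M n \<inter> G \<noteq> {}} \<Longrightarrow> n < j"
          using finite_nat_set_iff_bounded by meson
        then have "\<forall>n\<ge>j. M n \<inter> G = {}"
          by (metis (mono_tags) leD mem_Collect_eq)
        then have "c \<in> H j"
          using G(1,2) by (auto simp: H_def)
        then show "c \<in> \<Union>(range H)" by blast
      qed
      moreover have openH: "openin X (H j)" for j
        unfolding H_def by (rule openin_Union) simp
      ultimately obtain \<V> where \<V>: "finite \<V>" "\<V> \<subseteq> range H" "C \<subseteq> \<Union>\<V>"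
        using comp[OF C(1), unfolded countably_compactin_def, THEN conjunct2, THEN spec[of _ "range H"]]
        by auto
      then obtain J where J: "finite J" "\<V> = H ` J"
        using finite_subset_image by meson
      define j where "j = Max (insert 0 J)"
      have "H i \<subseteq> H j" if "i \<in> J" for i
        by (rule H_mono) (use that J in \<open>simp add: j_def\<close>)
      then have "C \<subseteq> H j"
        using \<V>(3) J(2) by blast
      then obtain N where N: "\<forall>n\<ge>N. W n \<subseteq> H j"
        using C(2)[OF openH] by blast
      then have "M (max N j) \<subseteq> H j"
        using M(2)[of "max N j"] by (meson max.cobounded1 subset_trans)
      moreover have "M (max N j) \<inter> G = {}" if "\<forall>n\<ge>j. M n \<inter> G = {}" for G
        using that by simp
      then have "M (max N j) \<inter> H j = {}"
        unfolding H_def by blast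
      ultimately show False
        using moves_nonempty[OF M(1)[of "max N j"]] by blast
    qed
    then show "some_ultrafilter (limit_ultrafilters X M)"
      by (rule Ls_nonempty_imp_some_ultrafilter)
  qed (rule decided_down)
qed

text \<open>If \<open>W\<^sub>n\<close> lies in a member of the \<open>n\<close>-th cover and contains \<open>x\<close>, it lies in the star of \<open>x\<close>.\<close>

lemma wDelta_space_controlled:
  assumes "wDelta_space X"
  shows "controlled some_ultrafilter k X"
proof -
  obtain \<G> :: "nat \<Rightarrow> 'a set set" where covers: "\<forall>n. (\<forall>G\<in>\<G> n. openin X G) \<and> \<Union>(\<G> n) = topspace X"
    and cluster: "\<forall>x\<in>topspace X. \<forall>s. (\<forall>n. s n \<in> star x (\<G> n)) \<longrightarrow> (\<exists>z. cluster_point_of X s z)"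
    using assms unfolding wDelta_space_def by (elim exE conjE)
  have \<G>: "G \<in> \<G> n \<Longrightarrow> openin X G" "\<Union>(\<G> n) = topspace X" for n G
    using covers by simp_all
  show ?thesis
  proof (rule controlled_by_sequence[where H = "\<lambda>n. {W \<in> nonempty_open X. \<exists>G\<in>\<G> n. W \<subseteq> G}"])
    show "mono some_ultrafilter" by (rule mono_some_ultrafilter)
    show "\<exists>W\<in>{W \<in> nonempty_open X. \<exists>G\<in>\<G> n. W \<subseteq> G}. W \<subseteq> V" if V: "V \<in> nonempty_open X" for n V
    proof -
      obtain v where "v \<in> V" "v \<in> topspace X" using nonempty_openD(2,3)[OF V] by blast
      moreover from this obtain G where "G \<in> \<G> n" "v \<in> G" using \<G>(2)[of n] by blast
      moreover have "openin X (V \<inter> G)" if "G \<in> \<G> n" for G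
        by (rule openin_Int[OF nonempty_openD(1)[OF V] \<G>(1)[OF that]])
      ultimately show ?thesis
        by (intro bexI[of _ "V \<inter> G"]) (auto simp: nonempty_open_def)
    qed
    fix W M x
    assume "decseq W" and x: "\<And>n. x \<in> W n" and W: "\<And>n. W n \<in> {W \<in> nonempty_open X. \<exists>G\<in>\<G> n. W \<subseteq> G}"
      and M: "\<And>n. M n \<in> moves k X" "\<And>n. M n \<subseteq> W n"
    define y where "y n = (SOME y. y \<in> M n)" for n
    have y: "y n \<in> M n" for n
      using moves_nonempty[OF M(1)[of n]] unfolding y_def by (simp add: some_in_eq)
    have "y n \<in> star x (\<G> n)" for n
    proof -
      obtain G where "G \<in> \<G> n" "W n \<subseteq> G" using W[of n] by blast
      then show ?thesis using x[of n] y[of n] M(2)[of n] by (auto simp: star_def)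
    qed
    moreover have "x \<in> topspace X"
      using W[of 0] x[of 0] nonempty_openD(3)[of "W 0" X] by auto
    ultimately have "\<exists>z. cluster_point_of X y z"
      using cluster[THEN bspec[of _ _ x], THEN spec[of _ y]] by simp
    then obtain z where z: "cluster_point_of X y z" ..
    have "infinite {n. M n \<inter> G \<noteq> {}}" if "openin X G" "z \<in> G" for G
    proof -
      have "infinite {n. y n \<in> G}" using z that by (simp add: cluster_point_of_def)
      moreover have "{n. y n \<in> G} \<subseteq> {n. M n \<inter> G \<noteq> {}}" using y by blast
      ultimately show ?thesis by (rule infinite_super[rotated])
    qed
    then have "z \<in> Ls X M"
      using z by (simp add: Ls_def cluster_point_of_def)
    then have "Ls X M \<noteq> {}" by blast
    then show "some_ultrafilter (limit_ultrafilters X M)"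
      by (rule Ls_nonempty_imp_some_ultrafilter)
  qed auto
qed

text \<open>Every sequence of nonempty open sets accumulates in a feebly compact space. Otherwise the family of
its terms is locally finite, hence finite, and a term repeated infinitely often accumulates at each of its points.\<close>

lemma feebly_compact_space_controlled:
  assumes "feebly_compact_space X"
  shows "controlled some_ultrafilter Opens X"
proof (rule controlled_by_sequence[where H = "\<lambda>_. nonempty_open X"])
  show "mono some_ultrafilter" by (rule mono_some_ultrafilter)
  fix W M x
  assume "decseq W" "\<And>n. x \<in> W n" "\<And>n. W n \<in> nonempty_open X"
    and "\<And>n. M n \<in> moves Opens X" "\<And>n. M n \<subseteq> W n"
  then have M: "M n \<in> nonempty_open X" for n by simp
  have "Ls X M \<noteq> {}"
  proof
    assume no: "Ls X M = {}"
    have locfin: "\<exists>G. openin X G \<and> x \<in> G \<and> finite {n. M n \<inter> G \<noteq> {}}" if "x \<in> topspace X" for x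
      using no that unfolding Ls_def by blast
    have "locally_finite_in X (range M)"
      unfolding locally_finite_in_def
    proof (intro conjI ballI)
      show "\<Union>(range M) \<subseteq> topspace X"
        using nonempty_openD(3)[OF M] by blast
      fix x assume "x \<in> topspace X"
      then obtain G where G: "openin X G" "x \<in> G" "finite {n. M n \<inter> G \<noteq> {}}"
        using locfin by blast
      have "{U \<in> range M. U \<inter> G \<noteq> {}} \<subseteq> M ` {n. M n \<inter> G \<noteq> {}}" by blast
      then have "finite {U \<in> range M. U \<inter> G \<noteq> {}}"
        using G(3) finite_surj by blast
      then show "\<exists>V. openin X V \<and> x \<in> V \<and> finite {U \<in> range M. U \<inter> V \<noteq> {}}"
        using G by blast
    qed
    moreover have "range M \<subseteq> nonempty_open X" using M by blast
    ultimately have "finite (range M)"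
      using assms unfolding feebly_compact_space_def by blast
    then obtain m where m: "infinite {n. M n = M m}"
      using pigeonhole_infinite[of "UNIV :: nat set" M] by auto
    obtain a where a: "a \<in> M m" "a \<in> topspace X"
      using nonempty_openD(2,3)[OF M[of m]] by blast
    then obtain G where G: "a \<in> G" "finite {n. M n \<inter> G \<noteq> {}}"
      using locfin by blast
    have "{n. M n = M m} \<subseteq> {n. M n \<inter> G \<noteq> {}}"
      using a(1) G(1) by blast
    then show False
      using m G(2) finite_subset by blast
  qed
  then show "some_ultrafilter (limit_ultrafilters X M)"
    by (rule Ls_nonempty_imp_some_ultrafilter)
qed auto

section \<open>\<open>p\<close>-spaces\<close>

lemma SC_embed_in_cube: "x \<in> topspace X \<Longrightarrow> SC_embed X x \<in> topspace (unit_cube X)"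
  by (auto simp: SC_embed_def unit_cube_def unit_maps_def continuous_map_def)

lemma SC_embed_in_Stone_Cech: "SC_embed X ` topspace X \<subseteq> topspace (Stone_Cech X)"
proof -
  have "SC_embed X ` topspace X \<subseteq> topspace (unit_cube X)"
    by (simp add: image_subset_iff SC_embed_in_cube)
  then show ?thesis
    using closure_of_subset[of "SC_embed X ` topspace X" "unit_cube X"]
    by (simp add: Stone_Cech_def)
qed

lemma continuous_map_SC_embed: "continuous_map X (Stone_Cech X) (SC_embed X)"
proof -
  have "continuous_map X (unit_cube X) (SC_embed X)"
    unfolding unit_cube_def continuous_map_componentwise
  proof (intro conjI ballI)
    show "SC_embed X ` topspace X \<subseteq> extensional (unit_maps X)"
      by (auto simp: SC_embed_def)
    fix f assume f: "f \<in> unit_maps X"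
    then have "(\<lambda>x. SC_embed X x f) = f" by (auto simp: SC_embed_def)
    then show "continuous_map X (top_of_set {0..1}) (\<lambda>x. SC_embed X x f)"
      using f by (simp add: unit_maps_def)
  qed
  then show ?thesis
    using SC_embed_in_Stone_Cech[of X] unfolding Stone_Cech_def
    by (intro continuous_map_into_subtopology) auto
qed

lemma compact_space_Stone_Cech: "compact_space (Stone_Cech X)"
proof -
  have "compact_space (unit_cube X)"
    unfolding unit_cube_def compact_space_product_topology
    by (simp add: compact_space_subtopology)
  then show ?thesis
    unfolding Stone_Cech_def
    by (intro compact_space_subtopology closedin_compact_space) auto
qed

lemma regular_space_Stone_Cech: "regular_space (Stone_Cech X)"
proof -
  have "regular_space (unit_cube X)"
    unfolding unit_cube_def regular_space_product_topology
    by (simp add: regular_space_subtopology regular_space_euclidean)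
  then show ?thesis
    unfolding Stone_Cech_def by (rule regular_space_subtopology)
qed

text \<open>Complete regularity provides a coordinate of the cube that separates \<open>b\<close> from the complement of a
given neighborhood.\<close>

lemma limitin_SC_embed:
  assumes cr: "completely_regular_space X" and lim: "limitin (Stone_Cech X) (\<lambda>n. SC_embed X (y n)) (SC_embed X b) U"
    and b: "b \<in> topspace X" and y: "\<And>n. y n \<in> topspace X"
  shows "limitin X y b U"
  unfolding limitin_def
proof (intro conjI allI impI b)
  fix O' assume O': "openin X O' \<and> b \<in> O'"
  then have "closedin X (topspace X - O')" "b \<in> topspace X - (topspace X - O')"
    using b by auto
  then obtain f where f: "continuous_map X (top_of_set {0..1::real}) f" "f b = 0"
    "f ` (topspace X - O') \<subseteq> {1}"
    using cr unfolding completely_regular_space_def by blast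
  define g where "g = restrict f (topspace X)"
  have g: "g \<in> unit_maps X"
    using f(1) unfolding unit_maps_def g_def by (auto intro: continuous_map_eq)
  have "limitin (unit_cube X) (\<lambda>n. SC_embed X (y n)) (SC_embed X b) U"
    using lim unfolding Stone_Cech_def by (simp add: limitin_subtopology)
  then have "limitin (top_of_set {0..1}) (\<lambda>n. SC_embed X (y n) g) (SC_embed X b g) U"
    using g unfolding unit_cube_def limitin_componentwise by blast
  then have "limitin (top_of_set {0..1}) (\<lambda>n. f (y n)) 0 U"
    using g b y f(2) by (simp add: SC_embed_def g_def)
  moreover have "openin (top_of_set {0..1}) ({0..1} \<inter> {..<1::real})"
    by (simp add: openin_open_Int)
  ultimately have "eventually (\<lambda>n. f (y n) \<in> {0..1} \<inter> {..<1}) U"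
    unfolding limitin_def by auto
  then show "eventually (\<lambda>n. y n \<in> O') U"
  proof eventually_elim
    case (elim n)
    then show ?case using f(3) y[of n] by auto
  qed
qed

text \<open>The closure of \<open>W\<^sub>n\<close> in the Stone--Cech compactification is required to lie in a member of the \<open>n\<close>-th
family. The moves converge in the compactification along any free ultrafilter; the limit lies in all
these closures, hence in the intersection of the stars of \<open>x\<close>, hence in the space.\<close>

lemma p_space_controlled:
  assumes "p_space X"
  shows "controlled every_ultrafilter k X"
proof -
  define e where "e = SC_embed X"
  define S where "S = Stone_Cech X"
  have cr: "completely_regular_space X"
    using assms by (simp add: p_space_def)
  obtain \<U> :: "nat \<Rightarrow> (('a \<Rightarrow> real) \<Rightarrow> real) set set"
    where covers: "\<forall>n. (\<forall>G\<in>\<U> n. openin S G) \<and> e ` topspace X \<subseteq> \<Union>(\<U> n)"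
      and stars: "\<forall>x\<in>topspace X. (\<Inter>n. star (e x) (\<U> n)) \<subseteq> e ` topspace X"
    using assms unfolding p_space_def e_def S_def by (elim exE conjE)
  have \<U>: "G \<in> \<U> n \<Longrightarrow> openin S G" "e ` topspace X \<subseteq> \<Union>(\<U> n)" for n G
    using covers by simp_all
  have eS: "e ` topspace X \<subseteq> topspace S"
    unfolding e_def S_def by (rule SC_embed_in_Stone_Cech)
  define H where "H n = {W \<in> nonempty_open X. \<exists>G\<in>\<U> n. S closure_of (e ` W) \<subseteq> G}" for n
  show ?thesis
  proof (rule controlled_by_sequence[where H = H])
    show "mono every_ultrafilter" by (rule mono_every_ultrafilter)
    show "H n \<subseteq> nonempty_open X" for n by (auto simp: H_def)
    show "V \<in> H n" if "W \<in> H n" "V \<in> nonempty_open X" "V \<subseteq> W" for n W V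
    proof -
      have "S closure_of (e ` V) \<subseteq> S closure_of (e ` W)"
        using that(3) by (intro closure_of_mono image_mono)
      then show ?thesis using that by (auto simp: H_def)
    qed
    show "\<exists>W\<in>H n. W \<subseteq> V" if V: "V \<in> nonempty_open X" for n V
    proof -
      obtain v where v: "v \<in> V" "v \<in> topspace X" using nonempty_openD(2,3)[OF V] by blast
      then obtain G where G: "G \<in> \<U> n" "e v \<in> G" using \<U>(2)[of n] by blast
      obtain A C where A: "openin S A" "closedin S C" "e v \<in> A" "A \<subseteq> C" "C \<subseteq> G"
        using regular_space_Stone_Cech[of X] \<U>(1)[OF G(1)] G(2)
        unfolding neighbourhood_base_of_closedin[symmetric] neighbourhood_base_of S_def by meson
      define W where "W = V \<inter> {x \<in> topspace X. e x \<in> A}"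
      have "openin X {x \<in> topspace X. e x \<in> A}"
        by (rule openin_continuous_map_preimage[OF _ A(1)])
          (simp add: e_def S_def continuous_map_SC_embed)
      then have "openin X W"
        unfolding W_def by (rule openin_Int[OF nonempty_openD(1)[OF V]])
      moreover have "v \<in> W" using v A(3) by (simp add: W_def)
      ultimately have "W \<in> nonempty_open X" by (rule nonempty_openI)
      moreover have "S closure_of (e ` W) \<subseteq> C"
        by (rule closure_of_minimal) (use A in \<open>auto simp: W_def\<close>)
      then have "S closure_of (e ` W) \<subseteq> G" using A(5) by blast
      ultimately show ?thesis
        using G(1) by (intro bexI[of _ W]) (auto simp: H_def W_def)
    qed
    fix W M x
    assume dec: "decseq W" and x: "\<And>n. x \<in> W n" and W: "\<And>n. W n \<in> H n"
      and M: "\<And>n. M n \<in> moves k X" "\<And>n. M n \<subseteq> W n"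
    have xX: "x \<in> topspace X"
      using W[of 0] x[of 0] nonempty_openD(3)[of "W 0" X] by (auto simp: H_def)
    define y where "y n = (SOME y. y \<in> M n)" for n
    have y: "y n \<in> M n" for n
      using moves_nonempty[OF M(1)[of n]] unfolding y_def by (simp add: some_in_eq)
    have yX: "y n \<in> topspace X" for n
      using y moves_subset[OF M(1)] by blast
    have WX: "W n \<subseteq> topspace X" for n
      using W[of n] nonempty_openD(3)[of "W n" X] by (simp add: H_def)
    show "every_ultrafilter (limit_ultrafilters X M)"
      unfolding every_ultrafilter_def
    proof
      fix U assume "U \<in> {U. free_ultrafilter U}"
      then have U: "free_ultrafilter U" by simp
      have "\<not> (\<exists>G. openin S G \<and> topspace S \<subseteq> G \<and> eventually (\<lambda>n. e (y n) \<notin> G) U)"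
      proof
        assume "\<exists>G. openin S G \<and> topspace S \<subseteq> G \<and> eventually (\<lambda>n. e (y n) \<notin> G) U"
        then obtain G where G: "topspace S \<subseteq> G" "eventually (\<lambda>n. e (y n) \<notin> G) U" by blast
        obtain n where "e (y n) \<notin> G" using free_ultrafilter_ex[OF U G(2)] by blast
        then show False using G(1) eS yX by blast
      qed
      moreover have "compactin S (topspace S)"
        using compact_space_Stone_Cech[of X] by (simp add: compact_space_def S_def)
      ultimately obtain z where z: "limitin S (\<lambda>n. e (y n)) z U"
        using ultrafilter_limit_or_avoids[OF _ U, of S "topspace S" "\<lambda>n. e (y n)"] by blast
      have zlim: "set_limit S (\<lambda>n. {e (y n)}) z U"
        by (rule limitin_imp_set_limit[OF z]) simp
      have "z \<in> star (e x) (\<U> m)" for m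
      proof -
        obtain G where G: "G \<in> \<U> m" "S closure_of (e ` W m) \<subseteq> G"
          using W[of m] by (auto simp: H_def)
        have "z \<in> S closure_of (e ` W m)"
        proof (rule set_limit_in_closure[OF U zlim])
          show "{e (y n)} \<subseteq> e ` W m" if "n \<ge> m" for n
            using y[of n] M(2)[of n] decseqD[OF dec that] by auto
        qed
        moreover have "e ` W m \<subseteq> S closure_of (e ` W m)"
          by (rule closure_of_subset) (use WX eS in blast)
        ultimately show ?thesis
          using G x[of m] by (auto simp: star_def)
      qed
      then have "z \<in> e ` topspace X"
        using bspec[OF stars xX] by auto
      then obtain b where b: "b \<in> topspace X" "z = e b" by blast
      have "limitin X y b U"
        using limitin_SC_embed[OF cr _ b(1) yX] z b(2) by (simp add: e_def S_def)
      then have "set_limit X M b U"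
        by (rule limitin_imp_set_limit) (simp add: y)
      then show "U \<in> limit_ultrafilters X M"
        using U by (auto simp: limit_ultrafilters_def)
    qed
  qed
qed

section \<open>Homeomorphisms, open subspaces and products\<close>

lemma monoD_bool: "mono \<Q> \<Longrightarrow> A \<subseteq> B \<Longrightarrow> \<Q> A \<Longrightarrow> \<Q> (B :: 'b set)"
  by (auto simp: mono_def le_bool_def)

lemma controlled_homeomorphic_space:
  assumes hom: "X homeomorphic_space Y" and ctrl: "controlled \<Q> k X" and Q: "mono \<Q>"
  shows "controlled \<Q> k Y"
proof -
  obtain f g where fg: "homeomorphic_maps X Y f g"
    using hom by (auto simp: homeomorphic_space_def)
  have f: "\<And>x. x \<in> topspace X \<Longrightarrow> f x \<in> topspace Y" and g: "\<And>y. y \<in> topspace Y \<Longrightarrow> g y \<in> topspace X"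
    and gf: "\<And>x. x \<in> topspace X \<Longrightarrow> g (f x) = x" and fg': "\<And>y. y \<in> topspace Y \<Longrightarrow> f (g y) = y"
    using fg by (auto simp: homeomorphic_maps_def continuous_map_def)
  have open_f: "openin Y (f ` U)" if "openin X U" for U
    using fg that homeomorphic_imp_open_map homeomorphic_map_maps unfolding open_map_def by metis
  have open_g: "openin X (g ` U)" if "openin Y U" for U
    using fg that homeomorphic_imp_open_map homeomorphic_map_maps homeomorphic_maps_sym
    unfolding open_map_def by metis
  have gf_image: "g ` (f ` U) = U" if "U \<subseteq> topspace X" for U
    using that gf by force
  have moves_g: "g ` M \<in> moves k X" if "M \<in> moves k Y" for M
    using that open_g g by (cases k) (auto simp: singletons_def nonempty_open_def)
  obtain \<G> where \<G>: "pi_rule X \<G>"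
    and play: "\<And>W M. controlled_play k X \<G> W M \<Longrightarrow> \<Q> (limit_ultrafilters X M)"
    using ctrl by (rule controlledE) blast
  define \<G>' where "\<G>' l = {V \<in> nonempty_open Y. g ` V \<in> \<G> (map ((`) g) l)}" for l
  show ?thesis
  proof (rule controlledI)
    show "pi_rule Y \<G>'"
      unfolding pi_rule_def
    proof (intro allI conjI ballI impI)
      show "\<G>' l \<subseteq> nonempty_open Y" for l by (auto simp: \<G>'_def)
      show "V \<in> \<G>' l" if W: "W \<in> \<G>' l" and V: "V \<in> nonempty_open Y" "V \<subseteq> W" for l W V
      proof -
        have "g ` V \<in> nonempty_open X"
          using V(1) open_g by (auto simp: nonempty_open_def)
        then have "g ` V \<in> \<G> (map ((`) g) l)"
          using pi_ruleD(2)[OF \<G>, of "g ` W"] W V(2) by (auto simp: \<G>'_def)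
        then show ?thesis using V(1) by (simp add: \<G>'_def)
      qed
      show "\<exists>W\<in>\<G>' l. W \<subseteq> V" if V: "V \<in> nonempty_open Y" for l V
      proof -
        have "g ` V \<in> nonempty_open X"
          using V open_g by (auto simp: nonempty_open_def)
        then obtain W where W: "W \<in> \<G> (map ((`) g) l)" "W \<subseteq> g ` V"
          using pi_ruleD(3)[OF \<G>] by blast
        have WX: "W \<in> nonempty_open X" by (rule pi_ruleD(1)[OF \<G> W(1)])
        then have "f ` W \<in> nonempty_open Y"
          using open_f by (auto simp: nonempty_open_def)
        moreover have "g ` f ` W = W"
          by (rule gf_image[OF nonempty_openD(3)[OF WX]])
        moreover have "f ` W \<subseteq> V"
          using W(2) fg' nonempty_openD(3)[OF V] by force
        ultimately show ?thesis
          using W(1) by (intro bexI[of _ "f ` W"]) (simp_all add: \<G>'_def)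
      qed
    qed
    fix W M assume p: "controlled_play k Y \<G>' W M"
    obtain y N where dec: "decseq W" and y: "\<And>n. y \<in> W n"
      and M: "\<And>n. M n \<in> moves k Y" "\<And>n. M n \<subseteq> W n"
      and N: "\<And>n. n \<ge> N \<Longrightarrow> W n \<in> \<G>' (map M [0..<n])"
      by (rule controlled_playE[OF p]) (rule that; assumption)
    have "controlled_play k X \<G> (\<lambda>n. g ` W n) (\<lambda>n. g ` M n)"
      unfolding controlled_play_def
    proof (intro conjI allI exI[of _ N] impI)
      show "decseq (\<lambda>n. g ` W n)"
        using dec unfolding decseq_def by (simp add: image_mono)
      have "g y \<in> (\<Inter>n. g ` W n)" using y by blast
      then show "(\<Inter>n. g ` W n) \<noteq> {}" by blast
      show "g ` M n \<in> moves k X" "g ` M n \<subseteq> g ` W n" for n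
        using moves_g[OF M(1)] M(2) by auto
      show "g ` W n \<in> \<G> (map (\<lambda>n. g ` M n) [0..<n])" if "N \<le> n" for n
        using N[OF that] by (simp add: \<G>'_def o_def)
    qed
    then have "\<Q> (limit_ultrafilters X (\<lambda>n. g ` M n))" by (rule play)
    moreover have "limit_ultrafilters X (\<lambda>n. g ` M n) \<subseteq> limit_ultrafilters Y M"
    proof
      fix U assume "U \<in> limit_ultrafilters X (\<lambda>n. g ` M n)"
      then obtain b where U: "free_ultrafilter U" and b: "set_limit X (\<lambda>n. g ` M n) b U"
        by (auto simp: limit_ultrafilters_def)
      then have bX: "b \<in> topspace X" by (simp add: set_limit_def)
      have "set_limit Y M (f b) U"
        unfolding set_limit_def
      proof (intro conjI allI impI)
        show "f b \<in> topspace Y" by (rule f[OF bX])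
        fix G assume G: "openin Y G \<and> f b \<in> G"
        then have "openin X (g ` G)" "b \<in> g ` G"
          using open_g gf[OF bX] by (auto intro: rev_image_eqI)
        then have "eventually (\<lambda>n. g ` M n \<inter> g ` G \<noteq> {}) U"
          using b by (simp add: set_limit_def)
        then show "eventually (\<lambda>n. M n \<inter> G \<noteq> {}) U"
        proof eventually_elim
          case (elim n)
          then obtain u v where uv: "u \<in> M n" "v \<in> G" "g u = g v" by auto
          then have "u \<in> topspace Y" "v \<in> topspace Y"
            using moves_subset[OF M(1)[of n]] G openin_subset by auto
          then have "u = v" using uv(3) fg' by metis
          then show ?case using uv by blast
        qed
      qed
      then show "U \<in> limit_ultrafilters Y M"
        using U by (auto simp: limit_ultrafilters_def)
    qed
    ultimately show "\<Q> (limit_ultrafilters Y M)"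
      using monoD_bool[OF Q] by blast
  qed
qed

text \<open>A limit of the moves has to stay in the subspace; regularity allows the closures of the sets \<open>W\<^sub>n\<close> in
the ambient space to be kept inside it.\<close>

lemma controlled_open_subspace:
  assumes reg: "regular_space X" and ctrl: "controlled \<Q> k X" and Q: "mono \<Q>" and R: "openin X R"
  shows "controlled \<Q> k (subtopology X R)"
proof -
  obtain \<G> where \<G>: "pi_rule X \<G>"
    and play: "\<And>W M. controlled_play k X \<G> W M \<Longrightarrow> \<Q> (limit_ultrafilters X M)"
    using ctrl by (rule controlledE) blast
  have sub: "V \<in> nonempty_open (subtopology X R) \<longleftrightarrow> V \<in> nonempty_open X \<and> V \<subseteq> R" for V
    using openin_open_subtopology[OF R] by (auto simp: nonempty_open_def)
  have moves_sub: "M \<in> moves k X" if "M \<in> moves k (subtopology X R)" for M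
    using that sub by (cases k) (auto simp: singletons_def)
  define \<G>' where "\<G>' l = {V \<in> \<G> l. X closure_of V \<subseteq> R \<and> V \<subseteq> R}" for l
  show ?thesis
  proof (rule controlledI)
    show "pi_rule (subtopology X R) \<G>'"
      unfolding pi_rule_def
    proof (intro allI conjI ballI impI)
      show "\<G>' l \<subseteq> nonempty_open (subtopology X R)" for l
        using pi_ruleD(1)[OF \<G>] sub by (auto simp: \<G>'_def)
      show "V \<in> \<G>' l" if W: "W \<in> \<G>' l" and V: "V \<in> nonempty_open (subtopology X R)" "V \<subseteq> W" for l W V
      proof -
        have "V \<in> \<G> l"
          using pi_ruleD(2)[OF \<G>, of W] W V sub by (auto simp: \<G>'_def)
        moreover have "X closure_of V \<subseteq> R"
          using closure_of_mono[OF V(2), of X] W by (auto simp: \<G>'_def)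
        ultimately show ?thesis using V(1) sub by (auto simp: \<G>'_def)
      qed
      show "\<exists>W\<in>\<G>' l. W \<subseteq> V" if V: "V \<in> nonempty_open (subtopology X R)" for l V
      proof -
        have VX: "V \<in> nonempty_open X" "V \<subseteq> R" using V sub by auto
        obtain W' where W': "W' \<in> nonempty_open X" "W' \<subseteq> V" "X closure_of W' \<subseteq> V"
          by (rule regular_space_shrink[OF reg VX(1)])
        obtain W where W: "W \<in> \<G> l" "W \<subseteq> W'"
          using pi_ruleD(3)[OF \<G> W'(1)] by blast
        have "X closure_of W \<subseteq> R"
          using closure_of_mono[OF W(2), of X] W'(3) VX(2) by blast
        then show ?thesis
          using W W'(2) VX(2) by (intro bexI[of _ W]) (auto simp: \<G>'_def)
      qed
    qed
    fix W M assume p: "controlled_play k (subtopology X R) \<G>' W M"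
    obtain z N where dec: "decseq W" and z: "\<And>n. z \<in> W n"
      and M: "\<And>n. M n \<in> moves k (subtopology X R)" "\<And>n. M n \<subseteq> W n"
      and N: "\<And>n. n \<ge> N \<Longrightarrow> W n \<in> \<G>' (map M [0..<n])"
      by (rule controlled_playE[OF p]) (rule that; assumption)
    have "controlled_play k X \<G> W M"
      unfolding controlled_play_def
    proof (intro conjI allI exI[of _ N] impI)
      have "z \<in> (\<Inter>n. W n)" using z by blast
      then show "(\<Inter>n. W n) \<noteq> {}" by blast
      show "W n \<in> \<G> (map M [0..<n])" if "N \<le> n" for n
        using N[OF that] by (simp add: \<G>'_def)
    qed (use dec M moves_sub in auto)
    then have "\<Q> (limit_ultrafilters X M)" by (rule play)
    moreover have "limit_ultrafilters X M \<subseteq> limit_ultrafilters (subtopology X R) M"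
    proof
      fix U assume "U \<in> limit_ultrafilters X M"
      then obtain b where U: "free_ultrafilter U" and b: "set_limit X M b U"
        by (auto simp: limit_ultrafilters_def)
      have "b \<in> X closure_of W N"
      proof (rule set_limit_in_closure[OF U b])
        show "M n \<subseteq> W N" if "n \<ge> N" for n
          using M(2)[of n] decseqD[OF dec that] by blast
      qed
      then have "b \<in> R"
        using N[of N] by (auto simp: \<G>'_def)
      then have "set_limit (subtopology X R) M b U"
        using b openin_open_subtopology[OF R] by (auto simp: set_limit_def)
      then show "U \<in> limit_ultrafilters (subtopology X R) M"
        using U by (auto simp: limit_ultrafilters_def)
    qed
    ultimately show "\<Q> (limit_ultrafilters (subtopology X R) M)"
      using monoD_bool[OF Q] by blast
  qed
qed

lemma moves_prod_box:
  assumes "M \<in> moves k (prod_topology X Y)"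
  shows "\<exists>C. fst C \<in> moves k X \<and> snd C \<in> moves k Y \<and> fst C \<times> snd C \<subseteq> M"
proof (cases k)
  case Points
  then obtain x y where "M = {(x, y)}" "x \<in> topspace X" "y \<in> topspace Y"
    using assms by (auto simp: singletons_def)
  then show ?thesis
    using Points by (intro exI[of _ "({x}, {y})"]) (auto simp: singletons_def)
next
  case Opens
  then have M: "openin (prod_topology X Y) M" "M \<noteq> {}"
    using assms by (auto simp: nonempty_open_def)
  then obtain x y where "(x, y) \<in> M" by auto
  then obtain A B where "openin X A" "openin Y B" "x \<in> A" "y \<in> B" "A \<times> B \<subseteq> M"
    using M(1) unfolding openin_prod_topology_alt by meson
  then show ?thesis
    using Opens by (intro exI[of _ "(A, B)"]) (auto simp: nonempty_open_def)
qed

text \<open>A free ultrafilter along which the first coordinates converge serves the second coordinates as well,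
since these converge along every free ultrafilter.\<close>

lemma controlled_prod_topology:
  assumes ctrlX: "controlled \<Q> k X" and ctrlY: "controlled every_ultrafilter k Y" and Q: "mono \<Q>"
  shows "controlled \<Q> k (prod_topology X Y)"
proof -
  let ?Z = "prod_topology X Y"
  obtain \<G>X where GX: "pi_rule X \<G>X"
    and playX: "\<And>W M. controlled_play k X \<G>X W M \<Longrightarrow> \<Q> (limit_ultrafilters X M)"
    using ctrlX by (rule controlledE) blast
  obtain \<G>Y where GY: "pi_rule Y \<G>Y"
    and playY: "\<And>W M. controlled_play k Y \<G>Y W M \<Longrightarrow> every_ultrafilter (limit_ultrafilters Y M)"
    using ctrlY by (rule controlledE) blast
  define C where "C M = (SOME C. fst C \<in> moves k X \<and> snd C \<in> moves k Y \<and> fst C \<times> snd C \<subseteq> M)" for M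
  define A where "A M = fst (C M)" for M
  define B where "B M = snd (C M)" for M
  have box: "A M \<in> moves k X" "B M \<in> moves k Y" "A M \<times> B M \<subseteq> M" if "M \<in> moves k ?Z" for M
    using someI_ex[OF moves_prod_box[OF that]] by (simp_all add: A_def B_def C_def)
  have fst_open: "fst ` V \<in> nonempty_open X" "snd ` V \<in> nonempty_open Y" if "V \<in> nonempty_open ?Z" for V
    using that open_map_fst[of X Y] open_map_snd[of X Y] by (auto simp: nonempty_open_def open_map_def)
  define \<G> where "\<G> l = {W \<in> nonempty_open ?Z. fst ` W \<in> \<G>X (map A l) \<and> snd ` W \<in> \<G>Y (map B l)}" for l
  show ?thesis
  proof (rule controlledI)
    show "pi_rule ?Z \<G>"
      unfolding pi_rule_def
    proof (intro allI conjI ballI impI)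
      show "\<G> l \<subseteq> nonempty_open ?Z" for l by (auto simp: \<G>_def)
      show "V \<in> \<G> l" if W: "W \<in> \<G> l" and V: "V \<in> nonempty_open ?Z" "V \<subseteq> W" for l W V
      proof -
        have "fst ` V \<in> \<G>X (map A l)"
          by (rule pi_ruleD(2)[OF GX, of "fst ` W"]) (use W V fst_open in \<open>auto simp: \<G>_def\<close>)
        moreover have "snd ` V \<in> \<G>Y (map B l)"
          by (rule pi_ruleD(2)[OF GY, of "snd ` W"]) (use W V fst_open in \<open>auto simp: \<G>_def\<close>)
        ultimately show ?thesis using V(1) by (simp add: \<G>_def)
      qed
      show "\<exists>W\<in>\<G> l. W \<subseteq> V" if V: "V \<in> nonempty_open ?Z" for l V
      proof -
        obtain D where D: "fst D \<in> moves Opens X" "snd D \<in> moves Opens Y" "fst D \<times> snd D \<subseteq> V"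
          using moves_prod_box[of V Opens X Y] V by auto
        obtain W1 where W1: "W1 \<in> \<G>X (map A l)" "W1 \<subseteq> fst D"
          using pi_ruleD(3)[OF GX, of "fst D"] D(1) by auto
        obtain W2 where W2: "W2 \<in> \<G>Y (map B l)" "W2 \<subseteq> snd D"
          using pi_ruleD(3)[OF GY, of "snd D"] D(2) by auto
        have OW: "W1 \<in> nonempty_open X" "W2 \<in> nonempty_open Y"
          by (rule pi_ruleD(1)[OF GX W1(1)], rule pi_ruleD(1)[OF GY W2(1)])
        then have "W1 \<times> W2 \<in> nonempty_open ?Z"
          by (auto simp: nonempty_open_def openin_prod_Times_iff)
        moreover have "fst ` (W1 \<times> W2) = W1" "snd ` (W1 \<times> W2) = W2"
          using OW by (auto simp: nonempty_open_def fst_image_times snd_image_times)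
        ultimately have "W1 \<times> W2 \<in> \<G> l"
          using W1(1) W2(1) by (simp add: \<G>_def)
        moreover have "W1 \<times> W2 \<subseteq> V"
          using W1(2) W2(2) D(3) by blast
        ultimately show ?thesis by blast
      qed
    qed
    fix W M assume p: "controlled_play k ?Z \<G> W M"
    obtain z N where dec: "decseq W" and z: "\<And>n. z \<in> W n"
      and M: "\<And>n. M n \<in> moves k ?Z" "\<And>n. M n \<subseteq> W n"
      and N: "\<And>n. n \<ge> N \<Longrightarrow> W n \<in> \<G> (map M [0..<n])"
      by (rule controlled_playE[OF p]) (rule that; assumption)
    have proj: "A (M n) \<subseteq> fst ` W n" "B (M n) \<subseteq> snd ` W n" for n
    proof -
      have "A (M n) \<times> B (M n) \<subseteq> W n" using box(3)[OF M(1)] M(2) by blast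
      moreover have "A (M n) \<noteq> {}" "B (M n) \<noteq> {}"
        using moves_nonempty[OF box(1)[OF M(1)]] moves_nonempty[OF box(2)[OF M(1)]] by auto
      ultimately show "A (M n) \<subseteq> fst ` W n" "B (M n) \<subseteq> snd ` W n"
        by force+
    qed
    have "controlled_play k X \<G>X (\<lambda>n. fst ` W n) (\<lambda>n. A (M n))"
      unfolding controlled_play_def
    proof (intro conjI allI exI[of _ N] impI)
      show "decseq (\<lambda>n. fst ` W n)"
        using dec unfolding decseq_def by (simp add: image_mono)
      have "fst z \<in> (\<Inter>n. fst ` W n)" using z by blast
      then show "(\<Inter>n. fst ` W n) \<noteq> {}" by blast
      show "fst ` W n \<in> \<G>X (map (\<lambda>n. A (M n)) [0..<n])" if "N \<le> n" for n
        using N[OF that] by (simp add: \<G>_def o_def)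
    qed (use proj box(1)[OF M(1)] in auto)
    then have QX: "\<Q> (limit_ultrafilters X (\<lambda>n. A (M n)))" by (rule playX)
    have "controlled_play k Y \<G>Y (\<lambda>n. snd ` W n) (\<lambda>n. B (M n))"
      unfolding controlled_play_def
    proof (intro conjI allI exI[of _ N] impI)
      show "decseq (\<lambda>n. snd ` W n)"
        using dec unfolding decseq_def by (simp add: image_mono)
      have "snd z \<in> (\<Inter>n. snd ` W n)" using z by blast
      then show "(\<Inter>n. snd ` W n) \<noteq> {}" by blast
      show "snd ` W n \<in> \<G>Y (map (\<lambda>n. B (M n)) [0..<n])" if "N \<le> n" for n
        using N[OF that] by (simp add: \<G>_def o_def)
    qed (use proj box(2)[OF M(1)] in auto)
    then have QY: "every_ultrafilter (limit_ultrafilters Y (\<lambda>n. B (M n)))" by (rule playY)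
    have "limit_ultrafilters X (\<lambda>n. A (M n)) \<subseteq> limit_ultrafilters ?Z M"
    proof
      fix U assume "U \<in> limit_ultrafilters X (\<lambda>n. A (M n))"
      then obtain a where U: "free_ultrafilter U" and a: "set_limit X (\<lambda>n. A (M n)) a U"
        by (auto simp: limit_ultrafilters_def)
      have "U \<in> limit_ultrafilters Y (\<lambda>n. B (M n))"
        using QY U unfolding every_ultrafilter_def by blast
      then obtain b where b: "set_limit Y (\<lambda>n. B (M n)) b U"
        by (auto simp: limit_ultrafilters_def)
      have "set_limit ?Z M (a, b) U"
        unfolding set_limit_def
      proof (intro conjI allI impI)
        show "(a, b) \<in> topspace ?Z" using a b by (simp add: set_limit_def)
        fix G assume "openin ?Z G \<and> (a, b) \<in> G"
        then obtain G1 G2 where G: "openin X G1" "openin Y G2" "a \<in> G1" "b \<in> G2" "G1 \<times> G2 \<subseteq> G"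
          unfolding openin_prod_topology_alt by meson
        have "eventually (\<lambda>n. A (M n) \<inter> G1 \<noteq> {}) U"
          using a G by (simp add: set_limit_def)
        moreover have "eventually (\<lambda>n. B (M n) \<inter> G2 \<noteq> {}) U"
          using b G by (simp add: set_limit_def)
        ultimately show "eventually (\<lambda>n. M n \<inter> G \<noteq> {}) U"
        proof eventually_elim
          case (elim n)
          then obtain u v where "u \<in> A (M n)" "u \<in> G1" "v \<in> B (M n)" "v \<in> G2" by blast
          then have "(u, v) \<in> M n" "(u, v) \<in> G" using box(3)[OF M(1)] G(5) by blast+
          then show ?case by blast
        qed
      qed
      then show "U \<in> limit_ultrafilters ?Z M"
        using U by (auto simp: limit_ultrafilters_def)
    qed
    then show "\<Q> (limit_ultrafilters ?Z M)"
      using monoD_bool[OF Q] QX by blast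
  qed
qed

lemma moves_product_box:
  assumes "M \<in> moves k (product_topology F I)"
  shows "\<exists>B. (\<forall>i\<in>I. B i \<in> moves k (F i)) \<and> PiE I B \<subseteq> M \<and>
     (k = Opens \<longrightarrow> finite {i \<in> I. B i \<noteq> topspace (F i)})"
proof (cases k)
  case Points
  then obtain f where f: "M = {f}" "f \<in> topspace (product_topology F I)"
    using assms by (auto simp: singletons_def)
  then have "f \<in> extensional I" "\<And>i. i \<in> I \<Longrightarrow> f i \<in> topspace (F i)" by (auto simp: PiE_def)
  then have "PiE I (\<lambda>i. {f i}) = M" "\<forall>i\<in>I. {f i} \<in> moves k (F i)"
    using f(1) Points by (auto simp: PiE_singleton singletons_def)
  then show ?thesis
    using Points by (intro exI[of _ "\<lambda>i. {f i}"]) simp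
next
  case Opens
  then have M: "openin (product_topology F I) M" "M \<noteq> {}"
    using assms by (auto simp: nonempty_open_def)
  then obtain f where "f \<in> M" by auto
  then obtain B where B: "finite {i \<in> I. B i \<noteq> topspace (F i)}" "\<forall>i\<in>I. openin (F i) (B i)"
    "f \<in> PiE I B" "PiE I B \<subseteq> M"
    using M(1) unfolding openin_product_topology_alt by meson
  then have "\<forall>i\<in>I. B i \<in> nonempty_open (F i)"
    by (auto simp: nonempty_open_def dest: PiE_mem)
  then show ?thesis
    using Opens B by (intro exI[of _ B]) simp
qed

text \<open>Each move is shrunk to a box. The rule of a factor is imposed in the coordinates \<open>K l\<close>: for open
moves, those in the supports of the boxes already played; for points, the first ones in an enumeration
of the countable index set. Every coordinate is eventually subject to its rule, except those in which
all boxes are full, where any point is a limit. As convergence holds along every free ultrafilter, one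
ultrafilter serves all coordinates.\<close>

lemma controlled_product_topology:
  fixes F :: "'i \<Rightarrow> 'a topology"
  assumes ctrl: "\<And>i. i \<in> I \<Longrightarrow> controlled every_ultrafilter k (F i)"
    and nonempty: "\<And>i. i \<in> I \<Longrightarrow> topspace (F i) \<noteq> {}"
    and count: "k = Points \<Longrightarrow> countable I"
  shows "controlled every_ultrafilter k (product_topology F I)"
proof -
  let ?Z = "product_topology F I"
  define R where "R i = (SOME \<G>. pi_rule (F i) \<G> \<and>
     (\<forall>W M. controlled_play k (F i) \<G> W M \<longrightarrow> every_ultrafilter (limit_ultrafilters (F i) M)))" for i
  have R: "pi_rule (F i) (R i) \<and>
     (\<forall>W M. controlled_play k (F i) (R i) W M \<longrightarrow> every_ultrafilter (limit_ultrafilters (F i) M))"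
    if "i \<in> I" for i
    unfolding R_def by (rule someI_ex[OF ctrl[OF that, unfolded controlled_def]])
  define B where "B M = (SOME B. (\<forall>i\<in>I. B i \<in> moves k (F i)) \<and> PiE I B \<subseteq> M \<and>
     (k = Opens \<longrightarrow> finite {i \<in> I. B i \<noteq> topspace (F i)}))" for M
  have B: "\<And>i. i \<in> I \<Longrightarrow> B M i \<in> moves k (F i)" "PiE I (B M) \<subseteq> M"
    "k = Opens \<Longrightarrow> finite {i \<in> I. B M i \<noteq> topspace (F i)}" if "M \<in> moves k ?Z" for M
    using someI_ex[OF moves_product_box[OF that]] unfolding B_def by auto
  define J where "J n M = (if k = Points then {i \<in> I. to_nat_on I i \<le> n}
     else if M \<in> moves k ?Z then {i \<in> I. B M i \<noteq> topspace (F i)} else {})" for n :: nat and M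
  have finJ: "finite (J n M)" for n M
  proof (cases k)
    case Points
    then have "inj_on (to_nat_on I) (J n M)"
      using inj_on_to_nat_on[OF count] by (auto simp: J_def intro: inj_on_subset)
    moreover have "to_nat_on I ` J n M \<subseteq> {..n}"
      using Points by (auto simp: J_def)
    ultimately show ?thesis
      by (meson finite_atMost finite_imageD finite_subset)
  next
    case Opens
    then show ?thesis using B(3)[of M] by (simp add: J_def)
  qed
  have JI: "J n M \<subseteq> I" for n M by (auto simp: J_def)
  define K where "K l = (\<Union>n<length l. J n (l ! n))" for l
  have finK: "finite (K l)" and KI: "K l \<subseteq> I" for l
    using finJ subsetD[OF JI] by (auto simp: K_def)
  define \<G> where "\<G> l = {W \<in> nonempty_open ?Z. \<forall>i\<in>K l. (\<lambda>x. x i) ` W \<in> R i (map (\<lambda>M. B M i) l)}" for l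
  have proj_open: "(\<lambda>x. x i) ` V \<in> nonempty_open (F i)" if "V \<in> nonempty_open ?Z" "i \<in> I" for V i
    using that open_map_product_projection[of i I F] by (auto simp: nonempty_open_def open_map_def)
  show ?thesis
  proof (rule controlledI)
    show "pi_rule ?Z \<G>"
      unfolding pi_rule_def
    proof (intro allI conjI ballI impI)
      show "\<G> l \<subseteq> nonempty_open ?Z" for l by (auto simp: \<G>_def)
      show "V \<in> \<G> l" if W: "W \<in> \<G> l" and V: "V \<in> nonempty_open ?Z" "V \<subseteq> W" for l W V
      proof -
        have "(\<lambda>x. x i) ` V \<in> R i (map (\<lambda>M. B M i) l)" if i: "i \<in> K l" for i
        proof -
          have iI: "i \<in> I" using i KI by blast
          show ?thesis
            by (rule pi_ruleD(2)[OF conjunct1[OF R[OF iI]], of "(\<lambda>x. x i) ` W"])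
              (use W V i proj_open[OF V(1) iI] in \<open>auto simp: \<G>_def\<close>)
        qed
        then show ?thesis using V(1) by (simp add: \<G>_def)
      qed
      show "\<exists>W\<in>\<G> l. W \<subseteq> V" if V: "V \<in> nonempty_open ?Z" for l V
      proof -
        obtain D where D: "\<And>i. i \<in> I \<Longrightarrow> D i \<in> nonempty_open (F i)" "PiE I D \<subseteq> V"
          "finite {i \<in> I. D i \<noteq> topspace (F i)}"
          using moves_product_box[of V Opens F I] V by auto
        define w where "w i = (SOME W. W \<in> R i (map (\<lambda>M. B M i) l) \<and> W \<subseteq> D i)" for i
        have w: "w i \<in> R i (map (\<lambda>M. B M i) l) \<and> w i \<subseteq> D i" if "i \<in> I" for i
        proof -
          have "\<exists>W. W \<in> R i (map (\<lambda>M. B M i) l) \<and> W \<subseteq> D i"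
            using pi_ruleD(3)[OF conjunct1[OF R[OF that]] D(1)[OF that]] by blast
          then show ?thesis unfolding w_def by (rule someI_ex)
        qed
        define E where "E i = (if i \<in> K l then w i else D i)" for i
        have EO: "E i \<in> nonempty_open (F i)" if "i \<in> I" for i
          using pi_ruleD(1)[OF conjunct1[OF R[OF that]]] w[OF that] D(1)[OF that] by (auto simp: E_def)
        have ED: "E i \<subseteq> D i" if "i \<in> I" for i
          using w[OF that] by (auto simp: E_def)
        have ne: "PiE I E \<noteq> {}"
          using EO nonempty_openD(2) by (auto simp: PiE_eq_empty_iff)
        have "{i \<in> I. E i \<noteq> topspace (F i)} \<subseteq> K l \<union> {i \<in> I. D i \<noteq> topspace (F i)}"
          by (auto simp: E_def)
        then have "finite {i \<in> I. E i \<noteq> topspace (F i)}"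
          using finK D(3) by (meson finite_UnI finite_subset)
        then have "openin ?Z (PiE I E)"
          using EO nonempty_openD(1) by (auto simp: openin_PiE_gen)
        then have "PiE I E \<in> nonempty_open ?Z"
          using ne by (simp add: nonempty_open_def)
        moreover have "(\<lambda>x. x i) ` PiE I E \<in> R i (map (\<lambda>M. B M i) l)" if "i \<in> K l" for i
        proof -
          have "i \<in> I" using that KI by blast
          moreover from this have "(\<lambda>x. x i) ` PiE I E = E i"
            using ne by (simp add: image_projection_PiE)
          ultimately show ?thesis using w[of i] that by (simp add: E_def)
        qed
        moreover have "PiE I E \<subseteq> V"
          using PiE_mono[of I E D] ED D(2) by blast
        ultimately show ?thesis by (intro bexI[of _ "PiE I E"]) (auto simp: \<G>_def)
      qed
    qed
    fix W M assume p: "controlled_play k ?Z \<G> W M"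
    obtain z N where dec: "decseq W" and z: "\<And>n. z \<in> W n"
      and M: "\<And>n. M n \<in> moves k ?Z" "\<And>n. M n \<subseteq> W n"
      and N: "\<And>n. n \<ge> N \<Longrightarrow> W n \<in> \<G> (map M [0..<n])"
      by (rule controlled_playE[OF p]) (rule that; assumption)
    note BM = B[OF M(1)]
    have ne: "PiE I (B (M n)) \<noteq> {}" for n
      using moves_nonempty[OF BM(1)] by (auto simp: PiE_eq_empty_iff)
    show "every_ultrafilter (limit_ultrafilters ?Z M)"
      unfolding every_ultrafilter_def
    proof
      fix U assume "U \<in> {U. free_ultrafilter U}"
      then have U: "free_ultrafilter U" by simp
      have coord: "\<exists>b. set_limit (F i) (\<lambda>n. B (M n) i) b U" if i: "i \<in> I" for i
      proof (cases "\<exists>m. i \<in> J m (M m)")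
        case True
        then obtain m where m: "i \<in> J m (M m)" by blast
        have "controlled_play k (F i) (R i) (\<lambda>n. (\<lambda>x. x i) ` W n) (\<lambda>n. B (M n) i)"
          unfolding controlled_play_def
        proof (intro conjI allI exI[of _ "max N (Suc m)"] impI)
          show "decseq (\<lambda>n. (\<lambda>x. x i) ` W n)"
            using dec unfolding decseq_def by (simp add: image_mono)
          have "z i \<in> (\<Inter>n. (\<lambda>x. x i) ` W n)" using z by blast
          then show "(\<Inter>n. (\<lambda>x. x i) ` W n) \<noteq> {}" by blast
          show "B (M n) i \<in> moves k (F i)" for n by (rule BM(1)[OF i])
          show "B (M n) i \<subseteq> (\<lambda>x. x i) ` W n" for n
          proof -
            have "(\<lambda>x. x i) ` PiE I (B (M n)) = B (M n) i"
              using ne[of n] i by (simp add: image_projection_PiE)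
            moreover have "PiE I (B (M n)) \<subseteq> W n" using BM(2) M(2) by blast
            ultimately show ?thesis by (metis image_mono)
          qed
          show "(\<lambda>x. x i) ` W n \<in> R i (map (\<lambda>n. B (M n) i) [0..<n])" if n: "max N (Suc m) \<le> n" for n
          proof -
            have "i \<in> K (map M [0..<n])"
              using m n by (auto simp: K_def intro!: bexI[of _ m])
            then show ?thesis using N[of n] n by (auto simp: \<G>_def o_def)
          qed
        qed
        then have "every_ultrafilter (limit_ultrafilters (F i) (\<lambda>n. B (M n) i))"
          using R[OF i] by blast
        then have "U \<in> limit_ultrafilters (F i) (\<lambda>n. B (M n) i)"
          using U unfolding every_ultrafilter_def by blast
        then show ?thesis by (simp add: limit_ultrafilters_def)
      next
        case False
        have k: "k \<noteq> Points"
        proof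
          assume "k = Points"
          then have "i \<in> J (to_nat_on I i) (M (to_nat_on I i))" using i by (simp add: J_def)
          then show False using False by blast
        qed
        have full: "B (M n) i = topspace (F i)" for n
        proof (rule ccontr)
          assume "B (M n) i \<noteq> topspace (F i)"
          then have "i \<in> J n (M n)" using i k M(1) by (simp add: J_def)
          then show False using False by blast
        qed
        obtain b where "b \<in> topspace (F i)" using nonempty[OF i] by blast
        then have "set_limit (F i) (\<lambda>n. B (M n) i) b U"
          unfolding set_limit_def full
          by (intro conjI allI impI always_eventually) (auto dest: openin_subset)
        then show ?thesis by blast
      qed
      \<comment> \<open>a basic neighborhood of \<open>b\<close> restricts finitely many coordinates, so boxes meet it along \<open>U\<close>\<close>
      define b where "b = (\<lambda>i\<in>I. SOME b. set_limit (F i) (\<lambda>n. B (M n) i) b U)"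
      have b: "set_limit (F i) (\<lambda>n. B (M n) i) (b i) U" if "i \<in> I" for i
        using someI_ex[OF coord[OF that]] that by (simp add: b_def)
      have "set_limit ?Z M b U"
        unfolding set_limit_def
      proof (intro conjI allI impI)
        show "b \<in> topspace ?Z"
          using b by (auto simp: set_limit_def b_def PiE_def)
        fix G assume "openin ?Z G \<and> b \<in> G"
        then obtain V where V: "finite {i \<in> I. V i \<noteq> topspace (F i)}" "\<forall>i\<in>I. openin (F i) (V i)"
          "b \<in> PiE I V" "PiE I V \<subseteq> G"
          unfolding openin_product_topology_alt by meson
        have "eventually (\<lambda>n. \<forall>i\<in>{i \<in> I. V i \<noteq> topspace (F i)}. B (M n) i \<inter> V i \<noteq> {}) U"
        proof (rule eventually_ball_finite[OF V(1)], rule ballI)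
          fix i assume i: "i \<in> {i \<in> I. V i \<noteq> topspace (F i)}"
          then have "openin (F i) (V i)" "b i \<in> V i" using V(2,3) by (auto dest: PiE_mem)
          then show "eventually (\<lambda>n. B (M n) i \<inter> V i \<noteq> {}) U"
            using b[of i] i by (simp add: set_limit_def)
        qed
        then show "eventually (\<lambda>n. M n \<inter> G \<noteq> {}) U"
        proof eventually_elim
          case (elim n)
          have "B (M n) i \<inter> V i \<noteq> {}" if i: "i \<in> I" for i
          proof (cases "V i = topspace (F i)")
            case True
            then show ?thesis
              using moves_nonempty[OF BM(1)[OF i, of n]] moves_subset[OF BM(1)[OF i, of n]] by auto
          qed (use elim i in blast)
          then have "PiE I (\<lambda>i. B (M n) i \<inter> V i) \<noteq> {}"
            by (auto simp: PiE_eq_empty_iff)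
          moreover have "PiE I (\<lambda>i. B (M n) i \<inter> V i) \<subseteq> PiE I (B (M n)) \<inter> PiE I V"
            by (auto simp: PiE_iff)
          ultimately show ?case using BM(2)[of n] V(4) by blast
        qed
      qed
      then show "U \<in> limit_ultrafilters ?Z M"
        using U by (auto simp: limit_ultrafilters_def)
    qed
  qed
qed

section \<open>The generated classes\<close>

text \<open>The invariant of the inductive generation of the classes: regularity accompanies control since the
passage to open subspaces relies on it, and nonempty factors are needed for products.\<close>

definition regular_controlled :: "(nat filter set \<Rightarrow> bool) \<Rightarrow> move_kind \<Rightarrow> 'a topology \<Rightarrow> bool" where
  "regular_controlled \<Q> k X \<longleftrightarrow> topspace X \<noteq> {} \<and> regular_space X \<and> controlled \<Q> k X"

lemma regular_controlled_homeomorphic: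
  assumes Y: "regular_controlled \<Q> k Y" and hom: "Z homeomorphic_space Y" and Q: "mono \<Q>"
  shows "regular_controlled \<Q> k Z"
proof -
  have YZ: "Y homeomorphic_space Z"
    using hom homeomorphic_space_sym by blast
  have "regular_space Z"
    using Y homeomorphic_regular_space[OF YZ] by (simp add: regular_controlled_def)
  moreover have "controlled \<Q> k Z"
    using Y controlled_homeomorphic_space[OF YZ _ Q] by (simp add: regular_controlled_def)
  moreover have "topspace Z \<noteq> {}"
    using Y homeomorphic_empty_space[OF YZ] null_topspace_iff_trivial[of Y] null_topspace_iff_trivial[of Z]
    by (simp add: regular_controlled_def)
  ultimately show ?thesis by (simp add: regular_controlled_def)
qed

lemma regular_controlled_open_subspace:
  assumes Y: "regular_controlled \<Q> k Y" and U: "openin Y U" "U \<noteq> {}" and Q: "mono \<Q>"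
  shows "regular_controlled \<Q> k (subtopology Y U)"
proof -
  have "topspace (subtopology Y U) = U"
    using openin_subset[OF U(1)] by (simp add: inf.absorb2)
  then show ?thesis
    using Y U(2) controlled_open_subspace[OF _ _ Q U(1)] regular_space_subtopology[of Y U]
    unfolding regular_controlled_def by simp
qed

lemma regular_controlled_prod:
  assumes Y: "regular_controlled \<Q> k Y" and T: "regular_controlled every_ultrafilter k T"
    and Q: "mono \<Q>"
  shows "regular_controlled \<Q> k (prod_topology Y T)"
  using Y T controlled_prod_topology[OF _ _ Q, of k Y T]
  by (simp add: regular_controlled_def regular_space_prod_topology)

lemma regular_controlled_product:
  assumes F: "\<And>i. i \<in> I \<Longrightarrow> regular_controlled every_ultrafilter k (F i)"
    and count: "k = Points \<Longrightarrow> countable I"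
  shows "regular_controlled every_ultrafilter k (product_topology F I)"
proof -
  have "controlled every_ultrafilter k (product_topology F I)"
    by (rule controlled_product_topology) (use F count in \<open>auto simp: regular_controlled_def\<close>)
  moreover have "regular_space (product_topology F I)"
    using F by (simp add: regular_space_product_topology regular_controlled_def)
  moreover have "topspace (product_topology F I) \<noteq> {}"
    using F unfolding topspace_product_topology PiE_eq_empty_iff by (auto simp: regular_controlled_def)
  ultimately show ?thesis by (simp add: regular_controlled_def)
qed

lemma p_space_regular_controlled:
  assumes "topspace Y \<noteq> {}" "p_space Y"
  shows "regular_controlled every_ultrafilter k Y"
proof -
  have "completely_regular_space Y"
    using assms(2) by (simp add: p_space_def)
  then show ?thesis
    using assms p_space_controlled[of Y k] completely_regular_imp_regular_space[of Y]
    by (simp add: regular_controlled_def)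
qed

lemma class_Pk_controlled: "class_Pk Y \<Longrightarrow> regular_controlled every_ultrafilter Opens Y"
proof (induction rule: class_Pk.induct)
  case (Pk_p Y)
  then show ?case by (rule p_space_regular_controlled)
next
  case (Pk_Sigma Y)
  then show ?case by (simp add: regular_controlled_def strongly_Sigma_space_controlled)
next
  case (Pk_product I F Z)
  show ?case
    by (rule regular_controlled_homeomorphic[OF regular_controlled_product Pk_product.hyps(2)
          mono_every_ultrafilter]) (use Pk_product.IH in auto)
next
  case (Pk_open Y U)
  show ?case
    by (rule regular_controlled_open_subspace[OF Pk_open.IH Pk_open.hyps(2,3) mono_every_ultrafilter])
qed

lemma class_Pc_controlled: "class_Pc Y \<Longrightarrow> regular_controlled every_ultrafilter Points Y"
proof (induction rule: class_Pc.induct)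
  case (Pc_p Y)
  then show ?case by (rule p_space_regular_controlled)
next
  case (Pc_Sigma Y)
  then show ?case by (simp add: regular_controlled_def strongly_Sigma_space_controlled)
next
  case (Pc_product I F Z)
  show ?case
    by (rule regular_controlled_homeomorphic[OF regular_controlled_product Pc_product.hyps(2)
          mono_every_ultrafilter]) (use Pc_product.IH in auto)
next
  case (Pc_open Y U)
  show ?case
    by (rule regular_controlled_open_subspace[OF Pc_open.IH Pc_open.hyps(2,3) mono_every_ultrafilter])
qed

lemma class_Kh_controlled: "class_Kh Y \<Longrightarrow> regular_controlled some_ultrafilter Points Y"
proof (induction rule: class_Kh.induct)
  case (Kh_Sigma Y)
  then show ?case by (simp add: regular_controlled_def Sigma_space_controlled)
next
  case (Kh_wDelta Y)
  then show ?case by (simp add: regular_controlled_def wDelta_space_controlled)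
next
  case (Kh_product Y T Z)
  show ?case
    by (rule regular_controlled_homeomorphic[OF regular_controlled_prod[OF Kh_product.IH
          class_Pc_controlled[OF Kh_product.hyps(2)] mono_some_ultrafilter] Kh_product.hyps(3)
          mono_some_ultrafilter])
next
  case (Kh_open Y U)
  show ?case
    by (rule regular_controlled_open_subspace[OF Kh_open.IH Kh_open.hyps(2,3) mono_some_ultrafilter])
qed

lemma class_K_controlled: "class_K Y \<Longrightarrow> regular_controlled some_ultrafilter Opens Y"
proof (induction rule: class_K.induct)
  case (K_Sigma Y)
  then show ?case by (simp add: regular_controlled_def Sigma_space_controlled)
next
  case (K_wDelta Y)
  then show ?case by (simp add: regular_controlled_def wDelta_space_controlled)
next
  case (K_feebly Y)
  then show ?case by (simp add: regular_controlled_def feebly_compact_space_controlled)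
next
  case (K_product Y T Z)
  show ?case
    by (rule regular_controlled_homeomorphic[OF regular_controlled_prod[OF K_product.IH
          class_Pk_controlled[OF K_product.hyps(2)] mono_some_ultrafilter] K_product.hyps(3)
          mono_some_ultrafilter])
next
  case (K_open Y U)
  show ?case
    by (rule regular_controlled_open_subspace[OF K_open.IH K_open.hyps(2,3) mono_some_ultrafilter])
qed

lemma in_class_Delta_h_controlled:
  assumes "in_class_Delta_h TYPE('u) X"
  shows "controlled some_ultrafilter Points X"
proof -
  obtain Z :: "'u topology" where Z: "class_Kh Z" "X homeomorphic_space Z"
    using assms by (auto simp: in_class_Delta_h_def)
  then have "regular_controlled some_ultrafilter Points X"
    using regular_controlled_homeomorphic[OF class_Kh_controlled[OF Z(1)] Z(2) mono_some_ultrafilter] by simp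
  then show ?thesis by (simp add: regular_controlled_def)
qed

lemma in_class_Delta_controlled:
  assumes "in_class_Delta TYPE('u) X"
  shows "controlled some_ultrafilter Opens X"
proof -
  obtain Z :: "'u topology" where Z: "class_K Z" "X homeomorphic_space Z"
    using assms by (auto simp: in_class_Delta_def)
  then have "regular_controlled some_ultrafilter Opens X"
    using regular_controlled_homeomorphic[OF class_K_controlled[OF Z(1)] Z(2) mono_some_ultrafilter] by simp
  then show ?thesis by (simp add: regular_controlled_def)
qed

lemma class_implications:
  fixes X :: "'a topology"
  assumes ne: "topspace X \<noteq> {}" and reg: "regular_space X"
  shows "(sigma_space X \<longrightarrow>
           (Baire_space X \<longrightarrow> Delta_s_Baire X) \<and>
           (nonmeager_space X \<longrightarrow> Delta_s_nonmeager X)) \<and>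
        (in_class_Delta_h TYPE('u) X \<longrightarrow>
           (Baire_space X \<longrightarrow> Delta_h_Baire X) \<and>
           (nonmeager_space X \<longrightarrow> Delta_h_nonmeager X)) \<and>
        (in_class_Delta TYPE('u) X \<longrightarrow>
           (Baire_space X \<longrightarrow> Delta_Baire X) \<and>
           (nonmeager_space X \<longrightarrow> Delta_nonmeager X))"
proof (intro conjI impI)
  note top = nonmeager_space_imp_nonmeager_open[OF _ ne]
  note Baire = Baire_space_imp_nonmeager_open
  {
    assume "sigma_space X"
    note good = sigma_space_imp_good_Delta_s[OF reg this]
    show "Delta_s_Baire X" if "Baire_space X"
      unfolding Delta_s_Baire_def using good[OF Baire[OF that]] by simp
    show "Delta_s_nonmeager X" if "nonmeager_space X"
      unfolding Delta_s_nonmeager_def using good[OF top[OF that]] by metis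
  }
  {
    assume "in_class_Delta_h TYPE('u) X"
    note good = controlled_imp_good_Delta_h[OF reg _ in_class_Delta_h_controlled[OF this]]
    show "Delta_h_Baire X" if "Baire_space X"
      unfolding Delta_h_Baire_def using good[OF Baire[OF that]] by simp
    show "Delta_h_nonmeager X" if "nonmeager_space X"
      unfolding Delta_h_nonmeager_def using good[OF top[OF that]] by metis
  }
  {
    assume "in_class_Delta TYPE('u) X"
    note good = controlled_imp_good_Delta[OF reg _ in_class_Delta_controlled[OF this]]
    show "Delta_Baire X" if "Baire_space X"
      unfolding Delta_Baire_def using good[OF Baire[OF that]] by simp
    show "Delta_nonmeager X" if "nonmeager_space X"
      unfolding Delta_nonmeager_def using good[OF top[OF that]] by metis
  }
qed

theorem theorem6p1:
  fixes X :: "'a topology"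
  assumes "topspace X \<noteq> {}"
  shows
    "((Gamma_BM_f_nonmeager X \<longrightarrow> Gamma_hat_BM_f_nonmeager X) \<and>
      (Gamma_BM_f_Baire X \<longrightarrow> Gamma_hat_BM_f_Baire X) \<and>
      (Gamma_hat_BM_f_nonmeager X \<longrightarrow> Delta_s_nonmeager X) \<and>
      (Gamma_hat_BM_f_Baire X \<longrightarrow> Delta_s_Baire X) \<and>

      (Gamma_OD_pl_nonmeager X \<longrightarrow> Gamma_hat_OD_pl_nonmeager X) \<and>
      (Gamma_OD_pl_Baire X \<longrightarrow> Gamma_hat_OD_pl_Baire X) \<and>
      (Gamma_hat_OD_pl_nonmeager X \<longrightarrow> Delta_h_nonmeager X) \<and>
      (Gamma_hat_OD_pl_Baire X \<longrightarrow> Delta_h_Baire X) \<and>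

      (Gamma_OD_ol_nonmeager X \<longrightarrow> Gamma_hat_OD_ol_nonmeager X) \<and>
      (Gamma_OD_ol_Baire X \<longrightarrow> Gamma_hat_OD_ol_Baire X) \<and>
      (Gamma_hat_OD_ol_nonmeager X \<longrightarrow> Delta_nonmeager X) \<and>
      (Gamma_hat_OD_ol_Baire X \<longrightarrow> Delta_Baire X) \<and>

      (Gamma_BM_f_nonmeager X \<longrightarrow> Gamma_OD_pl_nonmeager X) \<and>
      (Gamma_BM_f_Baire X \<longrightarrow> Gamma_OD_pl_Baire X) \<and>
      (Gamma_OD_pl_nonmeager X \<longrightarrow> Gamma_OD_ol_nonmeager X) \<and>
      (Gamma_OD_pl_Baire X \<longrightarrow> Gamma_OD_ol_Baire X) \<and>

      (Gamma_hat_BM_f_nonmeager X \<longrightarrow> Gamma_hat_OD_pl_nonmeager X) \<and>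
      (Gamma_hat_BM_f_Baire X \<longrightarrow> Gamma_hat_OD_pl_Baire X) \<and>
      (Gamma_hat_OD_pl_nonmeager X \<longrightarrow> Gamma_hat_OD_ol_nonmeager X) \<and>
      (Gamma_hat_OD_pl_Baire X \<longrightarrow> Gamma_hat_OD_ol_Baire X) \<and>

      (Delta_s_nonmeager X \<longrightarrow> Delta_h_nonmeager X) \<and>
      (Delta_s_Baire X \<longrightarrow> Delta_h_Baire X) \<and>
      (Delta_h_nonmeager X \<longrightarrow> Delta_nonmeager X) \<and>
      (Delta_h_Baire X \<longrightarrow> Delta_Baire X))
     \<and>
     (regular_space X \<longrightarrow>
        (sigma_space X \<longrightarrow>
           (Baire_space X \<longrightarrow> Delta_s_Baire X) \<and>
           (nonmeager_space X \<longrightarrow> Delta_s_nonmeager X)) \<and>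
        (in_class_Delta_h TYPE('u) X \<longrightarrow>
           (Baire_space X \<longrightarrow> Delta_h_Baire X) \<and>
           (nonmeager_space X \<longrightarrow> Delta_h_nonmeager X)) \<and>
        (in_class_Delta TYPE('u) X \<longrightarrow>
           (Baire_space X \<longrightarrow> Delta_Baire X) \<and>
           (nonmeager_space X \<longrightarrow> Delta_nonmeager X)))"
  by (rule conjI[OF game_implications[OF assms] impI[OF class_implications[OF assms]]])

end
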